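(* Let $G$ be a graph, let $S\subseteq V(G)$, and let $k, \ell$ be positive integers. Then, either $G$ contains $k$ vertex-disjoint $S$-rooted models of $K_{1,\ell}$, or there exists a set $X$ of at most $21\ell\cdot(k-1)$ vertices of $G$ such that $G-X$ has no $S$-rooted model of $K_{1, \ell}$.
   Context: All graphs are finite, simple and undirected. $K_{1,\ell}$ denotes the star with $\ell$ branches (one center adjacent to $\ell$ other vertices). A model of a graph $H$ in a graph $G$ is a family $(B_x \mid x\in V(H))$ of pairwise disjoint nonempty subsets of $V(G)$, called branch sets, each inducing a connected subgraph of $G$, such that for every $xy\in E(H)$ there is an edge of $G$ with one endpoint in $B_x$ and one endpoint in $B_y$. Given a set $S$ of vertices, the model is $S$-rooted if every branch set contains a vertex of $S$ ($S$ may contain vertices not in the graph under consideration; so an $S$-rooted model in $G-X$ is an $(S\setminus X)$-rooted model in $G-X$). Models are vertex-disjoint if the unions of their branch sets are pairwise disjoint. $G-X$ is the graph obtained from $G$ by deleting the vertices in $X$. *)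

theory Defs
  imports "Graph_Theory.Digraph_Component" "HOL-Library.Disjoint_Sets"
begin

text \<open>
  Finite simple undirected graphs are finite loop-free symmetric digraphs whose arcs are pairs of
  vertices (\<open>pair_graph\<close>); an undirected edge is a pair of opposite arcs.
\<close>

definition delete_verts :: "('a, 'b) pre_digraph \<Rightarrow> 'a set \<Rightarrow> ('a, 'b) pre_digraph" where
  "delete_verts G X = G \<restriction> (verts G - X)"

definition star_graph :: "nat \<Rightarrow> nat pair_pre_digraph" where
  "star_graph l = \<lparr> pverts = {0..l}, parcs = {0} \<times> {1..l} \<union> {1..l} \<times> {0} \<rparr>"

lemma pair_graph_star_graph: "pair_graph (star_graph l)"
  by unfold_locales (auto simp: star_graph_def symmetric_def sym_def)

text \<open>
  Only the values of \<open>B\<close> on the vertices of \<open>H\<close> matter. The inclusion in \<open>verts G\<close> is needed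
  because \<open>G \<restriction> U\<close> has vertex set \<open>U\<close> even if \<open>U\<close> is not contained in \<open>verts G\<close>.
\<close>

definition is_model :: "('h, 'e) pre_digraph \<Rightarrow> ('a, 'b) pre_digraph \<Rightarrow> ('h \<Rightarrow> 'a set) \<Rightarrow> bool" where
  "is_model H G B \<longleftrightarrow>
     (\<forall>x\<in>verts H. B x \<noteq> {} \<and> B x \<subseteq> verts G \<and> connected (G \<restriction> B x)) \<and>
     disjoint_family_on B (verts H) \<and>
     (\<forall>x y. x \<rightarrow>\<^bsub>H\<^esub> y \<longrightarrow> (\<exists>u\<in>B x. \<exists>v\<in>B y. u \<rightarrow>\<^bsub>G\<^esub> v))"

text \<open>\<open>S\<close> need not be contained in \<open>verts G\<close>.\<close>

definition is_rooted_model ::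
  "'a set \<Rightarrow> ('h, 'e) pre_digraph \<Rightarrow> ('a, 'b) pre_digraph \<Rightarrow> ('h \<Rightarrow> 'a set) \<Rightarrow> bool" where
  "is_rooted_model S H G B \<longleftrightarrow> is_model H G B \<and> (\<forall>x\<in>verts H. B x \<inter> S \<noteq> {})"

definition has_disjoint_rooted_models ::
  "nat \<Rightarrow> 'a set \<Rightarrow> ('h, 'e) pre_digraph \<Rightarrow> ('a, 'b) pre_digraph \<Rightarrow> bool" where
  "has_disjoint_rooted_models k S H G \<longleftrightarrow>
     (\<exists>M :: nat \<Rightarrow> 'h \<Rightarrow> 'a set.
        (\<forall>i<k. is_rooted_model S H G (M i)) \<and>
        disjoint_family_on (\<lambda>i. \<Union>x\<in>verts H. M i x) {..<k})"

end

theory Submission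
  imports Defs
begin

text \<open>
  A tree whose leaves lie in \<open>S\<close> is an \<open>S\<close>-rooted model of a star: cut off the leaves. Let \<open>l \<ge> 3\<close>.
  Among the subgraphs \<open>F\<close> of maximum degree 3 take one that maximises
  (number of leaves in \<open>S\<close>) \<open>- l \<cdot>\<close> (number of components), and then has the fewest edges. It is a
  forest, and with \<open>n\<close> leaves it splits into at least \<open>n / 3l\<close> disjoint models. By maximality no path
  outside \<open>F\<close> attaches a new leaf at a vertex of degree 2, and no path between two vertices of degree 2
  can be traded for an edge of \<open>F\<close> at an \<open>S\<close>-vertex \<open>y\<close> of degree 2, which would turn \<open>y\<close> into a
  leaf. Hence, once the at most \<open>6n\<close> vertices that are leaves, branch vertices, or the first
  \<open>S\<close>-vertex on a walk starting at one of these are deleted, every component that still meets \<open>F\<close>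
  is arranged along a path and contains no rooted \<open>K\<^bsub>1,3\<^esub>\<close>. All remaining models avoid \<open>F\<close>, and
  induction on \<open>k\<close> applies to the graph without \<open>F\<close>.

  If no subcubic tree has more than \<open>l\<close> leaves, the same exchanges are applied to a single tree that
  contains a model and has the least total degree excess over 3: pruning a branch at a vertex of degree
  at least 4 would lower the excess, so this tree has at most \<open>2l\<close> leaves. For \<open>l \<le> 2\<close> a rooted
  model is a connected set with \<open>l + 1\<close> vertices of \<open>S\<close>, and all \<open>S\<close>-vertices of \<open>F\<close> of degree at
  most 2 play the role of the leaves.
\<close>

section \<open>Reachability in symmetric relations\<close>

text \<open>The penalty \<open>l\<close> is what a component must earn: one with at most
  \<open>l\<close> leaves could be dropped without lowering the objective, so in an optimum every
  component has more than \<open>l\<close> leaves and yields a model. The obstacle is that exchanges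
  may merge components or cut one in two. Therefore pairs of a forest and a root set are compared,
  and a shortcut joining two components frees exactly the root that the deleted edge then needs. The
  vertices of \<open>S\<close> next to ends are deleted too because an exchange needs a further
  \<open>S\<close>-vertex of degree 2, and only a vertex not near an end is sure to see one in both
  directions. A star with three branches then fails by pigeonhole: the centre's vertex of
  \<open>S\<close> has only two directions in \<open>F\<close>. This is where
  \<open>l \<ge> 3\<close> enters. The constants: at most \<open>3l\<close> leaves per model and 6
  deleted vertices per leaf cost \<open>18l\<close> deleted vertices for each model found, within
  the allowed \<open>21l\<close>. Forests are symmetric relations in which every edge is a bridge,
  so all exchanges reduce to reachability and degree counts.\<close>

definition bridged :: "'a rel \<Rightarrow> bool" where
  "bridged F \<longleftrightarrow> (\<forall>u v. (u, v) \<in> F \<longrightarrow> (u, v) \<notin> (F - {(u, v), (v, u)})\<^sup>*)"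

text \<open>For a neighbour \<open>z\<close> of \<open>v\<close> in a forest this is the branch at
  \<open>v\<close> through \<open>z\<close>, so an arc names a branch. For \<open>z = v\<close> it
  degenerates to \<open>{v}\<close>, hence the recurring hypothesis that they differ.\<close>

definition side :: "'a rel \<Rightarrow> 'a \<Rightarrow> 'a \<Rightarrow> 'a set" where
  "side F v z = (Restr F (- {v}))\<^sup>* `` {z}"

lemma rtrancl_symD: "sym F \<Longrightarrow> (a, b) \<in> F\<^sup>* \<Longrightarrow> (b, a) \<in> F\<^sup>*"
  using symD[OF sym_rtrancl] .

lemma sym_Restr: "sym F \<Longrightarrow> sym (Restr F U)"
  by (auto simp: sym_def)

text \<open>Stop the walk at its first visit to \<open>v\<close>: the vertex before is reached
  without touching \<open>v\<close>.\<close>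

lemma rtrancl_last_step_before:
  assumes "(x, v) \<in> F\<^sup>*" "x \<noteq> v"
  shows "\<exists>w. (w, v) \<in> F \<and> (x, w) \<in> (Restr F (- {v}))\<^sup>*"
proof -
  have "(x, y) \<in> F\<^sup>* \<Longrightarrow> (y \<noteq> v \<and> (x, y) \<in> (Restr F (- {v}))\<^sup>*) \<or>
      (\<exists>w. (w, v) \<in> F \<and> (x, w) \<in> (Restr F (- {v}))\<^sup>*)" for y
  proof (induction rule: rtrancl_induct)
    case base
    then show ?case using assms(2) by simp
  next
    case (step y z)
    show ?case
    proof (cases "\<exists>w. (w, v) \<in> F \<and> (x, w) \<in> (Restr F (- {v}))\<^sup>*")
      case False
      then have *: "y \<noteq> v" "(x, y) \<in> (Restr F (- {v}))\<^sup>*" using step.IH by auto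
      then have "z \<noteq> v" using False step.hyps by blast
      then have "(y, z) \<in> Restr F (- {v})" using * step.hyps by simp
      then show ?thesis using * \<open>z \<noteq> v\<close> using rtrancl_into_rtrancl by metis
    qed simp
  qed
  then show ?thesis using assms(1) by blast
qed

text \<open>The part of the walk before its first use of the deleted edge survives and ends in
  \<open>y\<close> or \<open>z\<close>.\<close>

lemma rtrancl_remove_edge:
  assumes "(v, r) \<in> H\<^sup>*"
  shows "(v, r) \<in> (H - {(y, z), (z, y)})\<^sup>* \<or> (v, y) \<in> (H - {(y, z), (z, y)})\<^sup>* \<or>
    (v, z) \<in> (H - {(y, z), (z, y)})\<^sup>*"
  using assms
proof (induction rule: rtrancl_induct)
  case (step a b)
  show ?case
  proof (cases "(a, b) \<in> {(y, z), (z, y)}")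
    case True
    then have "a = y \<or> a = z" by auto
    then show ?thesis using step.IH by auto
  next
    case False
    then have "(a, b) \<in> H - {(y, z), (z, y)}" using step.hyps by simp
    then show ?thesis using step.IH rtrancl_into_rtrancl by metis
  qed
qed simp

lemma bridgedD: "bridged F \<Longrightarrow> (u, v) \<in> F \<Longrightarrow> (u, v) \<notin> (F - {(u, v), (v, u)})\<^sup>*"
  unfolding bridged_def by blast

lemma bridged_subset:
  assumes "bridged F" "F' \<subseteq> F"
  shows "bridged F'"
  unfolding bridged_def
proof (intro allI impI notI)
  fix u v assume *: "(u, v) \<in> F'" "(u, v) \<in> (F' - {(u, v), (v, u)})\<^sup>*"
  have "(F' - {(u, v), (v, u)})\<^sup>* \<subseteq> (F - {(u, v), (v, u)})\<^sup>*"
    using assms(2) by (intro rtrancl_mono) auto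
  then have "(u, v) \<in> (F - {(u, v), (v, u)})\<^sup>*" using *(2) by (rule subsetD)
  moreover have "(u, v) \<in> F" using *(1) assms(2) by (rule rev_subsetD)
  ultimately show False using assms(1) bridgedD by metis
qed

text \<open>A connection from \<open>z\<close> to \<open>w\<close> off \<open>v\<close>, followed by
  the edge from \<open>w\<close> to \<open>v\<close>, would bypass the bridge between
  \<open>v\<close> and \<open>z\<close>.\<close>

lemma bridged_neighbours_separated:
  assumes "bridged F" "sym F" "(v, z) \<in> F" "(v, w) \<in> F" "(z, w) \<in> (Restr F (- {v}))\<^sup>*"
  shows "z = w"
proof (rule ccontr)
  assume "z \<noteq> w"
  let ?F = "F - {(v, z), (z, v)}"
  have "v \<noteq> z"
    using assms(1,3) bridgedD by fastforce
  then have "(v, w) \<in> ?F" using assms(4) \<open>z \<noteq> w\<close> by auto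
  have "(Restr F (- {v}))\<^sup>* \<subseteq> ?F\<^sup>*" by (intro rtrancl_mono) auto
  then have "(z, w) \<in> ?F\<^sup>*" using assms(5) by (rule subsetD)
  moreover have "sym ?F" using assms(2) by (auto simp: sym_def)
  ultimately have "(w, z) \<in> ?F\<^sup>*" using rtrancl_symD by metis
  with \<open>(v, w) \<in> ?F\<close> have "(v, z) \<in> ?F\<^sup>*" by (rule converse_rtrancl_into_rtrancl)
  then show False using bridgedD[OF assms(1,3)] by metis
qed

lemma bridged_irrefl: "bridged F \<Longrightarrow> (v, v) \<notin> F"
  using bridgedD by fastforce

lemma side_step:
  assumes "x \<in> side F v z" "(x, x') \<in> F" "x \<noteq> v" "x' \<noteq> v"
  shows "x' \<in> side F v z"
proof -
  have "(z, x) \<in> (Restr F (- {v}))\<^sup>*" using assms(1) by (simp add: side_def)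
  moreover have "(x, x') \<in> Restr F (- {v})" using assms by auto
  ultimately have "(z, x') \<in> (Restr F (- {v}))\<^sup>*" by (rule rtrancl_into_rtrancl)
  then show ?thesis by (simp add: side_def)
qed

lemma not_in_side: "z \<noteq> v \<Longrightarrow> v \<notin> side F v z"
proof
  assume "z \<noteq> v" "v \<in> side F v z"
  then have "(z, v) \<in> (Restr F (- {v}))\<^sup>*" by (simp add: side_def)
  then show False using \<open>z \<noteq> v\<close> by (cases rule: rtranclE) auto
qed

lemma side_refl: "z \<in> side F v z"
  by (simp add: side_def)

lemma side_closed:
  assumes "x \<in> side F v z" "(x, x') \<in> F" "x' \<noteq> v" "z \<noteq> v"
  shows "x' \<in> side F v z"
proof -
  have "x \<noteq> v" using assms(1,4) not_in_side by metis
  then show ?thesis using assms side_step by metis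
qed

text \<open>The branch can be left only through \<open>v\<close>, so a walk from \<open>v\<close>
  that enters it must return to \<open>v\<close> before ending outside; such detours are cut
  off.\<close>

lemma rtrancl_outside_side:
  assumes "(v, x) \<in> F\<^sup>*" "x \<notin> side F v z" "z \<noteq> v"
  shows "(v, x) \<in> (Restr F (- side F v z))\<^sup>*"
proof -
  have "(v, x) \<in> F\<^sup>* \<Longrightarrow> x \<in> side F v z \<or> (v, x) \<in> (Restr F (- side F v z))\<^sup>*" for x
  proof (induction rule: rtrancl_induct)
    case (step x x')
    show ?case
    proof (cases "x' \<in> side F v z \<or> x' = v")
      case False
      then have "x \<notin> side F v z" using side_closed step.hyps assms(3) by metis
      then have "(x, x') \<in> Restr F (- side F v z)" "(v, x) \<in> (Restr F (- side F v z))\<^sup>*"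
        using step False by auto
      then show ?thesis using rtrancl_into_rtrancl by metis
    qed auto
  qed simp
  then show ?thesis using assms by blast
qed

text \<open>A walk from \<open>w\<close> that avoids \<open>y\<close> also avoids \<open>s\<close>,
  which lies outside the branch at \<open>y\<close>; hence it stays in the component of
  \<open>F\<close> minus \<open>s\<close> that contains \<open>y\<close>.\<close>

lemma side_subset_side:
  assumes "y \<in> side F s z" "(y, w) \<in> F" "s \<notin> side F y w" "y \<noteq> s"
  shows "side F y w \<subseteq> side F s z"
proof
  fix v assume "v \<in> side F y w"
  then have "(w, v) \<in> (Restr F (- {y}))\<^sup>*" by (simp add: side_def)
  then have "v \<in> side F s z \<and> v \<in> side F y w"
  proof (induction rule: rtrancl_induct)
    case base
    have "w \<noteq> s" using assms(3) side_refl by metis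
    then show ?case using assms side_step side_refl by metis
  next
    case (step u v)
    have uv: "(u, v) \<in> F" "u \<noteq> y" "v \<noteq> y" using step.hyps by auto
    have v: "v \<in> side F y w" using side_step[OF _ uv] step.IH by blast
    have "u \<noteq> s" "v \<noteq> s" using step.IH v assms(3) by auto
    then show ?case using side_step[OF _ uv(1)] step.IH v by blast
  qed
  then show "v \<in> side F s z" by blast
qed

text \<open>Going one edge further shrinks the branch strictly. Behind a smallest branch with some
  property, all branches therefore lack it.\<close>

lemma bridged_side_mono:
  assumes "bridged F" "sym F" "(u, v) \<in> F" "(v, w) \<in> F" "w \<noteq> u"
  shows "side F v w \<subseteq> side F u v - {v}"
proof -
  have vu: "(v, u) \<in> F" using assms(2,3) by (meson symD)
  have "v \<noteq> u" "w \<noteq> v" using assms bridged_irrefl by metis+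
  moreover have "u \<notin> side F v w"
    using bridged_neighbours_separated[OF assms(1,2,4) vu] assms(5) by (auto simp: side_def)
  ultimately show ?thesis
    using side_subset_side[OF side_refl assms(4)] not_in_side by fastforce
qed

lemma side_decompose:
  assumes "sym F" "x \<in> side F u v" "x \<noteq> v"
  obtains w where "(v, w) \<in> F" "w \<noteq> u" "x \<in> side F v w"
proof -
  let ?F = "Restr F (- {u})"
  have sF: "sym ?F" using sym_Restr assms(1) .
  have "(v, x) \<in> ?F\<^sup>*" using assms(2) by (simp add: side_def)
  then have "(x, v) \<in> ?F\<^sup>*" by (rule rtrancl_symD[OF sF])
  then obtain w where w: "(w, v) \<in> ?F" "(x, w) \<in> (Restr ?F (- {v}))\<^sup>*"
    using rtrancl_last_step_before assms(3) by metis
  have "(Restr ?F (- {v}))\<^sup>* \<subseteq> (Restr F (- {v}))\<^sup>*" by (intro rtrancl_mono) auto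
  then have "(x, w) \<in> (Restr F (- {v}))\<^sup>*" using w(2) by (rule subsetD)
  then have "(w, x) \<in> (Restr F (- {v}))\<^sup>*" by (rule rtrancl_symD[OF sym_Restr[OF assms(1)]])
  then have "x \<in> side F v w" by (simp add: side_def)
  moreover have "(v, w) \<in> F" "w \<noteq> u" using w(1) symD[OF sF] by auto
  ultimately show thesis using that by metis
qed

lemma side_connected:
  assumes "x \<in> side F u v" "v \<noteq> u"
  shows "(v, x) \<in> (Restr F (side F u v))\<^sup>*"
proof -
  have "(v, x) \<in> (Restr F (- {u}))\<^sup>*" using assms by (simp add: side_def)
  then have "x \<in> side F u v \<and> (v, x) \<in> (Restr F (side F u v))\<^sup>*"
  proof (induction rule: rtrancl_induct)
    case base
    then show ?case by (simp add: side_refl)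
  next
    case (step a b)
    have b: "b \<in> side F u v" using side_step[of a F u v b] step by blast
    then have "(a, b) \<in> Restr F (side F u v)" using step by auto
    then show ?case using step.IH b rtrancl_into_rtrancl by metis
  qed
  then show ?thesis by blast
qed

text \<open>The edges of a path with ends \<open>p\<close> and \<open>q\<close>, recorded only
  through connectedness and degrees: the exchanges use nothing else, and no list of vertices has to
  be carried along.\<close>

definition joins :: "'a rel \<Rightarrow> 'a \<Rightarrow> 'a \<Rightarrow> bool" where
  "joins R p q \<longleftrightarrow> finite R \<and> sym R \<and> (\<forall>v\<in>Domain R. (p, v) \<in> R\<^sup>*) \<and> q \<in> Domain R \<and>
     card (R `` {p}) = 1 \<and> card (R `` {q}) = 1 \<and> (\<forall>v. card (R `` {v}) \<le> 2)"

lemma joins_start_in_Domain: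
  assumes "joins R p q"
  shows "p \<in> Domain R"
proof -
  have "card (R `` {p}) = 1" using assms by (simp add: joins_def)
  then have "R `` {p} \<noteq> {}" by auto
  then show ?thesis by auto
qed

text \<open>Take a shortest walk from \<open>A\<close> to \<open>B\<close>. A further visit to
  either set or a repeated vertex would allow a shorter one, so the walk is a path with inner
  vertices outside \<open>A \<union> B\<close>. When \<open>A \<union> B\<close> is the vertex set
  of a forest, the path meets the forest in its ends only.\<close>

lemma shortest_path_between:
  assumes "(a, b) \<in> (Restr E U)\<^sup>*" "a \<in> A" "b \<in> B" "A \<inter> B = {}"
    and "sym E"
  obtains p q R where "p \<in> A" "q \<in> B" "joins R p q" "R \<subseteq> Restr E U" "Domain R \<inter> (A \<union> B) \<subseteq> {p, q}"
proof -
  let ?E = "Restr E U"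
  let ?P = "\<lambda>n. \<exists>a\<in>A. \<exists>b\<in>B. (a, b) \<in> ?E ^^ n"
  define n where "n = (LEAST n. ?P n)"
  have "\<exists>n. ?P n" using assms by (meson rtrancl_imp_relpow)
  then have "?P n" unfolding n_def by (rule LeastI_ex)
  have least: "n \<le> m" if "?P m" for m unfolding n_def using that by (rule Least_le)
  obtain f where f: "f 0 \<in> A" "f n \<in> B" "\<And>i. i < n \<Longrightarrow> (f i, f (Suc i)) \<in> ?E"
    using \<open>?P n\<close> by (auto simp: relpow_fun_conv)
  have seg: "(f i, f j) \<in> ?E ^^ (j - i)" if "i \<le> j" "j \<le> n" for i j
    using that
  proof (induction j)
    case (Suc j)
    show ?case
    proof (cases "i = Suc j")
      case False
      then have "i \<le> j" "j \<le> n" using Suc.prems by auto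
      then have "(f i, f j) \<in> ?E ^^ (j - i)" using Suc.IH by blast
      moreover have "(f j, f (Suc j)) \<in> ?E" using f(3) Suc.prems by simp
      ultimately have "(f i, f (Suc j)) \<in> ?E ^^ (Suc (j - i))" by (rule relpow_Suc_I)
      then show ?thesis using \<open>i \<le> j\<close> by (simp add: Suc_diff_le)
    qed simp
  qed simp
  have n0: "n > 0" using f assms(4) by (cases "n = 0") auto
  have notA: "f i \<notin> A" if "0 < i" "i \<le> n" for i
  proof
    assume "f i \<in> A"
    then have "?P (n - i)" using seg[of i n] f(2) that by blast
    then show False using least[of "n - i"] that by simp
  qed
  have notB: "f i \<notin> B" if "i < n" for i
  proof
    assume "f i \<in> B"
    then have "?P i" using seg[of 0 i] f(1) that by auto
    then show False using least[of i] that by simp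
  qed
  have "f i \<noteq> f j" if "i < j" "j \<le> n" for i j
  proof
    assume eq: "f i = f j"
    have "(f 0, f i) \<in> ?E ^^ i" "(f i, f n) \<in> ?E ^^ (n - j)"
      using seg[of 0 i] seg[of j n] that eq by auto
    then have "(f 0, f n) \<in> ?E ^^ (i + (n - j))" by (auto simp: relpow_add)
    then show False using least[of "i + (n - j)"] f(1,2) that by fastforce
  qed
  then have inj: "f i = f j \<Longrightarrow> i \<le> n \<Longrightarrow> j \<le> n \<Longrightarrow> i = j" for i j
    by (metis linorder_neqE_nat)
  define R where "R = (\<lambda>i. (f i, f (Suc i))) ` {..<n} \<union> (\<lambda>i. (f (Suc i), f i)) ` {..<n}"
  have Rf: "(x, y) \<in> R \<Longrightarrow> \<exists>i\<le>n. x = f i" for x y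
  proof -
    assume "(x, y) \<in> R"
    then obtain i where "i < n" "x = f i \<or> x = f (Suc i)" by (auto simp: R_def)
    then show ?thesis by (metis Suc_leI less_imp_le_nat)
  qed
  have nb: "R `` {f i} \<subseteq> {f (i - 1), f (Suc i)}" "R `` {f i} \<subseteq> {f j |j. j = i - 1 \<and> i > 0 \<or> j = Suc i \<and> i < n}"
    if "i \<le> n" for i
  proof -
    show "R `` {f i} \<subseteq> {f j |j. j = i - 1 \<and> i > 0 \<or> j = Suc i \<and> i < n}"
    proof
      fix y assume "y \<in> R `` {f i}"
      then have "(f i, y) \<in> R" by simp
      then consider j where "j < n" "f i = f j" "y = f (Suc j)" | j where "j < n" "f i = f (Suc j)" "y = f j"
        unfolding R_def by blast
      then show "y \<in> {f j |j. j = i - 1 \<and> i > 0 \<or> j = Suc i \<and> i < n}"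
      proof cases
        case 1
        then have "i = j" using inj that by auto
        then show ?thesis using 1 by blast
      next
        case 2
        then have "i = Suc j" using inj that by auto
        then show ?thesis using 2 by auto
      qed
    qed
    then show "R `` {f i} \<subseteq> {f (i - 1), f (Suc i)}" by blast
  qed
  have finR: "finite R" by (simp add: R_def)
  have reach: "(f 0, f i) \<in> R\<^sup>*" if "i \<le> n" for i
    using that
  proof (induction i)
    case (Suc i)
    have "(f i, f (Suc i)) \<in> R" using Suc.prems by (auto simp: R_def)
    then show ?case using Suc by (meson Suc_leD rtrancl.rtrancl_into_rtrancl)
  qed simp
  show thesis
  proof (rule that[of "f 0" "f n" R])
    have symR: "sym R" by (auto simp: R_def sym_def)
    show "R \<subseteq> ?E"
    proof
      fix e assume "e \<in> R"
      then obtain i where "i < n" "e = (f i, f (Suc i)) \<or> e = (f (Suc i), f i)" by (auto simp: R_def)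
      then show "e \<in> ?E" using f(3) symD[OF sym_Restr[OF assms(5)]] by blast
    qed
    show "Domain R \<inter> (A \<union> B) \<subseteq> {f 0, f n}"
    proof
      fix x assume x: "x \<in> Domain R \<inter> (A \<union> B)"
      then obtain i where "i \<le> n" "x = f i" using Rf by fastforce
      then show "x \<in> {f 0, f n}" using notA[of i] notB[of i] x by (cases "i = 0"; cases "i = n") auto
    qed
    have r: "(f 0, v) \<in> R\<^sup>*" if "v \<in> Domain R" for v using that Rf reach by fastforce
    have "(f 0, f (Suc 0)) \<in> R" "(f n, f (n - 1)) \<in> R"
    proof -
      obtain m where "n = Suc m" using n0 gr0_implies_Suc by blast
      then show "(f 0, f (Suc 0)) \<in> R" "(f n, f (n - 1)) \<in> R" by (auto simp: R_def)
    qed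
    moreover have "R `` {f 0} \<subseteq> {f (Suc 0)}" "R `` {f n} \<subseteq> {f (n - 1)}"
      using nb(2)[of 0] nb(2)[of n] by auto
    ultimately have "R `` {f 0} = {f (Suc 0)}" "R `` {f n} = {f (n - 1)}" by auto
    then have c: "card (R `` {f 0}) = 1" "card (R `` {f n}) = 1" by simp_all
    have d: "card (R `` {v}) \<le> 2" for v
    proof (cases "v \<in> Domain R")
      case True
      then obtain i where "i \<le> n" "v = f i" using Rf by fastforce
      then have "card (R `` {v}) \<le> card {f (i - 1), f (Suc i)}"
        using nb(1)[of i] by (intro card_mono) auto
      also have "\<dots> \<le> 2" by (simp add: card_insert_if)
      finally show ?thesis .
    next
      case False
      then have "R `` {v} = {}" by auto
      then show ?thesis by simp
    qed
    show "joins R (f 0) (f n)"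
      using finR symR r c d \<open>(f n, f (n - 1)) \<in> R\<close> unfolding joins_def by blast
  qed (use f in auto)
qed

section \<open>Splitting forests\<close>

abbreviation deg :: "'a rel \<Rightarrow> 'a \<Rightarrow> nat" where
  "deg F v \<equiv> card (F `` {v})"

definition linked :: "'a rel \<Rightarrow> 'a set \<Rightarrow> bool" where
  "linked F Z \<longleftrightarrow> (\<forall>x\<in>Z. \<forall>y\<in>Z. (x, y) \<in> (Restr F Z)\<^sup>*)"

lemma linkedD: "linked F Z \<Longrightarrow> x \<in> Z \<Longrightarrow> y \<in> Z \<Longrightarrow> (x, y) \<in> (Restr F Z)\<^sup>*"
  by (simp add: linked_def)

lemma linked_from:
  assumes "sym F" "\<And>x. x \<in> Z \<Longrightarrow> (u, x) \<in> (Restr F Z)\<^sup>*"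
  shows "linked F Z"
  unfolding linked_def
  using assms(2) rtrancl_trans rtrancl_symD[OF sym_Restr[OF assms(1)]] by metis

lemma finite_Image_rel: "finite F \<Longrightarrow> finite (F `` X)"
  by (rule finite_subset[of _ "Range F"]) (auto simp: finite_Range)

lemma finite_side: "finite F \<Longrightarrow> finite (side F v z)"
proof -
  assume "finite F"
  have "side F v z \<subseteq> insert z (Range F)"
  proof
    fix x assume "x \<in> side F v z"
    then have "(z, x) \<in> (Restr F (- {v}))\<^sup>*" by (simp add: side_def)
    then show "x \<in> insert z (Range F)" by (cases rule: rtranclE) auto
  qed
  then show ?thesis using \<open>finite F\<close> finite_subset finite_Range by blast
qed

lemma card_le_sum_sides:
  assumes "finite N" "finite A0" "X \<inter> A \<subseteq> A0 \<union> (\<Union>w\<in>N. C w)" "\<And>w. w \<in> N \<Longrightarrow> finite (C w)"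
    and "\<And>w. w \<in> N \<Longrightarrow> card (C w \<inter> A) \<le> l"
  shows "card (X \<inter> A) \<le> card A0 + card N * l"
proof -
  have "X \<inter> A \<subseteq> A0 \<union> (\<Union>w\<in>N. C w \<inter> A)" using assms(3) by blast
  moreover have "finite (A0 \<union> (\<Union>w\<in>N. C w \<inter> A))" using assms by auto
  ultimately have "card (X \<inter> A) \<le> card (A0 \<union> (\<Union>w\<in>N. C w \<inter> A))" by (rule card_mono[rotated])
  also have "\<dots> \<le> card A0 + card (\<Union>w\<in>N. C w \<inter> A)" by (rule card_Un_le)
  also have "card (\<Union>w\<in>N. C w \<inter> A) \<le> (\<Sum>w\<in>N. card (C w \<inter> A))" using assms(1) by (rule card_UN_le)
  also have "\<dots> \<le> card N * l" using sum_bounded_above[of N "\<lambda>w. card (C w \<inter> A)" l] assms(5) by simp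
  finally show ?thesis by simp
qed

text \<open>Shortest-path trees towards one representative per component use at most one edge per
  vertex and already keep all connections, so any additional edge would fail to be a bridge. The
  factor 2 appears because \<open>card F\<close> counts both orientations.\<close>

lemma bridged_card_le:
  assumes "finite F" "sym F" "bridged F"
  shows "card F \<le> 2 * card (Domain F)"
proof -
  define rep where "rep v = (SOME r. (v, r) \<in> F\<^sup>*)" for v
  have rep: "(v, rep v) \<in> F\<^sup>*" for v
    unfolding rep_def by (rule someI[of _ v]) simp
  \<comment> \<open>Adjacent vertices reach the same vertices, so \<open>SOME\<close> is applied to
    equal predicates and picks the same representative.\<close>
  have rep_eq: "rep v = rep w" if "(v, w) \<in> F" for v w
  proof -
    have "(v, r) \<in> F\<^sup>* \<longleftrightarrow> (w, r) \<in> F\<^sup>*" for r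
      using that symD[OF assms(2) that] converse_rtrancl_into_rtrancl by metis
    then show ?thesis by (simp add: rep_def)
  qed
  define d where "d v = (LEAST n. (v, rep v) \<in> F ^^ n)" for v
  have d: "(v, rep v) \<in> F ^^ d v" for v
  proof -
    obtain n where "(v, rep v) \<in> F ^^ n" using rtrancl_imp_relpow[OF rep] by metis
    then show ?thesis unfolding d_def by (rule LeastI)
  qed
  have ex: "\<exists>w. (v, w) \<in> F \<and> d w < d v" if pos: "d v > 0" for v
  proof -
    obtain n where n: "d v = Suc n" using gr0_implies_Suc[OF pos] by blast
    have "(v, rep v) \<in> F ^^ Suc n" using d[of v] unfolding n .
    then obtain w where w: "(v, w) \<in> F" "(w, rep v) \<in> F ^^ n" by (rule relpow_Suc_E2)
    have "d w \<le> n" unfolding d_def using w rep_eq[OF w(1)] by (intro Least_le) simp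
    then show ?thesis using w(1) n by auto
  qed
  define par where "par v = (SOME w. (v, w) \<in> F \<and> d w < d v)" for v
  have par: "(v, par v) \<in> F" "d (par v) < d v" if "d v > 0" for v
    using someI_ex[OF ex[OF that]] unfolding par_def by blast+
  define P where "P = (\<lambda>v. (v, par v)) ` {v \<in> Domain F. d v > 0}"
  define F0 where "F0 = P \<union> P\<inverse>"
  have finD: "finite (Domain F)" using assms(1) by (rule finite_Domain)
  have "card F0 \<le> card P + card (P\<inverse>)" unfolding F0_def by (rule card_Un_le)
  also have "\<dots> = 2 * card P" by (simp add: card_inverse)
  also have "card P \<le> card {v \<in> Domain F. d v > 0}"
    unfolding P_def using finD by (intro card_image_le) simp
  also have "\<dots> \<le> card (Domain F)" using finD by (intro card_mono) auto
  finally have card0: "card F0 \<le> 2 * card (Domain F)" by simp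
  have sym0: "sym F0" by (auto simp: F0_def sym_def)
  have reach: "(v, rep v) \<in> F0\<^sup>*" for v
  proof (induction "d v" arbitrary: v rule: less_induct)
    case less
    show ?case
    proof (cases "d v = 0")
      case True
      then have "v = rep v" using d[of v] by simp
      then show ?thesis by (metis rtrancl.rtrancl_refl)
    next
      case False
      then have p: "(v, par v) \<in> F" "d (par v) < d v" using par by auto
      then have "(v, par v) \<in> F0" using False by (auto simp: F0_def P_def)
      moreover have "(par v, rep v) \<in> F0\<^sup>*" using less[OF p(2)] rep_eq[OF p(1)] by simp
      ultimately show ?thesis by (rule converse_rtrancl_into_rtrancl)
    qed
  qed
  have F0F: "F0 \<subseteq> F"
    using par(1) symD[OF assms(2)] by (auto simp: F0_def P_def)
  have "F \<subseteq> F0"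
  proof (intro subrelI, rule ccontr)
    fix u v assume uv: "(u, v) \<in> F" "(u, v) \<notin> F0"
    have "(v, u) \<notin> F0" using uv(2) symD[OF sym0] by blast
    then have "F0\<^sup>* \<subseteq> (F - {(u, v), (v, u)})\<^sup>*" using uv(2) F0F by (intro rtrancl_mono) auto
    moreover have "(u, v) \<in> F0\<^sup>*"
      using reach[of u] rtrancl_symD[OF sym0 reach[of v]] rep_eq[OF uv(1)] rtrancl_trans by metis
    ultimately show False using bridgedD[OF assms(3) uv(1)] by blast
  qed
  then show ?thesis using card0 F0F by (simp add: subset_antisym)
qed

text \<open>Cut off a smallest branch with more than \<open>l\<close> elements of \<open>A\<close>.
  The branches behind its first vertex hold at most \<open>l\<close> each and number at most two, so
  the part holds at most \<open>2 * l\<close>; what remains is still connected. When no branch is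
  that large, at most \<open>3 * l\<close> elements are left and form the last part, whence the
  summand \<open>l\<close>.\<close>

lemma split_into_linked_parts:
  assumes "finite F" "sym F" "bridged F" "\<And>v. deg F v \<le> 3" "\<And>v. v \<in> A \<Longrightarrow> deg F v \<le> 2"
    and "l \<ge> 1" "finite Z" "linked F Z"
  shows "\<exists>\<P>. finite \<P> \<and> pairwise disjnt \<P> \<and>
    (\<forall>P\<in>\<P>. P \<subseteq> Z \<and> linked F P \<and> l < card (P \<inter> A)) \<and> card (Z \<inter> A) \<le> 2 * l * card \<P> + l"
  using assms(7,8)
proof (induction Z rule: finite_psubset_induct)
  case (psubset Z)
  let ?F = "Restr F Z"
  have fF: "finite ?F" "sym ?F" "bridged ?F"
    using assms(1,2,3) sym_Restr bridged_subset[of F "Restr F Z"] by auto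
  have degZ: "deg ?F v \<le> deg F v" for v
    using finite_Image_rel[OF assms(1)] by (intro card_mono) auto
  \<comment> \<open>The arc \<open>(u, v)\<close> stands for the branch at \<open>u\<close> through
    \<open>v\<close>.\<close>
  define big where "big e \<longleftrightarrow> e \<in> ?F \<and> l < card (side ?F (fst e) (snd e) \<inter> A)" for e
  show ?case
  proof (cases "card (Z \<inter> A) \<le> l")
    case True
    then show ?thesis by (intro exI[of _ "{}"]) auto
  next
    case large: False
    show ?thesis
    proof (cases "\<exists>e. big e")
      case True
      define m where "m e = card (side ?F (fst e) (snd e))" for e
      obtain e where e: "big e" "\<And>e'. big e' \<Longrightarrow> m e \<le> m e'"
        using True ex_has_least_nat[of big _ m] by metis
      obtain u v where uv: "e = (u, v)" by force
      have uvF: "(u, v) \<in> ?F" using e(1) uv by (simp add: big_def)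
      have "v \<noteq> u" using bridged_irrefl[OF fF(3)] uvF by metis
      define P where "P = side ?F u v"
      have finP: "finite P" unfolding P_def using fF(1) by (rule finite_side)
      have PZ: "P \<subseteq> Z"
      proof
        fix x assume "x \<in> P"
        then have "(v, x) \<in> (Restr ?F (- {u}))\<^sup>*" by (simp add: P_def side_def)
        then show "x \<in> Z" using uvF by (cases rule: rtranclE) auto
      qed
      have uP: "u \<notin> P" unfolding P_def using \<open>v \<noteq> u\<close> by (rule not_in_side)
      have big_P: "l < card (P \<inter> A)" using e(1) uv by (simp add: big_def P_def)
      have small: "card (side ?F v w \<inter> A) \<le> l" if "w \<in> ?F `` {v} - {u}" for w
      proof (rule ccontr)
        assume "\<not> ?thesis"
        then have b: "big (v, w)" using that by (simp add: big_def)
        have "side ?F v w \<subseteq> P - {v}" unfolding P_def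
          using that by (intro bridged_side_mono[OF fF(3,2) uvF]) auto
        then have "side ?F v w \<subset> P" using side_refl[of v ?F u] by (auto simp: P_def)
        then have "m (v, w) < m e" using finP by (simp add: m_def uv P_def psubset_card_mono)
        then show False using e(2)[OF b] by simp
      qed
      have cover: "P \<inter> A \<subseteq> ({v} \<inter> A) \<union> (\<Union>w\<in>?F `` {v} - {u}. side ?F v w)"
      proof
        fix x assume x: "x \<in> P \<inter> A"
        show "x \<in> ({v} \<inter> A) \<union> (\<Union>w\<in>?F `` {v} - {u}. side ?F v w)"
        proof (cases "x = v")
          case False
          then obtain w where "(v, w) \<in> ?F" "w \<noteq> u" "x \<in> side ?F v w"
            using side_decompose[OF fF(2)] x by (metis P_def IntD1)
          then show ?thesis by blast
        qed (use x in auto)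
      qed
      have "card (P \<inter> A) \<le> card ({v} \<inter> A) + card (?F `` {v} - {u}) * l"
        using card_le_sum_sides[OF _ _ cover _ small] finite_Image_rel[OF fF(1)] finite_side[OF fF(1)]
        by simp
      moreover have "card (?F `` {v} - {u}) = deg ?F v - 1"
        using uvF symD[OF fF(2)] by (subst card_Diff_singleton) auto
      \<comment> \<open>A vertex of \<open>A\<close> counts 1 but has at most one branch away from
        \<open>u\<close>; any other vertex counts 0 and has at most two. Both cases fit into
        \<open>2 * l\<close> since \<open>l \<ge> 1\<close>.\<close>
      moreover have "card ({v} \<inter> A) + (deg ?F v - 1) * l \<le> 2 * l"
      proof (cases "v \<in> A")
        case True
        then have "deg ?F v - 1 \<le> 1" using assms(5) degZ[of v] by fastforce
        then have "(deg ?F v - 1) * l \<le> 1 * l" by (rule mult_le_mono1)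
        moreover have "card ({v} \<inter> A) = 1" using True by simp
        ultimately show ?thesis using assms(6) by linarith
      next
        case False
        have "deg ?F v - 1 \<le> 2" using assms(4)[of v] degZ[of v] by simp
        then have "(deg ?F v - 1) * l \<le> 2 * l" by (rule mult_le_mono1)
        then show ?thesis using False by simp
      qed
      ultimately have cardP: "card (P \<inter> A) \<le> 2 * l" by simp
      have linkP: "linked F P"
      proof (rule linked_from[OF assms(2)])
        fix x assume "x \<in> P"
        then have "(v, x) \<in> (Restr ?F P)\<^sup>*" unfolding P_def using side_connected \<open>v \<noteq> u\<close> by metis
        moreover have "(Restr ?F P)\<^sup>* \<subseteq> (Restr F P)\<^sup>*" by (intro rtrancl_mono) auto
        ultimately show "(v, x) \<in> (Restr F P)\<^sup>*" by blast
      qed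
      have linkZ: "linked F (Z - P)"
      proof (rule linked_from[OF assms(2)])
        fix x assume x: "x \<in> Z - P"
        have "(u, x) \<in> ?F\<^sup>*" using linkedD[OF psubset.prems] x uvF by auto
        then have "(u, x) \<in> (Restr ?F (- P))\<^sup>*"
          unfolding P_def using x \<open>v \<noteq> u\<close> by (intro rtrancl_outside_side) (auto simp: P_def)
        moreover have "(Restr ?F (- P))\<^sup>* \<subseteq> (Restr F (Z - P))\<^sup>*" by (intro rtrancl_mono) auto
        ultimately show "(u, x) \<in> (Restr F (Z - P))\<^sup>*" by blast
      qed
      have "Z - P \<subset> Z" using PZ side_refl[of v ?F u] by (auto simp: P_def)
      then obtain \<P> where \<P>: "finite \<P>" "pairwise disjnt \<P>"
        "\<And>X. X \<in> \<P> \<Longrightarrow> X \<subseteq> Z - P \<and> linked F X \<and> l < card (X \<inter> A)"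
        "card ((Z - P) \<inter> A) \<le> 2 * l * card \<P> + l"
        using psubset.IH[OF _ linkZ] by metis
      have "P \<notin> \<P>" using \<P>(3) side_refl[of v ?F u] by (auto simp: P_def)
      have "Z \<inter> A = P \<inter> A \<union> (Z - P) \<inter> A" using PZ by blast
      then have "card (Z \<inter> A) \<le> card (P \<inter> A) + card ((Z - P) \<inter> A)" by (metis card_Un_le)
      also have "\<dots> \<le> 2 * l + (2 * l * card \<P> + l)" using cardP \<P>(4) by simp
      also have "\<dots> = 2 * l * card (insert P \<P>) + l" using \<P>(1) \<open>P \<notin> \<P>\<close> by simp
      finally have "card (Z \<inter> A) \<le> 2 * l * card (insert P \<P>) + l" .
      moreover have "pairwise disjnt (insert P \<P>)"
        using \<P>(2,3) by (auto simp: pairwise_insert disjnt_def)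
      moreover have "\<forall>X\<in>insert P \<P>. X \<subseteq> Z \<and> linked F X \<and> l < card (X \<inter> A)"
        using \<P>(3) PZ linkP big_P by blast
      ultimately show ?thesis using \<P>(1) by (intro exI[of _ "insert P \<P>"]) auto
    next
      case False
      have "Z \<noteq> {}" using large by auto
      \<comment> \<open>Any vertex will do: seen from it, \<open>Z\<close> consists of the vertex
        and at most three branches, none of them big.\<close>
      then obtain v where v: "v \<in> Z" by auto
      have cover: "Z \<inter> A \<subseteq> ({v} \<inter> A) \<union> (\<Union>w\<in>?F `` {v}. side ?F v w)"
      proof
        fix x assume x: "x \<in> Z \<inter> A"
        show "x \<in> ({v} \<inter> A) \<union> (\<Union>w\<in>?F `` {v}. side ?F v w)"
        proof (cases "x = v")
          case False
          have "(x, v) \<in> ?F\<^sup>*" using linkedD[OF psubset.prems] x v by auto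
          then obtain w where w: "(w, v) \<in> ?F" "(x, w) \<in> (Restr ?F (- {v}))\<^sup>*"
            using rtrancl_last_step_before False by metis
          then have "(w, x) \<in> (Restr ?F (- {v}))\<^sup>*"
            using rtrancl_symD[OF sym_Restr[OF fF(2)]] by metis
          then show ?thesis using w(1) symD[OF fF(2)] by (auto simp: side_def)
        qed (use x in auto)
      qed
      have small: "card (side ?F v w \<inter> A) \<le> l" if "w \<in> ?F `` {v}" for w
        using False that by (auto simp: big_def not_less)
      have "card (Z \<inter> A) \<le> card ({v} \<inter> A) + deg ?F v * l"
        using card_le_sum_sides[OF _ _ cover _ small] finite_Image_rel[OF fF(1)] finite_side[OF fF(1)]
        by simp
      also have "\<dots> \<le> 3 * l"
      proof (cases "v \<in> A")
        case True
        then have "deg ?F v \<le> 2" using assms(5) degZ[of v] by fastforce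
        then have "deg ?F v * l \<le> 2 * l" by (rule mult_le_mono1)
        moreover have "card ({v} \<inter> A) = 1" using True by simp
        ultimately show ?thesis using assms(6) by linarith
      next
        case False
        have "deg ?F v \<le> 3" using assms(4)[of v] degZ[of v] by simp
        then have "deg ?F v * l \<le> 3 * l" by (rule mult_le_mono1)
        then show ?thesis using False by simp
      qed
      finally have "card (Z \<inter> A) \<le> 2 * l * card {Z} + l" by simp
      then show ?thesis using large psubset.prems by (intro exI[of _ "{Z}"]) (auto simp: not_le)
    qed
  qed
qed

section \<open>Exchange arguments\<close>

definition spans :: "'a rel \<Rightarrow> 'a set \<Rightarrow> bool" where
  "spans F Q \<longleftrightarrow> finite Q \<and> (\<forall>v\<in>Domain F. \<exists>q\<in>Q. (v, q) \<in> F\<^sup>*)"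

lemma joins_reach: "joins R p q \<Longrightarrow> (p, q) \<in> R\<^sup>*"
  by (simp add: joins_def)

lemma rtrancl_subset_mono: "(a, b) \<in> F\<^sup>* \<Longrightarrow> F \<subseteq> F' \<Longrightarrow> (a, b) \<in> F'\<^sup>*"
  using rtrancl_mono by blast

lemma spans_add_path:
  assumes "spans F Q" "joins R p q" "p \<in> Domain F"
  shows "spans (F \<union> R) Q"
  unfolding spans_def
proof (intro conjI ballI)
  show "finite Q" using assms(1) by (simp add: spans_def)
  fix v assume v: "v \<in> Domain (F \<union> R)"
  have *: "\<exists>r\<in>Q. (u, r) \<in> (F \<union> R)\<^sup>*" if "u \<in> Domain F" for u
    using assms(1) that rtrancl_subset_mono[of _ _ F "F \<union> R"] unfolding spans_def by blast
  show "\<exists>r\<in>Q. (v, r) \<in> (F \<union> R)\<^sup>*"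
  proof (cases "v \<in> Domain F")
    case False
    then have "(p, v) \<in> R\<^sup>*" "sym R" using v assms(2) unfolding joins_def by auto
    then have "(v, p) \<in> R\<^sup>*" using rtrancl_symD by metis
    then have "(v, p) \<in> (F \<union> R)\<^sup>*" by (rule rtrancl_subset_mono) simp
    then show ?thesis using *[OF assms(3)] rtrancl_trans by metis
  qed (rule *)
qed

lemma deg_pos_iff: "finite F \<Longrightarrow> 1 \<le> deg F v \<longleftrightarrow> v \<in> Domain F"
  using finite_Image_rel[of F "{v}"] by (auto simp: Suc_le_eq card_gt_0_iff)

text \<open>
  \<open>th\<close> is the largest degree at which a vertex of \<open>S\<close> counts as a terminal of a forest. With \<open>l \<le> 2\<close>
  inner vertices of paths have to count as well, since a path all of whose vertices lie in \<open>S\<close> contains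
  arbitrarily many disjoint models but has only two leaves.
\<close>

locale rooted_graph =
  fixes E :: "'a rel" and S :: "'a set" and l th :: nat
  assumes finE: "finite E" and symE: "sym E" and irreflE: "(v, v) \<notin> E"
    and th: "th = 1 \<and> l \<ge> 3 \<or> th = 2 \<and> l \<ge> 1 \<and> l \<le> 2"
begin

definition terminals :: "'a rel \<Rightarrow> 'a set" where
  "terminals F = {v \<in> S. 1 \<le> deg F v \<and> deg F v \<le> th}"

text \<open>Subtraction is truncated, so the value is 0 exactly for subcubic subgraphs. The sum runs
  over \<open>Domain E\<close> so that different subgraphs are compared over one index set.\<close>

definition excess :: "'a rel \<Rightarrow> nat" where
  "excess F = (\<Sum>v\<in>Domain E. deg F v - 3)"

definition subgraph_in :: "'a set \<Rightarrow> 'a rel \<Rightarrow> bool" where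
  "subgraph_in W F \<longleftrightarrow> F \<subseteq> Restr E W \<and> sym F"

text \<open>\<open>Q\<close> contains a root in every component of \<open>F\<close>, so \<open>card Q\<close> stands for the number of components.\<close>

definition stable :: "'a set \<Rightarrow> 'a rel \<Rightarrow> 'a set \<Rightarrow> bool" where
  "stable W F Q \<longleftrightarrow> subgraph_in W F \<and> spans F Q \<and> bridged F \<and> (\<forall>v. deg F v = 1 \<longrightarrow> v \<in> S) \<and>
     (\<forall>F' Q'. subgraph_in W F' \<and> spans F' Q' \<and> card Q' \<le> card Q \<and> excess F' \<le> excess F \<longrightarrow>
        card (terminals F') \<le> card (terminals F))"

lemma l_pos: "l \<ge> 1" and th_pos: "1 \<le> th" "th \<le> 2"
  using th by auto

lemma subgraph_in_finite: "subgraph_in W F \<Longrightarrow> finite F"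
  unfolding subgraph_in_def using finE finite_subset by (metis finite_Int)

lemma subgraph_in_sym: "subgraph_in W F \<Longrightarrow> sym F"
  by (simp add: subgraph_in_def)

lemma terminals_subset: "finite F \<Longrightarrow> terminals F \<subseteq> Domain F \<inter> S"
proof
  fix v assume fin: "finite F" and v: "v \<in> terminals F"
  then show "v \<in> Domain F \<inter> S" using deg_pos_iff[OF fin, of v] by (simp add: terminals_def)
qed

lemma finite_terminals: "finite F \<Longrightarrow> finite (terminals F)"
  using terminals_subset finite_Domain finite_subset by (metis finite_Int)

text \<open>An end of the path raises a degree of at most 2 by one, and an inner vertex is new to
  \<open>F\<close> and has degree at most 2. Hence no excess over 3 grows.\<close>

lemma excess_add_path:
  assumes "finite F" "joins R p q" "Domain R \<inter> Domain F \<subseteq> {p, q}" "deg F p \<le> 2" "deg F q \<le> 2"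
    and "F' \<subseteq> F \<union> R"
  shows "excess F' \<le> excess F"
  unfolding excess_def
proof (rule sum_mono)
  fix v
  have fin: "finite (F `` {v} \<union> R `` {v})"
    using assms(1,2) finite_Image_rel[of F "{v}"] finite_Image_rel[of R "{v}"] by (auto simp: joins_def)
  have "deg F' v \<le> card (F `` {v} \<union> R `` {v})" using assms(6) fin by (intro card_mono) auto
  then have le: "deg F' v \<le> deg F v + deg R v" using card_Un_le le_trans by blast
  show "deg F' v - 3 \<le> deg F v - 3"
  proof (cases "v = p \<or> v = q")
    case True
    then have "deg F v \<le> 2" "deg R v = 1" using assms(2,4,5) by (auto simp: joins_def)
    then show ?thesis using le by simp
  next
    case False
    show ?thesis
    proof (cases "v \<in> Domain R")
      case True
      then have "F `` {v} = {}" using assms(3) False by auto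
      then have "deg F v = 0" by simp
      moreover have "deg R v \<le> 2" using assms(2) by (simp add: joins_def)
      ultimately show ?thesis using le by simp
    next
      case False
      then have "R `` {v} = {}" by auto
      then show ?thesis using le by simp
    qed
  qed
qed

text \<open>Adding the path makes \<open>x\<close> a new leaf in \<open>S\<close>, while
  \<open>p\<close>, which rises to degree 3, was no terminal. Roots and excess do not grow, against
  maximality.\<close>

lemma stable_no_pendant_path:
  assumes "stable W F Q" "joins R p x" "R \<subseteq> Restr E W" "Domain R \<inter> Domain F \<subseteq> {p}"
    and "p \<in> Domain F" "deg F p = 2" "p \<notin> terminals F" "x \<in> S" "x \<notin> Domain F"
  shows False
proof -
  let ?F = "F \<union> R"
  have sF: "subgraph_in W F" "spans F Q" using assms(1) by (auto simp: stable_def)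
  note fin = subgraph_in_finite[OF sF(1)]
  have "sym R" using assms(2) by (simp add: joins_def)
  then have "subgraph_in W ?F" using sF(1) assms(3) sym_Un by (auto simp: subgraph_in_def)
  moreover have "spans ?F Q" using spans_add_path sF(2) assms(2,5) by metis
  moreover have "deg F x \<le> 2" using deg_pos_iff[OF fin, of x] assms(9) by simp
  then have "excess ?F \<le> excess F"
    using assms(4,6) by (intro excess_add_path[OF fin assms(2)]) auto
  ultimately have le: "card (terminals ?F) \<le> card (terminals F)"
    using assms(1) unfolding stable_def by blast
  have "terminals F \<subseteq> terminals ?F"
  proof
    fix v assume v: "v \<in> terminals F"
    then have "v \<in> Domain F" "v \<noteq> p" using terminals_subset[OF fin] assms(7) by auto
    then have "R `` {v} = {}" using assms(4) by auto
    then have "?F `` {v} = F `` {v}" by (simp add: Un_Image)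
    then show "v \<in> terminals ?F" using v by (simp add: terminals_def)
  qed
  moreover have "F `` {x} = {}" using assms(9) by auto
  then have "?F `` {x} = R `` {x}" by (simp add: Un_Image)
  then have "deg ?F x = 1" using assms(2) by (simp add: joins_def)
  then have "x \<in> terminals ?F" using assms(8) th_pos by (simp add: terminals_def)
  moreover have "x \<notin> terminals F" using terminals_subset[OF fin] assms(9) by auto
  moreover have "finite (terminals ?F)" using finite_terminals fin assms(2) by (simp add: joins_def)
  ultimately have "card (terminals F) < card (terminals ?F)" by (intro psubset_card_mono) auto
  then show False using le by simp
qed

text \<open>Add \<open>R\<close> and delete the edge at \<open>y\<close> towards \<open>p\<close>:
  then \<open>y\<close> becomes a leaf and no terminal is lost. If \<open>p\<close> and
  \<open>q\<close> are connected in \<open>F\<close>, the deleted edge lies on a cycle closed by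
  \<open>R\<close> and its deletion separates nothing. Otherwise \<open>R\<close> merges two
  components before the deletion cuts one, so the number of roots does not grow.\<close>

lemma stable_no_shortcut:
  assumes "stable W F Q" "th = 1" "joins R p q" "R \<subseteq> Restr E W" "Domain R \<inter> Domain F \<subseteq> {p, q}"
    and "p \<in> Domain F" "q \<in> Domain F" "deg F p = 2" "deg F q = 2" "y \<in> S" "deg F y = 2"
    and "y \<noteq> p" "y \<noteq> q" "(p, y) \<in> F\<^sup>*" "(p, q) \<notin> (Restr F (- {y}))\<^sup>*"
  shows False
proof -
  have sF: "subgraph_in W F" "spans F Q" and br: "bridged F" using assms(1) by (auto simp: stable_def)
  note fin = subgraph_in_finite[OF sF(1)] and sym = subgraph_in_sym[OF sF(1)]
  have fR: "finite R" "sym R" using assms(3) by (auto simp: joins_def)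
  obtain z where z: "(z, y) \<in> F" "(p, z) \<in> (Restr F (- {y}))\<^sup>*"
    using rtrancl_last_step_before assms(12,14) by metis
  have yz: "(y, z) \<in> F" using z(1) symD[OF sym] by blast
  have "y \<noteq> z" using bridged_irrefl[OF br] yz by metis
  \<comment> \<open>The neighbour \<open>z\<close> loses an edge, so it must not be one of the
    leaves being counted.\<close>
  have deg_z: "deg F z \<ge> 2"
  proof (cases "p = z")
    case False
    obtain w where w: "(w, z) \<in> Restr F (- {y})" using z(2) False by (meson rtranclE)
    then have "{w, y} \<subseteq> F `` {z}" "w \<noteq> y" using z(1) symD[OF sym] by auto
    then show ?thesis using card_mono[OF finite_Image_rel[OF fin], of "{w, y}" "{z}"] by simp
  qed (use assms(8) in auto)
  define F' where "F' = F - {(y, z), (z, y)} \<union> R"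
  have yD: "y \<in> Domain F" using yz by auto
  have yR: "y \<notin> Domain R" using yD assms(5,12,13) by blast
  have F'_alt: "F' = (F \<union> R) - {(y, z), (z, y)}"
    using yR symD[OF fR(2)] by (auto simp: F'_def)
  have subF': "subgraph_in W F'"
    using sF(1) assms(4) fR(2) by (auto simp: subgraph_in_def F'_def sym_def)
  have excF': "excess F' \<le> excess F"
    using assms(5,8,9) by (intro excess_add_path[OF fin assms(3)]) (auto simp: F'_def)
  have Fy: "Restr F (- {y}) \<subseteq> F'" by (auto simp: F'_def)
  have pq: "(p, q) \<in> F'\<^sup>*" using rtrancl_subset_mono[OF joins_reach[OF assms(3)]] by (simp add: F'_def)
  have symF': "sym F'" using subF' subgraph_in_sym by metis
  have spansH: "spans (F \<union> R) Q" using spans_add_path sF(2) assms(3,6) by metis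
  have "\<exists>Q'. spans F' Q' \<and> card Q' \<le> card Q"
  proof (cases "(p, q) \<in> F\<^sup>*")
    case True
    \<comment> \<open>As \<open>y\<close> separates \<open>p\<close> from \<open>q\<close>, its
      neighbour \<open>z'\<close> towards \<open>q\<close> differs from \<open>z\<close>. The
      deleted edge is replaced by the detour from \<open>y\<close> through \<open>z'\<close>,
      \<open>q\<close>, the path \<open>R\<close> and \<open>p\<close> to \<open>z\<close>.\<close>
    have "(q, y) \<in> F\<^sup>*" using rtrancl_symD[OF sym True] assms(14) by (rule rtrancl_trans)
    then obtain z' where z': "(z', y) \<in> F" "(q, z') \<in> (Restr F (- {y}))\<^sup>*"
      using rtrancl_last_step_before assms(13) by metis
    have "z' \<noteq> z"
      using assms(15) z(2) rtrancl_symD[OF sym_Restr[OF sym] z'(2)] rtrancl_trans by metis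
    then have "(y, z') \<in> F'" using z'(1) symD[OF sym] by (auto simp: F'_def)
    also have "(z', q) \<in> F'\<^sup>*"
      using rtrancl_subset_mono[OF rtrancl_symD[OF sym_Restr[OF sym] z'(2)] Fy] .
    also have "(q, p) \<in> F'\<^sup>*" using rtrancl_symD[OF symF' pq] .
    also have "(p, z) \<in> F'\<^sup>*" using rtrancl_subset_mono[OF z(2) Fy] .
    finally have yz': "(y, z) \<in> F'\<^sup>*" .
    have "F \<union> R \<subseteq> F'\<^sup>*"
    proof
      fix e assume "e \<in> F \<union> R"
      then consider "e \<in> F'" | "e = (y, z)" | "e = (z, y)" by (auto simp: F'_def)
      then show "e \<in> F'\<^sup>*" using yz' rtrancl_symD[OF symF' yz'] by cases auto
    qed
    then have "(F \<union> R)\<^sup>* \<subseteq> F'\<^sup>*" using rtrancl_mono rtrancl_idemp by metis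
    moreover have "Domain F' \<subseteq> Domain (F \<union> R)" by (auto simp: F'_def)
    ultimately have "spans F' Q" using spansH unfolding spans_def by blast
    then show ?thesis by blast
  next
    case False
    obtain r1 r2 where r: "r1 \<in> Q" "(p, r1) \<in> F\<^sup>*" "r2 \<in> Q" "(q, r2) \<in> F\<^sup>*"
      using sF(2) assms(6,7) unfolding spans_def by meson
    have "r1 \<noteq> r2" using False r rtrancl_symD[OF sym] rtrancl_trans by metis
    let ?H = "F \<union> R"
    have FH: "(a, b) \<in> ?H\<^sup>*" if "(a, b) \<in> F\<^sup>*" for a b using that by (rule rtrancl_subset_mono) simp
    have symH: "sym ?H" using sym fR(2) by (rule sym_Un)
    have pqH: "(p, q) \<in> ?H\<^sup>*" using joins_reach[OF assms(3)] by (rule rtrancl_subset_mono) simp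
    have spansH': "\<exists>r\<in>Q - {r2}. (v, r) \<in> ?H\<^sup>*" if v: "v \<in> Domain ?H" for v
    proof -
      obtain r where r': "r \<in> Q" "(v, r) \<in> ?H\<^sup>*" using spansH v unfolding spans_def by blast
      show ?thesis
      proof (cases "r = r2")
        case True
        have "(r2, r1) \<in> ?H\<^sup>*"
          using rtrancl_symD[OF symH] FH[OF r(2)] FH[OF r(4)] pqH rtrancl_trans by metis
        then have "(v, r1) \<in> ?H\<^sup>*" using r'(2) True rtrancl_trans by metis
        then show ?thesis using r(1) \<open>r1 \<noteq> r2\<close> by blast
      qed (use r' in blast)
    qed
    have "(r1, y) \<in> ?H\<^sup>*" using FH[OF rtrancl_trans[OF rtrancl_symD[OF sym r(2)] assms(14)]] .
    then have "(r1, y) \<in> F'\<^sup>* \<or> (r1, z) \<in> F'\<^sup>*"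
      using rtrancl_remove_edge[of r1 y ?H y z] F'_alt by auto
    \<comment> \<open>The root \<open>r1\<close> stays connected to one end \<open>a\<close> of the
      deleted edge. Whatever loses its root reaches \<open>a\<close> or the other end
      \<open>b\<close>, so \<open>b\<close> takes the place of \<open>r2\<close>.\<close>
    then obtain a b where ab: "a = y \<and> b = z \<or> a = z \<and> b = y" "(r1, a) \<in> F'\<^sup>*" by blast
    have "spans F' (insert b (Q - {r2}))"
      unfolding spans_def
    proof (intro conjI ballI)
      show "finite (insert b (Q - {r2}))" using sF(2) by (simp add: spans_def)
      fix v assume "v \<in> Domain F'"
      then have "v \<in> Domain ?H" by (auto simp: F'_def)
      then obtain r where r': "r \<in> Q - {r2}" "(v, r) \<in> ?H\<^sup>*" using spansH' by blast
      then have "(v, r) \<in> F'\<^sup>* \<or> (v, y) \<in> F'\<^sup>* \<or> (v, z) \<in> F'\<^sup>*"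
        using rtrancl_remove_edge[of v r ?H y z] F'_alt by metis
      then consider "(v, r) \<in> F'\<^sup>*" | "(v, a) \<in> F'\<^sup>*" | "(v, b) \<in> F'\<^sup>*" using ab(1) by blast
      then show "\<exists>q\<in>insert b (Q - {r2}). (v, q) \<in> F'\<^sup>*"
      proof cases
        case 2
        then have "(v, r1) \<in> F'\<^sup>*" using rtrancl_symD[OF symF' ab(2)] rtrancl_trans by metis
        then show ?thesis using r(1) \<open>r1 \<noteq> r2\<close> by blast
      qed (use r' in blast)+
    qed
    moreover have "card (insert b (Q - {r2})) \<le> card Q"
    proof -
      have "finite Q" using sF(2) by (simp add: spans_def)
      then show ?thesis using r(3) card_insert_le_m1[of "card Q" "Q - {r2}" b] card_gt_0_iff[of Q] by fastforce
    qed
    ultimately show ?thesis by blast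
  qed
  then have le: "card (terminals F') \<le> card (terminals F)"
    using assms(1) subF' excF' unfolding stable_def by blast
  have "terminals F \<subseteq> terminals F'"
  proof
    fix v assume v: "v \<in> terminals F"
    then have "deg F v \<le> th" "1 \<le> deg F v" by (simp_all add: terminals_def)
    then have "deg F v = 1" using assms(2) by simp
    then have "v \<noteq> y" "v \<noteq> z" "v \<noteq> p" "v \<noteq> q" using assms(8,9,11) deg_z by auto
    then have "v \<notin> Domain R" using terminals_subset[OF fin] v assms(5) by blast
    then have "F' `` {v} = F `` {v}" using \<open>v \<noteq> y\<close> \<open>v \<noteq> z\<close> by (auto simp: F'_def)
    then show "v \<in> terminals F'" using v by (simp add: terminals_def)
  qed
  moreover have "F' `` {y} = F `` {y} - {z}" using yR \<open>y \<noteq> z\<close> by (auto simp: F'_def)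
  then have "deg F' y = 1" using assms(11) yz by (simp add: card_Diff_singleton)
  then have "y \<in> terminals F'" using assms(10) th_pos by (simp add: terminals_def)
  moreover have "\<not> deg F y \<le> th" using assms(2,11) by simp
  then have "y \<notin> terminals F" by (simp add: terminals_def)
  moreover have "finite (terminals F')" using finite_terminals[OF subgraph_in_finite[OF subF']] .
  ultimately have "card (terminals F) < card (terminals F')" by (intro psubset_card_mono) auto
  then show False using le by simp
qed

end

section \<open>Walks along vertices of degree two\<close>

text \<open>The vertices of this relation are the arcs of \<open>F\<close>; a walk stops on reaching \<open>S\<close> or a vertex
  of degree other than two.\<close>

definition walk :: "'a rel \<Rightarrow> 'a set \<Rightarrow> ('a \<times> 'a) rel" where
  "walk F S = {((a, b), (b', c)). b' = b \<and> (a, b) \<in> F \<and> (b, c) \<in> F \<and> deg F b = 2 \<and> b \<notin> S \<and> c \<noteq> a}"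

text \<open>These are deleted along with leaves and branch vertices: every other
  \<open>S\<close>-vertex of degree 2 sees, in both directions, a further \<open>S\<close>-vertex of
  degree 2 (\<open>next_terminal\<close>), the vertex that exchanges turn into a leaf.\<close>

definition near_end :: "'a rel \<Rightarrow> 'a set \<Rightarrow> 'a set" where
  "near_end F S = {s \<in> S. deg F s = 2 \<and>
     (\<exists>z a b. (s, z) \<in> F \<and> ((s, z), (a, b)) \<in> (walk F S)\<^sup>* \<and> deg F b \<noteq> 2)}"

text \<open>\<open>I\<close> is the set of inner vertices of the walk from the arc \<open>(s, z)\<close> to the arc \<open>(a, b)\<close>.\<close>

definition segment :: "'a rel \<Rightarrow> 'a set \<Rightarrow> 'a \<Rightarrow> 'a \<Rightarrow> 'a \<Rightarrow> 'a \<Rightarrow> 'a set \<Rightarrow> bool" where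
  "segment F S s z a b I \<longleftrightarrow> (a, b) \<in> F \<and> a \<in> insert s I \<and> b \<notin> insert s I \<and> s \<notin> I \<and> I \<inter> S = {} \<and>
     z \<in> insert b I \<and> (\<forall>i\<in>I. F `` {i} \<subseteq> insert s (insert b I)) \<and>
     (\<forall>i\<in>insert s I. (s, i) \<in> (Restr F (insert s I))\<^sup>*) \<and>
     (\<forall>i\<in>insert b I. (z, i) \<in> (Restr F (insert b I))\<^sup>*)"

lemma deg_two_cases:
  assumes "deg F b = 2" "(b, a) \<in> F" "(b, c) \<in> F" "c \<noteq> a"
  shows "F `` {b} = {a, c}"
proof -
  have "finite (F `` {b})" using assms(1) by (metis card.infinite zero_neq_numeral)
  moreover have "{a, c} \<subseteq> F `` {b}" "card {a, c} = card (F `` {b})" using assms by auto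
  ultimately show ?thesis using card_subset_eq by metis
qed

lemma deg_two_other:
  assumes "deg F b = 2"
  shows "\<exists>c. (b, c) \<in> F \<and> c \<noteq> a"
proof (rule ccontr)
  assume "\<not> ?thesis"
  then have "F `` {b} \<subseteq> {a}" by auto
  then have "deg F b \<le> card {a}" by (intro card_mono) auto
  then show False using assms by simp
qed

text \<open>Each step turns \<open>b\<close> into an inner vertex. The walk cannot return to
  \<open>insert s I\<close>, because \<open>a\<close> and \<open>c\<close> would then be connected
  off their common neighbour \<open>b\<close>, which a forest forbids.\<close>

lemma walk_segment:
  assumes "sym F" "bridged F" "(s, z) \<in> F" "((s, z), t) \<in> (walk F S)\<^sup>*"
  shows "\<exists>I. segment F S s z (fst t) (snd t) I"
  using assms(4)
proof (induction rule: rtrancl_induct)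
  case base
  have "s \<noteq> z" using assms(2,3) bridged_irrefl by metis
  then have "segment F S s z s z {}" using assms(3) by (simp add: segment_def)
  then show ?case by auto
next
  case (step t t')
  obtain a b c where t: "t = (a, b)" "t' = (b, c)" and e: "(a, b) \<in> F" "(b, c) \<in> F" "deg F b = 2"
    "b \<notin> S" "c \<noteq> a" using step.hyps(2) by (auto simp: walk_def)
  have ba: "(b, a) \<in> F" using e(1) symD[OF assms(1)] by blast
  have nb: "F `` {b} = {a, c}" using deg_two_cases[OF e(3) ba e(2,5)] .
  obtain I where "segment F S s z a b I" using step.IH t by auto
  then have I: "a \<in> insert s I" "b \<notin> insert s I" "s \<notin> I" "I \<inter> S = {}" "z \<in> insert b I"
    "\<And>i. i \<in> I \<Longrightarrow> F `` {i} \<subseteq> insert s (insert b I)"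
    "\<And>i. i \<in> insert s I \<Longrightarrow> (s, i) \<in> (Restr F (insert s I))\<^sup>*"
    "\<And>i. i \<in> insert b I \<Longrightarrow> (z, i) \<in> (Restr F (insert b I))\<^sup>*"
    unfolding segment_def by blast+
  have c: "c \<notin> insert s I"
  proof
    assume "c \<in> insert s I"
    then have "(a, c) \<in> (Restr F (insert s I))\<^sup>*"
      using I(1,7) rtrancl_symD[OF sym_Restr[OF assms(1)]] rtrancl_trans by metis
    then have "(a, c) \<in> (Restr F (- {b}))\<^sup>*"
      by (rule rtrancl_subset_mono) (use I(2) in auto)
    then show False using bridged_neighbours_separated[OF assms(2,1) ba e(2)] e(5) by blast
  qed
  have "b \<noteq> c" using e(2) bridged_irrefl[OF assms(2)] by metis
  let ?I = "insert b I"
  have r1: "(s, i) \<in> (Restr F (insert s ?I))\<^sup>*" if i: "i \<in> insert s ?I" for i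
  proof -
    have mono: "(s, i) \<in> (Restr F (insert s ?I))\<^sup>*" if "i \<in> insert s I" for i
      using I(7)[OF that] by (rule rtrancl_subset_mono) auto
    show ?thesis
    proof (cases "i = b")
      case True
      have "(a, b) \<in> Restr F (insert s ?I)" using e(1) I(1) by auto
      then show ?thesis using mono[OF I(1)] True rtrancl_into_rtrancl by metis
    qed (use mono i in auto)
  qed
  have r2: "(z, i) \<in> (Restr F (insert c ?I))\<^sup>*" if i: "i \<in> insert c ?I" for i
  proof -
    have mono: "(z, i) \<in> (Restr F (insert c ?I))\<^sup>*" if "i \<in> ?I" for i
      using I(8)[OF that] by (rule rtrancl_subset_mono) auto
    show ?thesis
    proof (cases "i = c")
      case True
      have "(b, c) \<in> Restr F (insert c ?I)" using e(2) by auto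
      then show ?thesis using mono[of b] True rtrancl_into_rtrancl by (metis insertI1)
    qed (use mono i in auto)
  qed
  have r3: "F `` {i} \<subseteq> insert s (insert c ?I)" if "i \<in> ?I" for i
    using that nb I(1) I(6)[of i] by (cases "i = b") auto
  have "segment F S s z b c ?I"
    unfolding segment_def using e c I(2-5) \<open>b \<noteq> c\<close> r1 r2 r3 by blast
  then show ?case using t by auto
qed

text \<open>The middle vertex of a step has degree 2, so the leaving arc determines the entering
  one. Tracing backwards gives both termination of walks and the injectivity in
  \<open>card_near_end\<close>.\<close>

lemma walk_converse_single_valued:
  assumes "sym F"
  shows "single_valued ((walk F S)\<inverse>)"
proof (rule single_valuedI)
  fix t u u' assume "(t, u) \<in> (walk F S)\<inverse>" "(t, u') \<in> (walk F S)\<inverse>"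
  then obtain a a' b c where *: "t = (b, c)" "u = (a, b)" "u' = (a', b)" "(a, b) \<in> F" "(a', b) \<in> F"
    "(b, c) \<in> F" "deg F b = 2" "c \<noteq> a" "c \<noteq> a'"
    by (auto simp: walk_def)
  have "(b, a) \<in> F" "(b, a') \<in> F" using *(4,5) symD[OF assms] by auto
  then have "a' \<in> {a, c}" using deg_two_cases[OF *(7) _ *(6,8)] by blast
  then show "u = u'" using * by auto
qed

lemma walk_start: "s \<in> S \<Longrightarrow> ((s, z)) \<notin> Range (walk F S)"
  by (auto simp: walk_def)

text \<open>With unique predecessors, tracing back from a cycle never leaves it, so it cannot arrive
  at \<open>x\<close>, which has no predecessor. The finite part reachable from \<open>x\<close> is
  therefore acyclic and has a last element.\<close>

lemma ex_terminal:
  assumes "finite r" "single_valued (r\<inverse>)" "x \<notin> Range r"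
  shows "\<exists>t. (x, t) \<in> r\<^sup>* \<and> t \<notin> Domain r"
proof -
  define r' where "r' = {(t, u) \<in> r. (x, t) \<in> r\<^sup>*}"
  have no_cycle: "(t, t) \<notin> r\<^sup>+" if "(x, t) \<in> r\<^sup>*" for t
    using that
  proof (induction rule: rtrancl_induct)
    case base
    then show ?case using assms(3) by (metis RangeI tranclD2)
  next
    case (step t u)
    show ?case
    proof
      assume "(u, u) \<in> r\<^sup>+"
      then obtain w where w: "(u, w) \<in> r\<^sup>*" "(w, u) \<in> r" by (metis tranclD2)
      then have "w = t" using assms(2) step.hyps(2) unfolding single_valued_def by blast
      then show False using w(1) step.hyps(2) step.IH by (meson rtrancl_into_trancl2)
    qed
  qed
  have sub: "r' \<subseteq> r" by (auto simp: r'_def)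
  have "acyclic r'"
    unfolding acyclic_def
  proof (intro allI notI)
    fix t assume t: "(t, t) \<in> r'\<^sup>+"
    then have "(x, t) \<in> r\<^sup>*" by (auto simp: r'_def dest: tranclD)
    moreover have "(t, t) \<in> r\<^sup>+" using t trancl_mono sub by metis
    ultimately show False using no_cycle by blast
  qed
  moreover have "finite r'" using sub assms(1) finite_subset by metis
  ultimately have "wf (r'\<inverse>)" using finite_acyclic_wf_converse by metis
  then obtain t where t: "(x, t) \<in> r\<^sup>*" "\<And>u. (u, t) \<in> r'\<inverse> \<Longrightarrow> (x, u) \<notin> r\<^sup>*"
    using wfE_min[of "r'\<inverse>" x "{t. (x, t) \<in> r\<^sup>*}"] by (metis (mono_tags, lifting) mem_Collect_eq rtrancl.rtrancl_refl)
  have "t \<notin> Domain r"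
  proof
    assume "t \<in> Domain r"
    then obtain u where u: "(t, u) \<in> r" by blast
    then have "(u, t) \<in> r'\<inverse>" using t(1) by (simp add: r'_def)
    then show False using t u rtrancl_into_rtrancl by metis
  qed
  then show ?thesis using t(1) by blast
qed

text \<open>Follow the walk from \<open>(s, z)\<close> to its end. As \<open>s\<close> is not near
  an end, it stops at a vertex of degree 2, and there only membership in \<open>S\<close> can stop
  it.\<close>

lemma next_terminal:
  assumes "finite F" "sym F" "bridged F" "s \<in> S" "deg F s = 2" "s \<notin> near_end F S" "(s, z) \<in> F"
  obtains y a I where "segment F S s z a y I" "y \<in> S" "deg F y = 2"
proof -
  have "walk F S \<subseteq> F \<times> F" by (auto simp: walk_def)
  then have "finite (walk F S)" using assms(1) finite_subset by blast
  then obtain a b where ab: "((s, z), (a, b)) \<in> (walk F S)\<^sup>*" "(a, b) \<notin> Domain (walk F S)"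
    using ex_terminal[OF _ walk_converse_single_valued[OF assms(2)] walk_start[OF assms(4)]]
    by (metis surj_pair)
  have deg: "deg F b = 2" using ab(1) assms(4-7) unfolding near_end_def by blast
  obtain I where I: "segment F S s z a b I" using walk_segment[OF assms(2,3,7) ab(1)] by auto
  have "b \<in> S"
  proof (rule ccontr)
    assume "b \<notin> S"
    moreover obtain c where "(b, c) \<in> F" "c \<noteq> a" using deg_two_other[OF deg] by blast
    ultimately have "((a, b), (b, c)) \<in> walk F S" using deg I by (auto simp: walk_def segment_def)
    then show False using ab(2) by blast
  qed
  then show thesis using that I deg by blast
qed

text \<open>Charge \<open>s\<close> to the last arc of its walk, reversed so that it starts at a
  vertex of degree other than 2. Two walks with the same last arc agree when traced backwards, and
  arcs starting in \<open>S\<close> have no predecessor, so both start in the same vertex.\<close>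

lemma card_near_end:
  assumes "finite F" "sym F"
  shows "card (near_end F S) \<le> (\<Sum>v | v \<in> Domain F \<and> deg F v \<noteq> 2. deg F v)"
proof -
  let ?V = "{v \<in> Domain F. deg F v \<noteq> 2}"
  let ?ok = "\<lambda>s t. \<exists>z. (s, z) \<in> F \<and> ((s, z), (snd t, fst t)) \<in> (walk F S)\<^sup>*"
  have ex: "\<exists>t\<in>Sigma ?V (\<lambda>b. F `` {b}). ?ok s t" if near: "s \<in> near_end F S" for s
  proof -
    obtain z a b where *: "(s, z) \<in> F" "((s, z), (a, b)) \<in> (walk F S)\<^sup>*" "deg F b \<noteq> 2"
      using near unfolding near_end_def by blast
    have "(a, b) \<in> F" using *(2) by (cases rule: rtranclE) (use *(1) in \<open>auto simp: walk_def\<close>)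
    then have "(b, a) \<in> F" using symD[OF assms(2)] by blast
    then show ?thesis using * by (intro bexI[of _ "(b, a)"]) auto
  qed
  then have "\<exists>g. \<forall>s\<in>near_end F S. g s \<in> Sigma ?V (\<lambda>b. F `` {b}) \<and> ?ok s (g s)"
    by (intro bchoice ballI) blast
  then obtain g where g: "\<And>s. s \<in> near_end F S \<Longrightarrow> g s \<in> Sigma ?V (\<lambda>b. F `` {b}) \<and> ?ok s (g s)"
    by blast
  have "inj_on g (near_end F S)"
  proof (rule inj_onI)
    fix s s' assume s: "s \<in> near_end F S" "s' \<in> near_end F S" and eq: "g s = g s'"
    obtain z where z: "((s, z), (snd (g s), fst (g s))) \<in> (walk F S)\<^sup>*" using g[OF s(1)] by blast
    obtain z' where z': "((s', z'), (snd (g s), fst (g s))) \<in> (walk F S)\<^sup>*" using g[OF s(2)] eq by auto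
    have "((s, z), (s', z')) \<in> ((walk F S)\<inverse>)\<^sup>* \<or> ((s', z'), (s, z)) \<in> ((walk F S)\<inverse>)\<^sup>*"
      using z z' single_valued_confluent[OF walk_converse_single_valued[OF assms(2)]]
      by (metis rtrancl_converseI)
    moreover have "((s, z)) \<notin> Range (walk F S)" "((s', z')) \<notin> Range (walk F S)"
      using s walk_start by (metis (no_types, lifting) mem_Collect_eq near_end_def)+
    ultimately have "(s, z) = (s', z')"
      by (metis RangeI converse_iff converse_rtranclE)
    then show "s = s'" by simp
  qed
  moreover have "finite ?V" using assms(1) by (simp add: finite_Domain)
  then have "finite (Sigma ?V (\<lambda>b. F `` {b}))" using finite_Image_rel[OF assms(1)] by blast
  ultimately have "card (near_end F S) \<le> card (Sigma ?V (\<lambda>b. F `` {b}))"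
    using card_inj_on_le[of g "near_end F S" "Sigma ?V (\<lambda>b. F `` {b})"] g by blast
  also have "\<dots> = (\<Sum>v\<in>?V. deg F v)"
    using \<open>finite ?V\<close> finite_Image_rel[OF assms(1)] by (intro card_SigmaI) auto
  finally show ?thesis by simp
qed

lemma card_rel_sum_deg:
  assumes "finite F"
  shows "card F = (\<Sum>v\<in>Domain F. deg F v)"
proof -
  have "F = Sigma (Domain F) (\<lambda>v. F `` {v})" by auto
  then have "card F = card (Sigma (Domain F) (\<lambda>v. F `` {v}))" by simp
  also have "\<dots> = (\<Sum>v\<in>Domain F. deg F v)"
    using assms finite_Image_rel[OF assms] by (intro card_SigmaI) (auto simp: finite_Domain)
  finally show ?thesis .
qed

text \<open>Since \<open>card F\<close> counts every edge twice, \<open>deg F v - 2\<close> has a nonpositive sum over a forest.\<close>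

lemma forest_weight_bound:
  fixes w :: "nat \<Rightarrow> nat"
  assumes "finite F" "sym F" "bridged F"
    and "\<And>d. d \<ge> 1 \<Longrightarrow> int (w d) \<le> (if d = 1 then int m else 0) + int c * (int d - 2)"
  shows "(\<Sum>v\<in>Domain F. w (deg F v)) \<le> m * card {v. deg F v = 1}"
proof -
  have fin: "finite (Domain F)" using assms(1) by (rule finite_Domain)
  have "(\<Sum>v\<in>Domain F. int (w (deg F v))) \<le>
      (\<Sum>v\<in>Domain F. (if deg F v = 1 then int m else 0) + int c * (int (deg F v) - 2))"
    using assms(4) deg_pos_iff[OF assms(1)] by (intro sum_mono) blast
  also have "\<dots> = (\<Sum>v\<in>Domain F. if deg F v = 1 then int m else 0) +
      int c * (int (card F) - 2 * int (card (Domain F)))"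
    by (simp add: sum.distrib sum_distrib_left[symmetric] sum_subtractf card_rel_sum_deg[OF assms(1)])
  also have "\<dots> \<le> (\<Sum>v\<in>Domain F. if deg F v = 1 then int m else 0)"
    using bridged_card_le[OF assms(1-3)] by (simp add: mult_le_0_iff)
  also have "\<dots> = int m * int (card {v \<in> Domain F. deg F v = 1})"
    using fin by (simp add: sum.If_cases Int_def)
  also have "{v \<in> Domain F. deg F v = 1} = {v. deg F v = 1}"
  proof (intro Collect_cong)
    show "v \<in> Domain F \<and> deg F v = 1 \<longleftrightarrow> deg F v = 1" for v
      using deg_pos_iff[OF assms(1), of v] by auto
  qed
  finally have "int (\<Sum>v\<in>Domain F. w (deg F v)) \<le> int (m * card {v. deg F v = 1})" by simp
  then show ?thesis by (simp only: of_nat_le_iff)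
qed

text \<open>Inner vertices have no neighbours besides \<open>s\<close>, \<open>y\<close> and one
  another. A walk from \<open>t\<close> avoiding \<open>y\<close> would thus bypass \<open>I\<close>
  and enter \<open>s\<close> from a neighbour other than \<open>z\<close>; that neighbour and
  \<open>z\<close> would be connected off \<open>s\<close>.\<close>

lemma segment_exit:
  assumes "sym F" "bridged F" "segment F S s z a y I" "(s, z) \<in> F" "t \<in> side F s z" "t \<notin> I"
  shows "(t, s) \<notin> (Restr F (- {y}))\<^sup>*"
proof
  assume ts: "(t, s) \<in> (Restr F (- {y}))\<^sup>*"
  have I: "y \<notin> insert s I" "z \<in> insert y I" "\<And>i. i \<in> I \<Longrightarrow> F `` {i} \<subseteq> insert s (insert y I)"
    using assms(3) by (auto simp: segment_def)
  have "z \<noteq> s" using assms(2,4) bridged_irrefl by metis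
  then have "t \<noteq> s" using assms(5) not_in_side by metis
  let ?out = "\<exists>w. (w, s) \<in> F \<and> w \<notin> I \<and> w \<noteq> y \<and> (t, w) \<in> (Restr F (- {s}))\<^sup>*"
  have "(t, v) \<in> (Restr F (- {y}))\<^sup>* \<Longrightarrow>
      v \<notin> insert s I \<and> (t, v) \<in> (Restr F (- {s}))\<^sup>* \<or> ?out" for v
  proof (induction rule: rtrancl_induct)
    case base
    then show ?case using \<open>t \<noteq> s\<close> assms(6) by auto
  next
    case (step v v')
    show ?case
    proof (cases ?out)
      case False
      then have v: "v \<notin> insert s I" "(t, v) \<in> (Restr F (- {s}))\<^sup>*" using step.IH by auto
      have vv: "(v, v') \<in> F" "v \<noteq> y" "v' \<noteq> y" using step.hyps(2) by auto
      have "v' \<noteq> s" using False v vv by blast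
      moreover have "v' \<notin> I"
      proof
        assume "v' \<in> I"
        then have "v \<in> insert s (insert y I)" using I(3) symD[OF assms(1) vv(1)] by blast
        then show False using v(1) vv(2) by blast
      qed
      moreover have "(v, v') \<in> Restr F (- {s})" using vv v(1) \<open>v' \<noteq> s\<close> by auto
      then have "(t, v') \<in> (Restr F (- {s}))\<^sup>*" using v(2) rtrancl_into_rtrancl by metis
      ultimately show ?thesis by blast
    qed simp
  qed
  then obtain w where w: "(w, s) \<in> F" "w \<notin> I" "w \<noteq> y" "(t, w) \<in> (Restr F (- {s}))\<^sup>*"
    using ts by blast
  have "(z, t) \<in> (Restr F (- {s}))\<^sup>*" using assms(5) by (simp add: side_def)
  then have "(z, w) \<in> (Restr F (- {s}))\<^sup>*" using w(4) by (rule rtrancl_trans)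
  then have "z = w"
    using bridged_neighbours_separated[OF assms(2,1,4)] symD[OF assms(1) w(1)] by blast
  then show False using I(2) w by blast
qed

text \<open>
  Starting at \<open>s\<close>, let \<open>y\<close> be the next vertex of \<open>S\<close> in the direction of \<open>z\<close>. It separates \<open>s\<close> from both \<open>s1\<close>
  and \<open>s2\<close> (unless it is one of them), which is impossible outside \<open>B0\<close>; inside \<open>B0\<close> it replaces \<open>s\<close>.
\<close>

lemma no_two_on_one_side:
  assumes "finite F" "sym F" "bridged F"
    and "\<And>s. s \<in> B0 \<inter> S \<Longrightarrow> deg F s = 2 \<and> s \<notin> near_end F S"
    and "B0 \<inter> B1 = {}" "B0 \<inter> B2 = {}" "B1 \<inter> B2 = {}"
    and "s1 \<in> B1 \<inter> S" "s2 \<in> B2 \<inter> S"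
    and sep1: "\<And>s y. s \<in> B0 \<inter> S \<Longrightarrow> y \<in> S \<Longrightarrow> deg F y = 2 \<Longrightarrow> y \<notin> B0 \<union> B1 \<Longrightarrow> (s, y) \<in> F\<^sup>* \<Longrightarrow>
      (s, s1) \<in> (Restr F (- {y}))\<^sup>*"
    and sep2: "\<And>s y. s \<in> B0 \<inter> S \<Longrightarrow> y \<in> S \<Longrightarrow> deg F y = 2 \<Longrightarrow> y \<notin> B0 \<union> B2 \<Longrightarrow> (s, y) \<in> F\<^sup>* \<Longrightarrow>
      (s, s2) \<in> (Restr F (- {y}))\<^sup>*"
    and "s \<in> B0 \<inter> S" "(s, z) \<in> F" "s1 \<in> side F s z" "s2 \<in> side F s z"
  shows False
  using assms(12-15)
proof (induction "card (side F s z)" arbitrary: s z rule: less_induct)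
  case less
  have s: "deg F s = 2" "s \<notin> near_end F S" "s \<in> S" using assms(4) less.prems(1) by auto
  obtain y a I where seg: "segment F S s z a y I" and y: "y \<in> S" "deg F y = 2"
    using next_terminal[OF assms(1-3) s(3,1,2) less.prems(2)] .
  note exit = segment_exit[OF assms(2,3) seg less.prems(2)]
  have I: "(a, y) \<in> F" "a \<in> insert s I" "y \<notin> insert s I" "s \<notin> I" "I \<inter> S = {}" "z \<in> insert y I"
    "\<And>i. i \<in> insert s I \<Longrightarrow> (s, i) \<in> (Restr F (insert s I))\<^sup>*"
    "\<And>i. i \<in> insert y I \<Longrightarrow> (z, i) \<in> (Restr F (insert y I))\<^sup>*"
    using seg unfolding segment_def by blast+
  have s12: "s1 \<in> S" "s2 \<in> S" "s1 \<notin> I" "s2 \<notin> I" using assms(8,9) I(5) by auto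
  have symy: "sym (Restr F (- {y}))" using assms(2) by (rule sym_Restr)
  have sa: "(s, i) \<in> (Restr F (- {y}))\<^sup>*" if "i \<in> insert s I" for i
    using I(7)[OF that] by (rule rtrancl_subset_mono) (use I(3) in auto)
  have ya: "(y, a) \<in> F" using I(1) symD[OF assms(2)] by blast
  have "(s, a) \<in> F\<^sup>*" using sa[OF I(2)] by (rule rtrancl_subset_mono) auto
  then have sy: "(s, y) \<in> F\<^sup>*" using I(1) by (rule rtrancl_into_rtrancl)
  show False
  proof (cases "y \<in> B0")
    case False
    \<comment> \<open>A vertex outside \<open>B0\<close> misses one of the two other sets as well,
      and the matching separation hypothesis yields a walk that \<open>segment_exit\<close>
      forbids.\<close>
    have "y \<notin> B1 \<or> y \<notin> B2" using assms(7) by blast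
    then show False
    proof
      assume "y \<notin> B1"
      then have "(s, s1) \<in> (Restr F (- {y}))\<^sup>*" using sep1[OF less.prems(1) y _ sy] False by blast
      then show False using exit[OF less.prems(3) s12(3)] rtrancl_symD[OF symy] by blast
    next
      assume "y \<notin> B2"
      then have "(s, s2) \<in> (Restr F (- {y}))\<^sup>*" using sep2[OF less.prems(1) y _ sy] False by blast
      then show False using exit[OF less.prems(4) s12(4)] rtrancl_symD[OF symy] by blast
    qed
  next
    case True
    obtain w where w: "(y, w) \<in> F" "w \<noteq> a" using deg_two_other[OF y(2)] by blast
    have nb: "F `` {y} = {a, w}" using deg_two_cases[OF y(2) ya w] .
    have sw: "s \<notin> side F y w"
    proof
      assume "s \<in> side F y w"
      then have "(w, a) \<in> (Restr F (- {y}))\<^sup>*"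
        using sa[OF I(2)] rtrancl_trans by (fastforce simp: side_def)
      then show False using bridged_neighbours_separated[OF assms(3,2) w(1) ya] w(2) by blast
    qed
    have zs: "z \<noteq> s" using bridged_irrefl[OF assms(3)] less.prems(2) by metis
    have y_side: "y \<in> side F s z"
    proof -
      have "(z, y) \<in> (Restr F (insert y I))\<^sup>*" using I(8) by simp
      then have "(z, y) \<in> (Restr F (- {s}))\<^sup>*" by (rule rtrancl_subset_mono) (use I(3,4) in auto)
      then show ?thesis by (simp add: side_def)
    qed
    have sub: "side F y w \<subseteq> side F s z"
      using side_subset_side[OF y_side w(1) sw] I(3) by auto
    have "w \<noteq> y" using bridged_irrefl[OF assms(3)] w(1) by metis
    then have "y \<notin> side F y w" using not_in_side by metis
    then have "card (side F y w) < card (side F s z)"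
      using sub y_side finite_side[OF assms(1)] by (intro psubset_card_mono) auto
    \<comment> \<open>Vertices beyond the segment reach \<open>y\<close> through \<open>w\<close>:
      arriving through \<open>a\<close> would give a walk to \<open>s\<close> that avoids
      \<open>y\<close>. So \<open>s1\<close> and \<open>s2\<close> both lie in the smaller branch at
      \<open>y\<close>.\<close>
    moreover have "t \<in> side F y w" if t: "t \<in> side F s z" "t \<notin> I" "t \<noteq> y" for t
    proof -
      have "(z, t) \<in> F\<^sup>*" using t(1) unfolding side_def by (auto intro: rtrancl_subset_mono)
      then have "(s, t) \<in> F\<^sup>*" using less.prems(2) by (rule converse_rtrancl_into_rtrancl[rotated])
      then have "(t, y) \<in> F\<^sup>*" using sy rtrancl_symD[OF assms(2)] rtrancl_trans by metis
      then obtain v where v: "(v, y) \<in> F" "(t, v) \<in> (Restr F (- {y}))\<^sup>*"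
        using rtrancl_last_step_before t(3) by metis
      have "v \<noteq> a"
      proof
        assume "v = a"
        then have "(t, s) \<in> (Restr F (- {y}))\<^sup>*"
          using v(2) rtrancl_symD[OF symy sa[OF I(2)]] rtrancl_trans by metis
        then show False using exit[OF t(1,2)] by blast
      qed
      then have "v = w" using nb v(1) symD[OF assms(2)] by blast
      then have "(w, t) \<in> (Restr F (- {y}))\<^sup>*" using rtrancl_symD[OF symy v(2)] by simp
      then show ?thesis by (simp add: side_def)
    qed
    moreover have "s1 \<noteq> y" "s2 \<noteq> y" using assms(5,6,8,9) True by auto
    ultimately show False using less.hyps[of y w] True y(1) w(1) less.prems(3,4) s12(3,4) by blast
  qed
qed

section \<open>Models that meet a stable forest\<close>

lemma linked_Un:
  assumes "sym E" "linked E A" "linked E B" "u \<in> A" "v \<in> B" "(u, v) \<in> E"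
  shows "linked E (A \<union> B)"
proof (rule linked_from[OF assms(1), of _ u])
  fix x assume "x \<in> A \<union> B"
  then show "(u, x) \<in> (Restr E (A \<union> B))\<^sup>*"
  proof
    assume "x \<in> A"
    then have "(u, x) \<in> (Restr E A)\<^sup>*" using assms(2,4) linkedD by metis
    then show ?thesis by (rule rtrancl_subset_mono) auto
  next
    assume "x \<in> B"
    then have "(v, x) \<in> (Restr E B)\<^sup>*" using assms(3,5) linkedD by metis
    then have "(v, x) \<in> (Restr E (A \<union> B))\<^sup>*" by (rule rtrancl_subset_mono) auto
    moreover have "(u, v) \<in> Restr E (A \<union> B)" using assms(4-6) by auto
    ultimately show ?thesis by (rule converse_rtrancl_into_rtrancl[rotated])
  qed
qed

context rooted_graph
begin

text \<open>Rooted models of the star with centre \<open>0\<close>, phrased for a vertex set instead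
  of a graph, so that deleting \<open>X\<close> is just a set difference. Symmetry of
  \<open>E\<close> makes one direction of adjacency enough.\<close>

definition star_model :: "'a set \<Rightarrow> (nat \<Rightarrow> 'a set) \<Rightarrow> bool" where
  "star_model U B \<longleftrightarrow> (\<forall>i\<le>l. B i \<subseteq> U \<and> linked E (B i) \<and> B i \<inter> S \<noteq> {}) \<and>
     (\<forall>i\<le>l. \<forall>j\<le>l. i \<noteq> j \<longrightarrow> B i \<inter> B j = {}) \<and> (\<forall>i. 1 \<le> i \<and> i \<le> l \<longrightarrow> (\<exists>u\<in>B 0. \<exists>v\<in>B i. (u, v) \<in> E))"

lemma star_modelD:
  assumes "star_model U B"
  shows "\<And>i. i \<le> l \<Longrightarrow> B i \<subseteq> U" "\<And>i. i \<le> l \<Longrightarrow> linked E (B i)" "\<And>i. i \<le> l \<Longrightarrow> B i \<inter> S \<noteq> {}"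
    "\<And>i j. i \<le> l \<Longrightarrow> j \<le> l \<Longrightarrow> i \<noteq> j \<Longrightarrow> B i \<inter> B j = {}"
    "\<And>i. 1 \<le> i \<Longrightarrow> i \<le> l \<Longrightarrow> \<exists>u\<in>B 0. \<exists>v\<in>B i. (u, v) \<in> E"
  using assms unfolding star_model_def by simp_all

lemma star_model_linked:
  assumes "star_model U B"
  shows "linked E (\<Union>i\<le>l. B i)"
proof -
  have "n \<le> l \<Longrightarrow> linked E (\<Union>i\<le>n. B i)" for n
  proof (induction n)
    case 0
    then show ?case using star_modelD(2)[OF assms, of 0] by simp
  next
    case (Suc n)
    then obtain u v where uv: "u \<in> B 0" "v \<in> B (Suc n)" "(u, v) \<in> E"
      using star_modelD(5)[OF assms, of "Suc n"] by auto
    have "linked E ((\<Union>i\<le>n. B i) \<union> B (Suc n))"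
      using Suc star_modelD(2)[OF assms] uv by (intro linked_Un[OF symE, of _ _ u v]) auto
    then show ?case by (simp add: atMost_Suc Un_commute)
  qed
  then show ?thesis by blast
qed

text \<open>Otherwise a shortest path in \<open>U\<close> from the forest to \<open>x\<close> is a
  pendant path at a nonterminal of degree 2.\<close>

lemma stable_linked_terminals:
  assumes "stable W F Q" "U \<subseteq> W" "linked E U"
    and "\<And>v. v \<in> U \<Longrightarrow> v \<in> Domain F \<Longrightarrow> deg F v = 2 \<and> v \<notin> terminals F"
    and "a \<in> U" "a \<in> Domain F" "x \<in> U" "x \<in> S"
  shows "x \<in> Domain F"
proof (rule ccontr)
  assume x: "x \<notin> Domain F"
  have "(a, x) \<in> (Restr E U)\<^sup>*" using assms(3,5,7) linkedD by metis
  then obtain p q R where R: "p \<in> Domain F" "q \<in> {x}" "joins R p q" "R \<subseteq> Restr E U"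
      "Domain R \<inter> (Domain F \<union> {x}) \<subseteq> {p, q}"
    using shortest_path_between[of a x E U "Domain F" "{x}"] assms(6) x symE by blast
  have "p \<in> Domain R" using R(3) by (rule joins_start_in_Domain)
  then have "p \<in> U" using R(4) by auto
  then have "deg F p = 2" "p \<notin> terminals F" using assms(4) R(1) by auto
  moreover have "R \<subseteq> Restr E W" "Domain R \<inter> Domain F \<subseteq> {p}" using R assms(2) x by auto
  ultimately show False
    using stable_no_pendant_path[OF assms(1), of R p x] R(1-3) assms(8) x by simp
qed

text \<open>\<open>A\<close> and \<open>D - A\<close> exhaust \<open>D\<close>, so a shortest path
  between them has no inner vertex in \<open>D\<close>. With \<open>D = Domain F\<close> it is a
  path as required by \<open>stable_no_shortcut\<close>.\<close>

lemma linked_crossing_path: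
  assumes "U \<subseteq> W" "linked E U" "A \<subseteq> D" "a \<in> U" "a \<in> A" "b \<in> U" "b \<in> D" "b \<notin> A"
  obtains p q R where "p \<in> U \<inter> A" "q \<in> U \<inter> (D - A)" "joins R p q" "R \<subseteq> Restr E W"
    "Domain R \<inter> D \<subseteq> {p, q}"
proof -
  have "(a, b) \<in> (Restr E U)\<^sup>*" using assms(2,4,6) linkedD by metis
  then obtain p q R where R: "p \<in> A" "q \<in> D - A" "joins R p q" "R \<subseteq> Restr E U"
      "Domain R \<inter> (A \<union> (D - A)) \<subseteq> {p, q}"
    using shortest_path_between[of a b E U A "D - A"] assms(5,7,8) symE by blast
  have "p \<in> Domain R" using R(3) by (rule joins_start_in_Domain)
  moreover have "q \<in> Domain R" using R(3) by (simp add: joins_def)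
  ultimately have "p \<in> U" "q \<in> U" using R(4) by auto
  moreover have "R \<subseteq> Restr E W" "A \<union> (D - A) = D" using R(4) assms(1,3) by auto
  ultimately show thesis using that R by simp
qed

text \<open>If \<open>y\<close> separated \<open>a\<close> from \<open>b\<close> in
  \<open>F\<close>, a path within \<open>U\<close> leaving the part of \<open>a\<close> would be a
  shortcut. Its start is still connected to \<open>y\<close> in \<open>F\<close>, and
  \<open>y\<close> is no end of it because \<open>y \<notin> U\<close>.\<close>

lemma stable_linked_avoiding:
  assumes "stable W F Q" "th = 1" "U \<subseteq> W" "linked E U"
    and "\<And>v. v \<in> U \<Longrightarrow> v \<in> Domain F \<Longrightarrow> deg F v = 2"
    and "y \<in> S" "deg F y = 2" "y \<notin> U"
    and "a \<in> U" "a \<in> Domain F" "b \<in> U" "b \<in> Domain F" "(a, y) \<in> F\<^sup>*"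
  shows "(a, b) \<in> (Restr F (- {y}))\<^sup>*"
proof (rule ccontr)
  assume nb: "(a, b) \<notin> (Restr F (- {y}))\<^sup>*"
  define A where "A = {v \<in> Domain F. (a, v) \<in> (Restr F (- {y}))\<^sup>*}"
  have symF: "sym F" using assms(1) by (auto simp: stable_def subgraph_in_def)
  have a: "a \<in> A" using assms(10) by (simp add: A_def)
  have b: "b \<notin> A" using nb by (simp add: A_def)
  have "A \<subseteq> Domain F" by (auto simp: A_def)
  then obtain p q R where R: "p \<in> U \<inter> A" "q \<in> U \<inter> (Domain F - A)" "joins R p q" "R \<subseteq> Restr E W"
      "Domain R \<inter> Domain F \<subseteq> {p, q}"
    by (rule linked_crossing_path[OF assms(3,4) _ assms(9) a assms(11,12) b])
  have ap: "(a, p) \<in> (Restr F (- {y}))\<^sup>*" using R(1) by (simp add: A_def)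
  have "(a, p) \<in> F\<^sup>*" using ap by (rule rtrancl_subset_mono) auto
  then have py: "(p, y) \<in> F\<^sup>*" using assms(13) rtrancl_symD[OF symF] rtrancl_trans by metis
  have "(p, q) \<notin> (Restr F (- {y}))\<^sup>*"
  proof
    assume "(p, q) \<in> (Restr F (- {y}))\<^sup>*"
    with ap have "(a, q) \<in> (Restr F (- {y}))\<^sup>*" by (rule rtrancl_trans)
    then show False using R(2) by (simp add: A_def)
  qed
  then show False
    using stable_no_shortcut[OF assms(1,2) R(3-5) _ _ _ _ assms(6,7) _ _ py] R(1,2) assms(5,8)
    by (auto simp: A_def)
qed

text \<open>A path in \<open>U\<close> to another component merges two components, which pays for an
  edge deleted at any \<open>S\<close>-vertex of degree 2 in the component of \<open>a\<close>,
  except at the end of the path.\<close>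

lemma stable_linked_component:
  assumes "stable W F Q" "th = 1" "U \<subseteq> W" "linked E U"
    and "\<And>v. v \<in> U \<Longrightarrow> v \<in> Domain F \<Longrightarrow> deg F v = 2"
    and "a \<in> U" "a \<in> S" "deg F a = 2" "a \<notin> near_end F S" "b \<in> U" "b \<in> Domain F"
  shows "(a, b) \<in> F\<^sup>*"
proof (rule ccontr)
  assume nb: "(a, b) \<notin> F\<^sup>*"
  define A where "A = {v \<in> Domain F. (a, v) \<in> F\<^sup>*}"
  have F: "finite F" "sym F" "bridged F"
    using assms(1) subgraph_in_finite by (auto simp: stable_def subgraph_in_def)
  obtain z where z: "(a, z) \<in> F" using deg_two_other[OF assms(8)] by blast
  obtain y c I where seg: "segment F S a z c y I" and y: "y \<in> S" "deg F y = 2"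
    using next_terminal[OF F assms(7-9) z] .
  have "y \<noteq> a" using seg by (auto simp: segment_def)
  have "(z, y) \<in> (Restr F (insert y I))\<^sup>*" using seg by (simp add: segment_def)
  then have "(z, y) \<in> F\<^sup>*" by (rule rtrancl_subset_mono) auto
  with z have ay: "(a, y) \<in> F\<^sup>*" by (rule converse_rtrancl_into_rtrancl)
  have a: "a \<in> A" using z by (auto simp: A_def)
  have b: "b \<notin> A" using nb by (simp add: A_def)
  have "A \<subseteq> Domain F" by (auto simp: A_def)
  then obtain p q R where R: "p \<in> U \<inter> A" "q \<in> U \<inter> (Domain F - A)" "joins R p q" "R \<subseteq> Restr E W"
      "Domain R \<inter> Domain F \<subseteq> {p, q}"
    by (rule linked_crossing_path[OF assms(3,4) _ assms(6) a assms(10,11) b])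
  have ap: "(a, p) \<in> F\<^sup>*" using R(1) by (simp add: A_def)
  have naq: "(a, q) \<notin> F\<^sup>*" using R(2) by (simp add: A_def)
  \<comment> \<open>The degree of \<open>p\<close> grows, so \<open>y'\<close> must differ from it:
    \<open>a\<close> itself serves unless \<open>p = a\<close>, and then the next
    \<open>S\<close>-vertex does.\<close>
  obtain y' where y': "y' \<in> S" "deg F y' = 2" "y' \<noteq> p" "(a, y') \<in> F\<^sup>*"
    using y ay \<open>y \<noteq> a\<close> assms(7,8) by (cases "p = a") (blast intro: rtrancl_refl)+
  have py: "(p, y') \<in> F\<^sup>*" using ap y'(4) rtrancl_symD[OF F(2)] rtrancl_trans by metis
  have "y' \<noteq> q" using naq y'(4) by blast
  have "(p, q) \<notin> F\<^sup>*" using ap naq rtrancl_trans by metis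
  then have "(p, q) \<notin> (Restr F (- {y'}))\<^sup>*" using rtrancl_subset_mono[of p q "Restr F (- {y'})" F] by auto
  then show False
    using stable_no_shortcut[OF assms(1,2) R(3-5) _ _ _ _ y'(1,2,3) \<open>y' \<noteq> q\<close> py] R(1,2) assms(5)
    by (auto simp: A_def)
qed

text \<open>As the model meets \<open>F\<close>, all its \<open>S\<close>-vertices lie on
  \<open>F\<close> with degree 2. Those of three branches lie in the component of \<open>s0\<close>,
  an \<open>S\<close>-vertex of the centre, which offers only two directions. So two of them share a
  side, against \<open>no_two_on_one_side\<close>.\<close>

lemma stable_no_star_model:
  assumes "stable W F Q" "th = 1" "star_model U B" "U \<subseteq> W"
    and avoid: "\<And>v. v \<in> U \<Longrightarrow> v \<in> Domain F \<Longrightarrow> deg F v = 2 \<and> v \<notin> near_end F S"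
    and meet: "i0 \<le> l" "a \<in> B i0" "a \<in> Domain F"
  shows False
proof -
  have F: "finite F" "sym F" "bridged F"
    using assms(1) subgraph_in_finite by (auto simp: stable_def subgraph_in_def)
  have l3: "l \<ge> 3" using th assms(2) by auto
  note B = star_modelD[OF assms(3)]
  let ?M = "\<Union>i\<le>l. B i"
  have M: "?M \<subseteq> U" "linked E ?M" using B(1) star_model_linked[OF assms(3)] by auto
  have term2: "v \<in> Domain F \<Longrightarrow> deg F v = 2 \<Longrightarrow> v \<notin> terminals F" for v
  proof
    assume d: "deg F v = 2" and "v \<in> terminals F"
    then have "deg F v \<le> th" by (simp add: terminals_def)
    then show False using d assms(2) by simp
  qed
  have inD: "v \<in> Domain F" if "v \<in> S" "v \<in> ?M" for v
  proof (rule stable_linked_terminals[OF assms(1) _ M(2), of a])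
    show "?M \<subseteq> W" using M(1) assms(4) by blast
    show "deg F v = 2 \<and> v \<notin> terminals F" if "v \<in> ?M" "v \<in> Domain F" for v
      using avoid[of v] term2[of v] that M(1) by blast
  qed (use that meet in auto)
  have good: "deg F v = 2 \<and> v \<notin> near_end F S \<and> v \<in> Domain F" if "v \<in> S" "v \<in> ?M" for v
    using inD[OF that] avoid[of v] M(1) that(2) by blast
  \<comment> \<open>The exchanges are applied to the centre with one branch rather than to the whole
    model, so that \<open>y\<close> may lie in a different branch set.\<close>
  define U' where "U' i = B 0 \<union> B i" for i
  have U': "linked E (U' i)" "U' i \<subseteq> W" if i: "1 \<le> i" "i \<le> l" for i
  proof -
    obtain u v where "u \<in> B 0" "v \<in> B i" "(u, v) \<in> E" using B(5) i by blast
    then show "linked E (U' i)" unfolding U'_def using linked_Un[OF symE B(2)[of 0] B(2)[of i]] i by blast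
    show "U' i \<subseteq> W" using B(1)[of 0] B(1)[of i] i assms(4) by (auto simp: U'_def)
  qed
  have deg2: "deg F v = 2" if "v \<in> U' i" "v \<in> Domain F" "i \<le> l" for v i
    using avoid[of v] B(1)[of 0] B(1)[of i] that by (auto simp: U'_def)
  have sep: "(s, t) \<in> (Restr F (- {y}))\<^sup>*"
    if "1 \<le> i" "i \<le> l" "t \<in> B i \<inter> S" "s \<in> B 0 \<inter> S" "y \<in> S" "deg F y = 2" "y \<notin> B 0 \<union> B i" "(s, y) \<in> F\<^sup>*"
    for i s t y
  proof (rule stable_linked_avoiding[OF assms(1,2) U'(2,1)])
    show "s \<in> U' i" "t \<in> U' i" "y \<notin> U' i" using that by (auto simp: U'_def)
    show "s \<in> Domain F" "t \<in> Domain F" using that inD by auto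
  qed (use that deg2 in auto)
  obtain s0 where s0: "s0 \<in> B 0 \<inter> S" using B(3)[of 0] by blast
  define t where "t i = (SOME x. x \<in> B i \<inter> S)" for i
  have t: "t i \<in> B i \<inter> S" if "i \<le> l" for i
    unfolding t_def using B(3)[OF that] by (metis ex_in_conv someI_ex)
  have s0g: "deg F s0 = 2" "s0 \<notin> near_end F S" using good[of s0] s0 by auto
  obtain z1 where z1: "(s0, z1) \<in> F" using deg_two_other[OF s0g(1)] by blast
  obtain z2 where z2: "(s0, z2) \<in> F" "z2 \<noteq> z1" using deg_two_other[OF s0g(1)] by blast
  have nb: "F `` {s0} = {z1, z2}" using deg_two_cases[OF s0g(1) z1 z2] .
  have sides: "t i \<in> side F s0 z1 \<or> t i \<in> side F s0 z2" if i: "1 \<le> i" "i \<le> l" for i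
  proof -
    have "(s0, t i) \<in> F\<^sup>*"
    proof (rule stable_linked_component[OF assms(1,2) U'(2,1)[OF i]])
      show "s0 \<in> U' i" "t i \<in> U' i" using s0 t i by (auto simp: U'_def)
      show "t i \<in> Domain F" using inD[of "t i"] t i by auto
    qed (use s0 s0g deg2 i in auto)
    then have "(t i, s0) \<in> F\<^sup>*" using rtrancl_symD[OF F(2)] by blast
    moreover have "t i \<noteq> s0" using B(4)[of 0 i] t[of i] s0 i by auto
    ultimately obtain w where w: "(w, s0) \<in> F" "(t i, w) \<in> (Restr F (- {s0}))\<^sup>*"
      using rtrancl_last_step_before by metis
    have "t i \<in> side F s0 w" using rtrancl_symD[OF sym_Restr[OF F(2)] w(2)] by (simp add: side_def)
    moreover have "w \<in> F `` {s0}" using symD[OF F(2) w(1)] by simp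
    then have "w = z1 \<or> w = z2" using nb by simp
    ultimately show ?thesis by auto
  qed
  have no: False if ij: "1 \<le> i" "i \<le> l" "1 \<le> j" "j \<le> l" "i \<noteq> j" and z: "(s0, z) \<in> F"
    "t i \<in> side F s0 z" "t j \<in> side F s0 z" for i j z
  proof (rule no_two_on_one_side[OF F, of "B 0" S "B i" "B j" "t i" "t j" s0 z])
    show "deg F s = 2 \<and> s \<notin> near_end F S" if "s \<in> B 0 \<inter> S" for s using good[of s] that by auto
    show "B 0 \<inter> B i = {}" "B 0 \<inter> B j = {}" "B i \<inter> B j = {}" using B(4) ij by auto
  qed (use sep t s0 ij z in auto)
  have "t 1 \<in> side F s0 z1 \<or> t 1 \<in> side F s0 z2" "t 2 \<in> side F s0 z1 \<or> t 2 \<in> side F s0 z2"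
    "t 3 \<in> side F s0 z1 \<or> t 3 \<in> side F s0 z2"
    using sides l3 by auto
  then show False using no[of 1 2] no[of 1 3] no[of 2 3] z1 z2(1) l3 by auto
qed

text \<open>For \<open>th = 1\<close> what remains of \<open>F\<close> has degree 2 and is not near
  an end, and \<open>stable_no_star_model\<close> applies. For \<open>th = 2\<close> every terminal
  is deleted, so no vertex of \<open>S\<close> is left on \<open>F\<close>, while a model meeting
  \<open>F\<close> would have all its \<open>S\<close>-vertices there.\<close>

lemma stable_hitting_set:
  assumes "stable W F Q"
  obtains X where "X \<subseteq> Domain F" "card X \<le> 6 * card (terminals F)"
    "\<And>B. star_model (W - X) B \<Longrightarrow> (\<Union>i\<le>l. B i) \<inter> Domain F = {}"
proof -
  have F: "finite F" "sym F" "bridged F" and leaf: "\<And>v. deg F v = 1 \<Longrightarrow> v \<in> S"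
    using assms subgraph_in_finite by (auto simp: stable_def subgraph_in_def)
  have finD: "finite (Domain F)" using F(1) by (rule finite_Domain)
  define X0 where "X0 = {v \<in> Domain F. deg F v \<noteq> 2}"
  have finX0: "finite X0" using finD by (simp add: X0_def)
  have leaves: "{v. deg F v = 1} \<subseteq> terminals F" using leaf th_pos by (auto simp: terminals_def)
  show thesis
  proof (cases "th = 1")
    case True
    let ?X = "X0 \<union> near_end F S"
    have "deg F v \<ge> 1" if "v \<in> near_end F S" for v using that by (simp add: near_end_def)
    then have sub: "?X \<subseteq> Domain F" using deg_pos_iff[OF F(1)] by (auto simp: X0_def)
    have "card ?X \<le> card X0 + card (near_end F S)" by (rule card_Un_le)
    also have "\<dots> \<le> card X0 + (\<Sum>v\<in>X0. deg F v)" using card_near_end[OF F(1,2)] by (simp add: X0_def)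
    also have "\<dots> = (\<Sum>v\<in>X0. 1 + deg F v)" by (simp add: sum.distrib[symmetric] sum_Suc)
    also have "\<dots> = (\<Sum>v\<in>Domain F. if deg F v = 2 then 0 else 1 + deg F v)"
      unfolding X0_def using finD by (intro sum.mono_neutral_cong_left) auto
    \<comment> \<open>A vertex of degree \<open>d\<close> other than 2 pays for itself and for
      \<open>d\<close> vertices near it. The least \<open>c\<close> with
      \<open>1 + d \<le> c * (d - 2)\<close> for all \<open>d \<ge> 3\<close> is 4, and a leaf then
      needs \<open>2 + 4 = 6\<close>.\<close>
    also have "\<dots> \<le> 6 * card {v. deg F v = 1}"
      by (rule forest_weight_bound[OF F, where c = 4 and w = "\<lambda>d. if d = 2 then 0 else 1 + d"]) auto
    also have "\<dots> \<le> 6 * card (terminals F)" using leaves finite_terminals[OF F(1)] by (simp add: card_mono)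
    finally have card: "card ?X \<le> 6 * card (terminals F)" .
    show thesis
    proof (rule that[OF sub card])
      fix B assume B: "star_model (W - ?X) B"
      show "(\<Union>i\<le>l. B i) \<inter> Domain F = {}"
      proof (rule ccontr)
        assume "(\<Union>i\<le>l. B i) \<inter> Domain F \<noteq> {}"
        then obtain i a where "i \<le> l" "a \<in> B i" "a \<in> Domain F" by auto
        then show False
        proof (rule stable_no_star_model[OF assms True B _ _, rotated 2])
          show "W - ?X \<subseteq> W" by blast
          show "deg F v = 2 \<and> v \<notin> near_end F S" if "v \<in> W - ?X" "v \<in> Domain F" for v
            using that by (simp add: X0_def)
        qed
      qed
    qed
  next
    case False
    then have th2: "th = 2" using th by auto
    let ?X = "X0 \<union> terminals F"
    have sub: "?X \<subseteq> Domain F" using terminals_subset[OF F(1)] by (auto simp: X0_def)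
    have "card X0 = (\<Sum>v\<in>X0. 1)" by simp
    also have "\<dots> = (\<Sum>v\<in>Domain F. if deg F v = 2 then 0 else 1)"
      unfolding X0_def using finD by (intro sum.mono_neutral_cong_left) auto
    \<comment> \<open>Here only the vertex itself is paid for: \<open>c = 1\<close> covers branch
      vertices, and a leaf needs \<open>1 + 1 = 2\<close>.\<close>
    also have "\<dots> \<le> 2 * card {v. deg F v = 1}"
      by (rule forest_weight_bound[OF F, where c = 1 and w = "\<lambda>d. if d = 2 then 0 else 1"]) auto
    also have "\<dots> \<le> 2 * card (terminals F)" using leaves finite_terminals[OF F(1)] by (simp add: card_mono)
    finally have "card X0 + card (terminals F) \<le> 6 * card (terminals F)" by simp
    then have card: "card ?X \<le> 6 * card (terminals F)" using card_Un_le le_trans by metis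
    show thesis
    proof (rule that[OF sub card])
      fix B assume B: "star_model (W - ?X) B"
      show "(\<Union>i\<le>l. B i) \<inter> Domain F = {}"
      proof (rule ccontr)
        assume "(\<Union>i\<le>l. B i) \<inter> Domain F \<noteq> {}"
        then obtain i a where a: "i \<le> l" "a \<in> B i" "a \<in> Domain F" by auto
        obtain x where x: "x \<in> B 0 \<inter> S" using star_modelD(3)[OF B, of 0] by blast
        have sub': "(\<Union>i\<le>l. B i) \<subseteq> W - ?X" using star_modelD(1)[OF B] by blast
        \<comment> \<open>On \<open>F\<close> the vertex \<open>x\<close> would have degree 2 and
          thus be a deleted terminal.\<close>
        have xF: "x \<in> Domain F"
        proof (rule stable_linked_terminals[OF assms _ star_model_linked[OF B]])
          show "(\<Union>i\<le>l. B i) \<subseteq> W" using sub' by blast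
          show "a \<in> (\<Union>i\<le>l. B i)" "x \<in> (\<Union>i\<le>l. B i)" using a x by auto
          show "deg F v = 2 \<and> v \<notin> terminals F" if "v \<in> (\<Union>i\<le>l. B i)" "v \<in> Domain F" for v
            using sub' that by (auto simp: X0_def)
        qed (use a x in auto)
        have "x \<notin> ?X" using sub' x by auto
        then have "deg F x = 2" "x \<notin> terminals F" using xF by (simp_all add: X0_def)
        then show False using x th2 unfolding terminals_def by simp
      qed
    qed
  qed
qed

end

section \<open>Models inside a tree\<close>

lemma linked_singleton: "linked F {x}"
  by (simp add: linked_def)

lemma linked_mono_rel: "linked F Z \<Longrightarrow> F \<subseteq> F' \<Longrightarrow> linked F' Z"
  unfolding linked_def by (intro ballI rtrancl_subset_mono[of _ _ "Restr F Z" "Restr F' Z"]) auto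

text \<open>Take for \<open>K\<close> the component of \<open>a\<close> after removal of
  \<open>b\<close>. The rest of \<open>C\<close> is connected through \<open>b\<close>. No
  acyclicity is involved.\<close>

lemma linked_split:
  assumes "sym E" "linked E C" "a \<in> C" "b \<in> C" "a \<noteq> b"
  obtains K K' u v where "C = K \<union> K'" "K \<inter> K' = {}" "linked E K" "linked E K'" "a \<in> K" "b \<in> K'"
    "u \<in> K" "v \<in> K'" "(u, v) \<in> E"
proof -
  let ?F = "Restr E C"
  have symF: "sym ?F" using assms(1) by (rule sym_Restr)
  have "(a, b) \<in> ?F\<^sup>*" using linkedD[OF assms(2-4)] .
  then obtain y where y: "(y, b) \<in> ?F" "(a, y) \<in> (Restr ?F (- {b}))\<^sup>*"
    using rtrancl_last_step_before assms(5) by metis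
  have yb: "y \<noteq> b" using y(2) assms(5) by (auto elim: rtranclE)
  define K where "K = side ?F b y"
  have aK: "a \<in> K" using rtrancl_symD[OF sym_Restr[OF symF] y(2)] by (simp add: K_def side_def)
  have bK: "b \<notin> K" unfolding K_def using yb by (rule not_in_side)
  have KC: "K \<subseteq> C"
  proof
    fix x assume "x \<in> K"
    then have "(y, x) \<in> (Restr ?F (- {b}))\<^sup>*" by (simp add: K_def side_def)
    then show "x \<in> C" using y(1) by (cases rule: rtranclE) auto
  qed
  have "linked E K"
  proof (rule linked_from[OF assms(1)])
    fix x assume "x \<in> K"
    then have "(y, x) \<in> (Restr ?F K)\<^sup>*" unfolding K_def using side_connected yb by metis
    then show "(y, x) \<in> (Restr E K)\<^sup>*" by (rule rtrancl_subset_mono) auto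
  qed
  moreover have "linked E (C - K)"
  proof (rule linked_from[OF assms(1)])
    fix x assume x: "x \<in> C - K"
    have "(b, x) \<in> ?F\<^sup>*" using linkedD[OF assms(2,4)] x by simp
    then have "(b, x) \<in> (Restr ?F (- K))\<^sup>*"
      unfolding K_def using x yb by (intro rtrancl_outside_side) (auto simp: K_def)
    then show "(b, x) \<in> (Restr E (C - K))\<^sup>*" by (rule rtrancl_subset_mono) auto
  qed
  moreover have "y \<in> K" by (simp add: K_def side_refl)
  ultimately show thesis using that[of K "C - K" y b] KC aK bK assms(4) y(1) by blast
qed

lemma rtrancl_within_reachable:
  "(q, v) \<in> F\<^sup>* \<Longrightarrow> (q, v) \<in> (Restr F (F\<^sup>* `` {q}))\<^sup>*"
proof (induction rule: rtrancl_induct)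
  case (step y z)
  have "(q, z) \<in> F\<^sup>*" using step.hyps by (rule rtrancl_into_rtrancl)
  then have "(y, z) \<in> Restr F (F\<^sup>* `` {q})" using step.hyps by auto
  with step.IH show ?case by (rule rtrancl_into_rtrancl)
qed simp

lemma rtrancl_outside_reachable:
  assumes "sym F" "(v, r) \<in> F\<^sup>*" "v \<notin> F\<^sup>* `` {q}"
  shows "(v, r) \<in> (Restr F (- F\<^sup>* `` {q}))\<^sup>*"
proof -
  have "(v, r) \<in> (Restr F (F\<^sup>* `` {v}))\<^sup>*" using assms(2) by (rule rtrancl_within_reachable)
  moreover have "F\<^sup>* `` {v} \<subseteq> - F\<^sup>* `` {q}"
    using assms(1,3) rtrancl_symD rtrancl_trans by (metis ComplI Image_singleton_iff subsetI)
  then have "Restr F (F\<^sup>* `` {v}) \<subseteq> Restr F (- F\<^sup>* `` {q})" by auto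
  ultimately show ?thesis by (rule rtrancl_subset_mono)
qed

context rooted_graph
begin

text \<open>The leaves in \<open>L\<close> become single branches and \<open>Z - L\<close> the
  centre. A walk entering a leaf must return to the vertex it came from, so removing leaves keeps
  the rest connected and every leaf attached to it.\<close>

lemma star_modelI_singletons:
  assumes "F \<subseteq> E" "sym F" "linked F Z" "L \<subseteq> Z" "finite L" "card L = l" "\<And>v. v \<in> L \<Longrightarrow> deg F v = 1"
    and "L \<subseteq> S" "s \<in> Z - L" "s \<in> S"
  shows "\<exists>B. star_model Z B"
proof -
  let ?R = "(Restr F (Z - L))\<^sup>*"
  have reach: "y \<notin> L \<and> (s, y) \<in> ?R \<or> y \<in> L \<and> (\<exists>w\<in>Z - L. (w, y) \<in> F \<and> (s, w) \<in> ?R)" if y: "y \<in> Z" for y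
  proof -
    have "(s, y) \<in> (Restr F Z)\<^sup>*" using linkedD[OF assms(3)] assms(9) y by blast
    then show ?thesis
    proof (induction rule: rtrancl_induct)
      case base
      then show ?case using assms(9) by auto
    next
      case (step y y')
      have yy: "(y, y') \<in> F" "y \<in> Z" "y' \<in> Z" using step.hyps(2) by auto
      from step.IH show ?case
      proof
        assume y: "y \<notin> L \<and> (s, y) \<in> ?R"
        show ?thesis
        proof (cases "y' \<in> L")
          case False
          then have "(y, y') \<in> Restr F (Z - L)" using y yy by auto
          then show ?thesis using y False rtrancl_into_rtrancl by metis
        qed (use y yy in blast)
      next
        assume "y \<in> L \<and> (\<exists>w\<in>Z - L. (w, y) \<in> F \<and> (s, w) \<in> ?R)"
        then obtain w where w: "y \<in> L" "w \<in> Z - L" "(w, y) \<in> F" "(s, w) \<in> ?R" by blast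
        have "card (F `` {y}) = 1" using assms(7) w(1) by blast
        moreover have "w \<in> F `` {y}" "y' \<in> F `` {y}" using w(3) yy(1) symD[OF assms(2)] by auto
        ultimately have "y' = w" by (metis card_1_singletonE singletonD)
        then show ?thesis using w by blast
      qed
    qed
  qed
  have "linked F (Z - L)" by (rule linked_from[OF assms(2), of _ s]) (use reach in blast)
  then have link: "linked E (Z - L)" using assms(1) by (rule linked_mono_rel)
  obtain f where f: "bij_betw f {1..l} L" using ex_bij_betw_nat_finite_1[OF assms(5)] assms(6) by auto
  define B where "B i = (if i = 0 then Z - L else {f i})" for i
  have fL: "f i \<in> L" if "1 \<le> i" "i \<le> l" for i using bij_betwE[OF f] that by simp
  have finj: "f i \<noteq> f j" if "1 \<le> i" "i \<le> l" "1 \<le> j" "j \<le> l" "i \<noteq> j" for i j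
    using inj_onD[OF bij_betw_imp_inj_on[OF f], of i j] that by auto
  have "star_model Z B"
    unfolding star_model_def
  proof (intro conjI allI impI)
    fix i assume i: "i \<le> l"
    have fi: "f i \<in> L" if "i \<noteq> 0" using fL[of i] that i by simp
    show "B i \<subseteq> Z" using fi assms(4) by (auto simp: B_def)
    show "linked E (B i)" using link by (simp add: B_def linked_singleton)
    show "B i \<inter> S \<noteq> {}" using fi assms(8-10) by (auto simp: B_def)
    fix j assume j: "j \<le> l" "i \<noteq> j"
    have fj: "f j \<in> L" if "j \<noteq> 0" using fL[of j] that j by simp
    show "B i \<inter> B j = {}" using fi fj finj[of i j] i j by (auto simp: B_def)
  next
    fix i assume i: "1 \<le> i \<and> i \<le> l"
    then have fi: "f i \<in> L" using fL by simp
    then obtain w where "w \<in> Z - L" "(w, f i) \<in> F" using reach[of "f i"] assms(4) by blast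
    then show "\<exists>u\<in>B 0. \<exists>v\<in>B i. (u, v) \<in> E" using i assms(1) by (auto simp: B_def)
  qed
  then show ?thesis by blast
qed

text \<open>Split \<open>K\<close> between \<open>s\<close> and \<open>t\<close>. The half that
  contains \<open>u\<close> is the centre: it touches both the other half and
  \<open>K'\<close>.\<close>

lemma star_model_two_parts:
  assumes "l = 2" "linked E K" "linked E K'" "K \<inter> K' = {}" "u \<in> K" "v \<in> K'" "(u, v) \<in> E"
    and "s \<in> K \<inter> S" "t \<in> K \<inter> S" "s \<noteq> t" "K' \<inter> S \<noteq> {}"
  shows "\<exists>B. star_model (K \<union> K') B"
proof -
  obtain P P' a b where P: "K = P \<union> P'" "P \<inter> P' = {}" "linked E P" "linked E P'" "s \<in> P" "t \<in> P'"
    "a \<in> P" "b \<in> P'" "(a, b) \<in> E"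
    using linked_split[OF symE assms(2), of s t] assms(8-10) by blast
  have ba: "(b, a) \<in> E" using P(9) symD[OF symE] by blast
  have all_le: "(\<forall>i\<le>l. R i) \<longleftrightarrow> R 0 \<and> R 1 \<and> R 2" for R
    using assms(1) by (auto simp: le_Suc_eq numeral_2_eq_2)
  have all_le1: "(\<forall>i. 1 \<le> i \<and> i \<le> l \<longrightarrow> R i) \<longleftrightarrow> R 1 \<and> R 2" for R
    using assms(1) by (auto simp: le_Suc_eq numeral_2_eq_2)
  have mk: "star_model (K \<union> K') (\<lambda>i. if i = 0 then X else if i = 1 then Y else K')"
    if "X \<union> Y = K" "X \<inter> Y = {}" "linked E X" "linked E Y" "X \<inter> S \<noteq> {}" "Y \<inter> S \<noteq> {}"
      "u \<in> X" "c \<in> X" "d \<in> Y" "(c, d) \<in> E" for X Y c d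
    unfolding star_model_def all_le all_le1
    using that assms(3,4,6,7,11) by (simp; blast)
  show ?thesis
  proof (cases "u \<in> P")
    case True
    have "star_model (K \<union> K') (\<lambda>i. if i = 0 then P else if i = 1 then P' else K')"
      by (rule mk[of P P' a b]) (use P True assms(8,9) in auto)
    then show ?thesis by blast
  next
    case False
    have "star_model (K \<union> K') (\<lambda>i. if i = 0 then P' else if i = 1 then P else K')"
      by (rule mk[of P' P b a]) (use P False assms(5,8,9) ba in auto)
    then show ?thesis by blast
  qed
qed

text \<open>Split \<open>Z\<close> between two vertices of \<open>S\<close>. For
  \<open>l = 1\<close> the halves are the model; for \<open>l = 2\<close> the half that contains a
  third vertex of \<open>S\<close> is split once more.\<close>

lemma star_modelI_few:
  assumes "th = 2" "linked E Z" "T \<subseteq> Z \<inter> S" "l < card T"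
  shows "\<exists>B. star_model Z B"
proof -
  have fin: "finite T" using assms(4) by (intro card_ge_0_finite) simp
  have l12: "l = 1 \<or> l = 2" using th assms(1) by auto
  have "2 \<le> card T" using assms(4) l12 by auto
  then have "\<not> card T \<le> Suc 0" by simp
  then obtain s t where st: "s \<in> T" "t \<in> T" "s \<noteq> t"
    unfolding card_le_Suc0_iff_eq[OF fin] by blast
  have TZ: "s \<in> Z" "s \<in> S" "t \<in> Z" "t \<in> S" using st assms(3) by auto
  obtain K K' u v where K: "Z = K \<union> K'" "K \<inter> K' = {}" "linked E K" "linked E K'" "s \<in> K" "t \<in> K'"
    "u \<in> K" "v \<in> K'" "(u, v) \<in> E"
    using linked_split[OF symE assms(2) TZ(1,3) st(3)] by metis
  have vu: "(v, u) \<in> E" using K(9) symD[OF symE] by blast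
  from l12 show ?thesis
  proof
    assume l: "l = 1"
    have "star_model Z (\<lambda>i. if i = 0 then K else K')"
    proof -
      have all_le: "(\<forall>i\<le>l. R i) \<longleftrightarrow> R 0 \<and> R 1" for R
        using l by (auto simp: le_Suc_eq)
      have all_le1: "(\<forall>i. 1 \<le> i \<and> i \<le> l \<longrightarrow> R i) \<longleftrightarrow> R 1" for R
        using l by (auto simp: le_Suc_eq)
      show ?thesis unfolding star_model_def all_le all_le1 using K TZ by auto
    qed
    then show ?thesis by blast
  next
    assume l: "l = 2"
    have "\<not> T \<subseteq> {s, t}"
    proof
      assume "T \<subseteq> {s, t}"
      then have "card T \<le> card {s, t}" by (intro card_mono) auto
      then show False using assms(4) st(3) l by simp
    qed
    then obtain r where r: "r \<in> Z" "r \<in> S" "r \<noteq> s" "r \<noteq> t" using assms(3) by blast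
    show ?thesis
    proof (cases "r \<in> K")
      case True
      then show ?thesis
        using star_model_two_parts[OF l K(3,4,2,7,8,9), of s r] K(1,5,6) TZ r by auto
    next
      case False
      then have "r \<in> K'" using r K(1) by blast
      then show ?thesis
        using star_model_two_parts[OF l K(4,3) _ K(8,7) vu, of t r] K(1,2,5,6) TZ r
        by (auto simp: Un_commute Int_commute)
    qed
  qed
qed

text \<open>For \<open>th = 1\<close>, \<open>l\<close> terminals become branches and one more roots
  the centre, which is why more than \<open>l\<close> are demanded.\<close>

lemma star_modelI_terminals:
  assumes "subgraph_in W F" "linked F P" "l < card (P \<inter> terminals F)"
  shows "\<exists>B. star_model P B"
proof -
  have F: "F \<subseteq> E" "sym F" "finite F" using assms(1) subgraph_in_finite by (auto simp: subgraph_in_def)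
  show ?thesis
  proof (cases "th = 1")
    case True
    obtain L where L: "L \<subseteq> P \<inter> terminals F" "card L = l" "finite L"
      using obtain_subset_with_card_n[of l "P \<inter> terminals F"] assms(3) by (metis less_imp_le)
    have "L \<noteq> P \<inter> terminals F" using L(2) assms(3) by auto
    then obtain s where s: "s \<in> P \<inter> terminals F" "s \<notin> L" using L(1) by blast
    have t: "v \<in> S \<and> deg F v = 1" if "v \<in> terminals F" for v
    proof -
      have "v \<in> S" "1 \<le> deg F v" "deg F v \<le> th" using that by (simp_all add: terminals_def)
      then show ?thesis using True by simp
    qed
    show ?thesis
      by (rule star_modelI_singletons[OF F(1,2) assms(2) _ L(3,2), of s]) (use L s t in auto)
  next
    case False
    then have "th = 2" using th by auto
    moreover have "linked E P" using assms(2) F(1) by (rule linked_mono_rel)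
    moreover have "P \<inter> terminals F \<subseteq> P \<inter> S" by (auto simp: terminals_def)
    ultimately show ?thesis using assms(3) star_modelI_few by metis
  qed
qed

section \<open>Existence of stable forests\<close>

lemma deg_mono: "finite F \<Longrightarrow> F' \<subseteq> F \<Longrightarrow> deg F' v \<le> deg F v"
  using finite_Image_rel[of F "{v}"] by (intro card_mono) auto

lemma excess_mono: "finite F \<Longrightarrow> F' \<subseteq> F \<Longrightarrow> excess F' \<le> excess F"
  unfolding excess_def by (intro sum_mono diff_le_mono deg_mono)

lemma excess_zeroI: "(\<And>v. deg F v \<le> 3) \<Longrightarrow> excess F = 0"
  by (simp add: excess_def)

lemma excess_zeroD:
  assumes "subgraph_in W F" "excess F = 0"
  shows "deg F v \<le> 3"
proof (cases "v \<in> Domain E")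
  case True
  then show ?thesis using assms(2) finE by (simp add: excess_def finite_Domain)
next
  case False
  then have "F `` {v} = {}" using assms(1) by (auto simp: subgraph_in_def)
  then show ?thesis by simp
qed

text \<open>Removing edges only lowers degrees, so a terminal is lost only by becoming
  isolated.\<close>

lemma terminals_reduce:
  assumes "finite F" "F' \<subseteq> F" "t \<in> terminals F" "t \<in> Domain F'"
  shows "t \<in> terminals F'"
proof -
  have "finite F'" using assms(1,2) finite_subset by metis
  then have "1 \<le> deg F' t" using deg_pos_iff assms(4) by metis
  moreover have "deg F' t \<le> deg F t" using deg_mono assms(1,2) by metis
  ultimately show ?thesis using assms(3) by (simp add: terminals_def)
qed

text \<open>Edge-minimality supplies the two structural conditions: an edge on a cycle can be
  removed, and so can the edge at a leaf outside \<open>S\<close>. Neither removal loses a terminal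
  or a vertex of \<open>S\<close>, and neither needs more roots.\<close>

lemma stableI:
  assumes sub: "subgraph_in W F" and spans: "spans F Q"
    and max: "\<And>F' Q'. subgraph_in W F' \<Longrightarrow> spans F' Q' \<Longrightarrow> card Q' \<le> card Q \<Longrightarrow> excess F' \<le> excess F \<Longrightarrow>
      card (terminals F') \<le> card (terminals F)"
    and min: "\<And>F' Q'. F' \<subset> F \<Longrightarrow> subgraph_in W F' \<Longrightarrow> spans F' Q' \<Longrightarrow> card Q' \<le> card Q \<Longrightarrow>
      terminals F \<subseteq> terminals F' \<Longrightarrow> S \<inter> Domain F \<subseteq> Domain F' \<Longrightarrow> False"
    and two: "\<And>v. v \<in> Domain F \<Longrightarrow> \<exists>s t. s \<in> terminals F \<and> t \<in> terminals F \<and> s \<noteq> t \<and> (v, s) \<in> F\<^sup>* \<and> (v, t) \<in> F\<^sup>*"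
  shows "stable W F Q"
proof -
  have fin: "finite F" and sym: "sym F" using sub subgraph_in_finite by (auto simp: subgraph_in_def)
  have br: "bridged F"
    unfolding bridged_def
  proof (intro allI impI notI)
    fix u v assume uv: "(u, v) \<in> F" "(u, v) \<in> (F - {(u, v), (v, u)})\<^sup>*"
    let ?F = "F - {(u, v), (v, u)}"
    have sF: "subgraph_in W ?F" using sub by (auto simp: subgraph_in_def sym_def)
    have "u \<noteq> v" using uv(1) sub irreflE by (auto simp: subgraph_in_def)
    have uv': "(v, u) \<in> ?F\<^sup>*" using rtrancl_symD[OF subgraph_in_sym[OF sF] uv(2)] .
    have "u \<in> Domain ?F" using uv(2) \<open>u \<noteq> v\<close> by (cases rule: converse_rtranclE) auto
    moreover have "v \<in> Domain ?F" using uv' \<open>u \<noteq> v\<close> by (cases rule: converse_rtranclE) auto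
    ultimately have dom: "Domain F \<subseteq> Domain ?F" by auto
    have "F \<subseteq> ?F\<^sup>*"
    proof
      fix e assume "e \<in> F"
      then consider "e \<in> ?F" | "e = (u, v)" | "e = (v, u)" by auto
      then show "e \<in> ?F\<^sup>*" using uv(2) uv' by cases auto
    qed
    then have reach: "F\<^sup>* \<subseteq> ?F\<^sup>*" using rtrancl_mono rtrancl_idemp by metis
    have "spans ?F Q" using spans reach unfolding spans_def by blast
    moreover have "terminals F \<subseteq> terminals ?F"
      using terminals_reduce[OF fin, of ?F] terminals_subset[OF fin] dom by blast
    ultimately show False using min[of ?F Q] sF uv(1) dom by blast
  qed
  have "v \<in> S" if v: "deg F v = 1" for v
  proof (rule ccontr)
    assume vS: "v \<notin> S"
    obtain u where Fv: "F `` {v} = {u}" using v by (rule card_1_singletonE)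
    then have vu: "(v, u) \<in> F" by auto
    then have uv: "(u, v) \<in> F" using symD[OF sym] by blast
    have "u \<noteq> v" using bridged_irrefl[OF br] uv by metis
    \<comment> \<open>Otherwise the component is \<open>{u, v}\<close> and both vertices are its
      terminals, although \<open>v \<notin> S\<close>.\<close>
    have "\<exists>w. (u, w) \<in> F \<and> w \<noteq> v"
    proof (rule ccontr)
      assume "\<not> ?thesis"
      then have Fu: "F `` {u} \<subseteq> {v}" by auto
      have "x \<in> {u, v}" if "(v, x) \<in> F\<^sup>*" for x
        using that by (induction rule: rtrancl_induct) (use Fu Fv in auto)
      moreover obtain s t where "s \<in> terminals F" "t \<in> terminals F" "s \<noteq> t" "(v, s) \<in> F\<^sup>*" "(v, t) \<in> F\<^sup>*"
        using two[of v] vu by blast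
      ultimately have "v \<in> terminals F" by blast
      then show False using vS by (simp add: terminals_def)
    qed
    then obtain w where w: "(u, w) \<in> F" "w \<noteq> v" by blast
    let ?F = "F - {(u, v), (v, u)}"
    have sF: "subgraph_in W ?F" using sub by (auto simp: subgraph_in_def sym_def)
    have dom: "Domain F - {v} \<subseteq> Domain ?F" using w \<open>u \<noteq> v\<close> by auto
    have step: "y \<noteq> v \<and> (x, y) \<in> ?F\<^sup>* \<or> y = v \<and> (x, u) \<in> ?F\<^sup>*" if "(x, y) \<in> F\<^sup>*" "x \<noteq> v" for x y
      using that
    proof (induction rule: rtrancl_induct)
      case (step y z)
      from step.IH[OF step.prems] show ?case
      proof
        assume y: "y \<noteq> v \<and> (x, y) \<in> ?F\<^sup>*"
        show ?thesis
        proof (cases "z = v")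
          case True
          then have "y = u" using symD[OF sym step.hyps(2)] Fv by auto
          then show ?thesis using y True by blast
        next
          case False
          then have "(y, z) \<in> ?F" using y step.hyps(2) by auto
          then show ?thesis using y False rtrancl_into_rtrancl by metis
        qed
      next
        assume y: "y = v \<and> (x, u) \<in> ?F\<^sup>*"
        then have "z = u" using step.hyps(2) Fv by auto
        then show ?thesis using y \<open>u \<noteq> v\<close> by blast
      qed
    qed simp
    \<comment> \<open>A root placed at the removed leaf moves to its neighbour.\<close>
    define Q' where "Q' = (if v \<in> Q then insert u (Q - {v}) else Q)"
    have finQ: "finite Q" using spans by (simp add: spans_def)
    have "spans ?F Q'"
      unfolding spans_def
    proof (intro conjI ballI)
      show "finite Q'" using finQ by (simp add: Q'_def)
      fix x assume x: "x \<in> Domain ?F"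
      then have "x \<noteq> v" using Fv by auto
      moreover obtain r where r: "r \<in> Q" "(x, r) \<in> F\<^sup>*" using x spans unfolding spans_def by blast
      ultimately consider "r \<noteq> v" "(x, r) \<in> ?F\<^sup>*" | "r = v" "(x, u) \<in> ?F\<^sup>*" using step by blast
      then show "\<exists>q\<in>Q'. (x, q) \<in> ?F\<^sup>*" using r(1) by cases (auto simp: Q'_def)
    qed
    moreover have "card Q' \<le> card Q"
    proof (cases "v \<in> Q")
      case True
      then have "card Q' \<le> Suc (card (Q - {v}))" by (simp add: Q'_def card_insert_le_m1 card_insert_if finQ)
      also have "\<dots> = card Q" using card.remove[OF finQ True] by simp
      finally show ?thesis .
    qed (simp add: Q'_def)
    moreover have "terminals F \<subseteq> terminals ?F"
    proof
      fix t assume t: "t \<in> terminals F"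
      then have "t \<in> S" by (simp add: terminals_def)
      then have "t \<noteq> v" using vS by blast
      then have "t \<in> Domain ?F" using t terminals_subset[OF fin] dom by blast
      then show "t \<in> terminals ?F" using terminals_reduce[OF fin, of ?F t] t by auto
    qed
    moreover have "S \<inter> Domain F \<subseteq> Domain ?F" using dom vS by blast
    ultimately show False using min[of ?F Q'] sF uv by blast
  qed
  then show ?thesis unfolding stable_def using sub spans br max by blast
qed

text \<open>The two halves of the duality in one object: the last conjunct turns the hitting set,
  measured in terminals, into a price per packed model.\<close>

definition packing_forest :: "'a set \<Rightarrow> 'a rel \<Rightarrow> 'a set \<Rightarrow> 'a set set \<Rightarrow> bool" where
  "packing_forest W F Q \<P> \<longleftrightarrow> stable W F Q \<and> finite \<P> \<and> \<P> \<noteq> {} \<and> pairwise disjnt \<P> \<and>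
     (\<forall>P\<in>\<P>. P \<subseteq> Domain F \<and> (\<exists>B. star_model P B)) \<and> card (terminals F) \<le> 3 * l * card \<P>"

lemma reachable_linked:
  assumes "sym F"
  shows "linked F (F\<^sup>* `` {q})"
proof (rule linked_from[OF assms, of _ q])
  fix x assume "x \<in> F\<^sup>* `` {q}"
  then have "(q, x) \<in> F\<^sup>*" by simp
  then show "(q, x) \<in> (Restr F (F\<^sup>* `` {q}))\<^sup>*" by (rule rtrancl_within_reachable)
qed

lemma ex_optimal_subcubic:
  assumes "subgraph_in W F0" "excess F0 = 0" "spans F0 Q0" "l * card Q0 < card (terminals F0)"
  obtains F Q where "subgraph_in W F" "excess F = 0" "spans F Q" "l * card Q < card (terminals F)"
    "\<And>F' Q'. subgraph_in W F' \<Longrightarrow> excess F' = 0 \<Longrightarrow> spans F' Q' \<Longrightarrow>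
       card (terminals F') + l * card Q \<le> card (terminals F) + l * card Q'"
    "\<And>F' Q'. subgraph_in W F' \<Longrightarrow> excess F' = 0 \<Longrightarrow> spans F' Q' \<Longrightarrow>
       card (terminals F) + l * card Q' \<le> card (terminals F') + l * card Q \<Longrightarrow> card F \<le> card F'"
proof -
  let ?n = "card (Domain E)"
  let ?g = "\<lambda>(F, Q). subgraph_in W F \<and> excess F = 0 \<and> spans F Q"
  \<comment> \<open>The objective with reversed sign, shifted by \<open>?n\<close> to stay a natural
    number: a forest has at most \<open>?n\<close> terminals.\<close>
  let ?m = "\<lambda>(F, Q). ?n + l * card Q - card (terminals F)"
  have le: "card (terminals F) \<le> ?n" if "subgraph_in W F" for F
  proof -
    have "terminals F \<subseteq> Domain F" using terminals_subset[OF subgraph_in_finite[OF that]] by blast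
    also have "\<dots> \<subseteq> Domain E" using that by (auto simp: subgraph_in_def)
    finally show ?thesis using finE by (intro card_mono) (auto simp: finite_Domain)
  qed
  have "?g (F0, Q0)" using assms by simp
  then obtain p where p: "?g p" "\<And>p'. ?g p' \<Longrightarrow> ?m p \<le> ?m p'"
    using ex_has_least_nat[of ?g "(F0, Q0)" ?m] by blast
  let ?g' = "\<lambda>p'. ?g p' \<and> ?m p' = ?m p"
  obtain q where q: "?g' q" "\<And>q'. ?g' q' \<Longrightarrow> card (fst q) \<le> card (fst q')"
    using ex_has_least_nat[of ?g' p "\<lambda>q. card (fst q)"] p(1) by blast
  obtain F Q where FQ: "q = (F, Q)" by (cases q)
  have g: "subgraph_in W F" "excess F = 0" "spans F Q" using q(1) FQ by auto
  have opt: "card (terminals F') + l * card Q \<le> card (terminals F) + l * card Q'"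
    if "subgraph_in W F'" "excess F' = 0" "spans F' Q'" for F' Q'
    using p(2)[of "(F', Q')"] q(1) FQ that le[OF that(1)] le[OF g(1)] by auto
  have min: "card F \<le> card F'"
    if "subgraph_in W F'" "excess F' = 0" "spans F' Q'" "card (terminals F) + l * card Q' \<le> card (terminals F') + l * card Q" for F' Q'
  proof -
    have "?m (F', Q') \<le> ?m (F, Q)" using that(4) le[OF that(1)] le[OF g(1)] by auto
    moreover have "?m p \<le> ?m (F', Q')" using p(2)[of "(F', Q')"] that by simp
    ultimately show ?thesis using q(2)[of "(F', Q')"] q(1) FQ that by auto
  qed
  have "l * card Q < card (terminals F)" using opt[OF assms(1-3)] assms(4) by linarith
  then show thesis using that[OF g] opt min by blast
qed

text \<open>Every component has more than \<open>l\<close> terminals, so it splits into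
  \<open>p \<ge> 1\<close> parts and has at most \<open>2 * l * p + l \<le> 3 * l * p\<close>
  terminals.\<close>

lemma ex_packing_forest_subcubic:
  assumes "subgraph_in W F0" "excess F0 = 0" "spans F0 Q0" "l * card Q0 < card (terminals F0)"
  shows "\<exists>F Q \<P>. packing_forest W F Q \<P>"
proof -
  obtain F Q where sub: "subgraph_in W F" and excess: "excess F = 0" and spans: "spans F Q"
    and pos: "l * card Q < card (terminals F)"
    and opt: "\<And>F' Q'. subgraph_in W F' \<Longrightarrow> excess F' = 0 \<Longrightarrow> spans F' Q' \<Longrightarrow>
       card (terminals F') + l * card Q \<le> card (terminals F) + l * card Q'"
    and min: "\<And>F' Q'. subgraph_in W F' \<Longrightarrow> excess F' = 0 \<Longrightarrow> spans F' Q' \<Longrightarrow>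
       card (terminals F) + l * card Q' \<le> card (terminals F') + l * card Q \<Longrightarrow> card F \<le> card F'"
    using ex_optimal_subcubic[OF assms] by blast
  have fin: "finite F" and sym: "sym F" using sub subgraph_in_finite by (auto simp: subgraph_in_def)
  have finQ: "finite Q" using spans by (simp add: spans_def)
  define T where "T q = F\<^sup>* `` {q}" for q
  have finT: "finite (T q)" for q
  proof -
    have "T q \<subseteq> insert q (Range F)" by (auto simp: T_def elim: rtranclE)
    then show ?thesis using fin finite_Range finite_subset by blast
  qed
  have cardQ: "card (Q - {q}) + 1 = card Q" if "q \<in> Q" for q
    using card.remove[OF finQ that] by simp
  have not_spans: "\<not> spans F (Q - {q})" if "q \<in> Q" for q
  proof
    assume "spans F (Q - {q})"
    then have "l * card Q \<le> l * card (Q - {q})" using opt[OF sub excess] by fastforce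
    then show False using cardQ[OF that] l_pos by (metis Suc_eq_plus1 Suc_n_not_le_n mult_le_cancel1 not_one_le_zero gr0I)
  qed
  have T_terminals: "l < card (T q \<inter> terminals F)" if q: "q \<in> Q" for q
  proof (rule ccontr)
    assume small: "\<not> l < card (T q \<inter> terminals F)"
    let ?F = "Restr F (- T q)"
    have sF: "subgraph_in W ?F" using sub sym_Restr by (auto simp: subgraph_in_def)
    have excess': "excess ?F = 0" using excess_mono[OF fin, of ?F] excess by auto
    have sp: "spans ?F (Q - {q})"
      unfolding spans_def
    proof (intro conjI ballI)
      fix v assume v: "v \<in> Domain ?F"
      then obtain r where r: "r \<in> Q" "(v, r) \<in> F\<^sup>*" using spans unfolding spans_def by blast
      have vT: "v \<notin> T q" using v by auto
      then have "(v, r) \<in> ?F\<^sup>*" unfolding T_def by (intro rtrancl_outside_reachable[OF sym r(2)])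
      moreover have "r \<noteq> q" using vT r(2) rtrancl_symD[OF sym] by (auto simp: T_def)
      ultimately show "\<exists>r\<in>Q - {q}. (v, r) \<in> ?F\<^sup>*" using r(1) by blast
    qed (use finQ in simp)
    have "terminals F - T q \<subseteq> terminals ?F"
    proof
      fix t assume t: "t \<in> terminals F - T q"
      then obtain w where w: "(t, w) \<in> F" using terminals_subset[OF fin] by blast
      have "w \<notin> T q"
      proof
        assume "w \<in> T q"
        then have "(q, t) \<in> F\<^sup>*"
          using symD[OF sym w] rtrancl_into_rtrancl[of q w F t] by (simp add: T_def)
        then show False using t by (simp add: T_def)
      qed
      then have "t \<in> Domain ?F" using w t by auto
      then show "t \<in> terminals ?F" using terminals_reduce[OF fin, of ?F] t by auto
    qed
    then have "card (terminals F - T q) \<le> card (terminals ?F)"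
      using finite_terminals[OF subgraph_in_finite[OF sF]] by (intro card_mono)
    moreover have "card (terminals F) \<le> card (terminals F - T q) + card (T q \<inter> terminals F)"
    proof -
      have "terminals F = (terminals F - T q) \<union> (T q \<inter> terminals F)" by blast
      then show ?thesis using card_Un_le by metis
    qed
    ultimately have "card (terminals F) \<le> card (terminals ?F) + l" using small by simp
    moreover have "l * card Q = l * card (Q - {q}) + l" using cardQ[OF q] by (metis add_mult_distrib2 mult.right_neutral)
    ultimately have "card F \<le> card ?F" using min[OF sF excess' sp] by linarith
    moreover have "?F \<subseteq> F" by auto
    ultimately have "?F = F" using fin card_seteq by metis
    then show False using sp not_spans[OF q] by simp
  qed
  have T_disj: "T q \<inter> T r = {}" if qr_in: "q \<in> Q" "r \<in> Q" "q \<noteq> r" for q r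
  proof (rule ccontr)
    assume "T q \<inter> T r \<noteq> {}"
    then obtain x where "(q, x) \<in> F\<^sup>*" "(r, x) \<in> F\<^sup>*" by (auto simp: T_def)
    then have qr: "(q, r) \<in> F\<^sup>*" using rtrancl_symD[OF sym] rtrancl_trans by metis
    have "spans F (Q - {q})"
      unfolding spans_def
    proof (intro conjI ballI)
      fix v assume "v \<in> Domain F"
      then obtain u where u: "u \<in> Q" "(v, u) \<in> F\<^sup>*" using spans unfolding spans_def by blast
      show "\<exists>u\<in>Q - {q}. (v, u) \<in> F\<^sup>*"
      proof (cases "u = q")
        case True
        then have "(v, r) \<in> F\<^sup>*" using u(2) qr rtrancl_trans by metis
        then show ?thesis using qr_in by blast
      qed (use u in blast)
    qed (use finQ in simp)
    then show False using not_spans qr_in(1) by blast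
  qed
  have T_dom: "T q \<subseteq> Domain F" if "q \<in> Q" for q
  proof
    fix v assume v: "v \<in> T q"
    show "v \<in> Domain F"
    proof (rule ccontr)
      assume vD: "v \<notin> Domain F"
      have vq: "(v, q) \<in> F\<^sup>*" using v rtrancl_symD[OF sym] by (auto simp: T_def)
      then have "v = q" using vD by (auto elim: converse_rtranclE)
      then have "T q \<subseteq> {v}" using vD by (auto simp: T_def elim: converse_rtranclE)
      then have "T q \<inter> terminals F = {}" using vD terminals_subset[OF fin] by blast
      then show False using T_terminals[OF that] by simp
    qed
  qed
  have stable: "stable W F Q"
  proof (rule stableI[OF sub spans])
    fix F' Q' assume *: "subgraph_in W F'" "spans F' Q'" "card Q' \<le> card Q" "excess F' \<le> excess F"
    have "l * card Q' \<le> l * card Q" using *(3) by (rule mult_le_mono2)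
    moreover have "excess F' = 0" using *(4) excess by simp
    ultimately show "card (terminals F') \<le> card (terminals F)" using opt[OF *(1) _ *(2)] by linarith
  next
    fix F' Q' assume *: "F' \<subset> F" "subgraph_in W F'" "spans F' Q'" "card Q' \<le> card Q" "terminals F \<subseteq> terminals F'"
    have "excess F' = 0" using excess_mono[OF fin, of F'] excess *(1) by simp
    moreover have "l * card Q' \<le> l * card Q" using *(4) by (rule mult_le_mono2)
    moreover have "card (terminals F) \<le> card (terminals F')"
      using *(5) finite_terminals[OF subgraph_in_finite[OF *(2)]] by (intro card_mono)
    ultimately have "card F \<le> card F'" using min[OF *(2) _ *(3)] by linarith
    then show False using psubset_card_mono[OF fin *(1)] by simp
  next
    fix v assume "v \<in> Domain F"
    then obtain q where q: "q \<in> Q" "(v, q) \<in> F\<^sup>*" using spans unfolding spans_def by blast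
    have "\<not> card (T q \<inter> terminals F) \<le> Suc 0" using T_terminals[OF q(1)] l_pos by simp
    then obtain s t where "s \<in> T q \<inter> terminals F" "t \<in> T q \<inter> terminals F" "s \<noteq> t"
      using card_le_Suc0_iff_eq[of "T q \<inter> terminals F"] finT[of q] by auto
    moreover have "(v, x) \<in> F\<^sup>*" if "x \<in> T q" for x 
      using that q(2) rtrancl_trans[of v q F x] by (simp add: T_def)
    ultimately show "\<exists>s t. s \<in> terminals F \<and> t \<in> terminals F \<and> s \<noteq> t \<and> (v, s) \<in> F\<^sup>* \<and> (v, t) \<in> F\<^sup>*" by blast
  qed
  have br: "bridged F" using stable by (simp add: stable_def)
  have deg3: "deg F v \<le> 3" for v using excess_zeroD[OF sub excess] .
  have deg2: "deg F v \<le> 2" if "v \<in> terminals F" for v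
  proof -
    have "deg F v \<le> th" using that by (simp add: terminals_def)
    then show ?thesis using th_pos(2) by simp
  qed
  have "\<exists>\<P>. finite \<P> \<and> pairwise disjnt \<P> \<and>
      (\<forall>P\<in>\<P>. P \<subseteq> T q \<and> linked F P \<and> l < card (P \<inter> terminals F)) \<and>
      card (T q \<inter> terminals F) \<le> 2 * l * card \<P> + l" for q
    by (rule split_into_linked_parts[OF fin sym br deg3 deg2 l_pos finT])
      (auto simp: T_def reachable_linked[OF sym])
  then obtain \<P> where \<P>: "\<And>q. finite (\<P> q)" "\<And>q. pairwise disjnt (\<P> q)"
    "\<And>q P. P \<in> \<P> q \<Longrightarrow> P \<subseteq> T q \<and> linked F P \<and> l < card (P \<inter> terminals F)"
    "\<And>q. card (T q \<inter> terminals F) \<le> 2 * l * card (\<P> q) + l"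
    by metis
  let ?P = "\<Union>q\<in>Q. \<P> q"
  have ne: "P \<noteq> {}" if "P \<in> \<P> q" for P q using \<P>(3)[OF that] by auto
  have disj: "P \<inter> P' = {}" if "P \<in> \<P> q" "P' \<in> \<P> r" "q \<in> Q" "r \<in> Q" "q \<noteq> r" for P P' q r
    using \<P>(3)[OF that(1)] \<P>(3)[OF that(2)] T_disj[OF that(3-5)] by blast
  have "packing_forest W F Q ?P"
    unfolding packing_forest_def
  proof (intro conjI)
    show "finite ?P" using finQ \<P>(1) by blast
    have cardP: "card ?P = (\<Sum>q\<in>Q. card (\<P> q))"
    proof (rule card_UN_disjoint[OF finQ])
      show "\<forall>q\<in>Q. \<forall>r\<in>Q. q \<noteq> r \<longrightarrow> \<P> q \<inter> \<P> r = {}"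
      proof (intro ballI impI)
        fix q r assume "q \<in> Q" "r \<in> Q" "q \<noteq> r"
        then show "\<P> q \<inter> \<P> r = {}" using disj[of _ q _ r] ne by fastforce
      qed
    qed (use \<P>(1) in blast)
    show "pairwise disjnt ?P"
    proof (rule pairwiseI)
      fix P P' assume "P \<in> ?P" "P' \<in> ?P" and PP: "P \<noteq> P'"
      then obtain q r where qr: "q \<in> Q" "P \<in> \<P> q" "r \<in> Q" "P' \<in> \<P> r" by blast
      show "disjnt P P'"
      proof (cases "q = r")
        case True
        then show ?thesis using pairwiseD[OF \<P>(2)[of q]] qr PP by blast
      qed (use disj qr in \<open>auto simp: disjnt_def\<close>)
    qed
    show "\<forall>P\<in>?P. P \<subseteq> Domain F \<and> (\<exists>B. star_model P B)"
      using \<P>(3) T_dom star_modelI_terminals[OF sub] by blast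
    have "terminals F \<subseteq> (\<Union>q\<in>Q. T q \<inter> terminals F)"
    proof
      fix t assume t: "t \<in> terminals F"
      then obtain q where "q \<in> Q" "(t, q) \<in> F\<^sup>*" using terminals_subset[OF fin] spans unfolding spans_def by blast
      then show "t \<in> (\<Union>q\<in>Q. T q \<inter> terminals F)" using t rtrancl_symD[OF sym] by (auto simp: T_def)
    qed
    then have "card (terminals F) \<le> card (\<Union>q\<in>Q. T q \<inter> terminals F)"
      using finQ finT by (intro card_mono) auto
    also have "\<dots> \<le> (\<Sum>q\<in>Q. card (T q \<inter> terminals F))" using finQ by (rule card_UN_le)
    also have "\<dots> \<le> (\<Sum>q\<in>Q. 3 * l * card (\<P> q))"
    proof (rule sum_mono)
      fix q assume q: "q \<in> Q"
      have "card (\<P> q) \<noteq> 0"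
      proof
        assume "card (\<P> q) = 0"
        then show False using T_terminals[OF q] \<P>(4)[of q] by simp
      qed
      then have "l \<le> l * card (\<P> q)" by simp
      then show "card (T q \<inter> terminals F) \<le> 3 * l * card (\<P> q)" using \<P>(4)[of q] by linarith
    qed
    also have "\<dots> = 3 * l * card ?P" by (simp add: cardP sum_distrib_left)
    finally show le: "card (terminals F) \<le> 3 * l * card ?P" .
    show "?P \<noteq> {}"
    proof
      assume "?P = {}"
      then have "card ?P = 0" by simp
      then show False using le pos by simp
    qed
  qed (rule stable)
  then show ?thesis by blast
qed

text \<open>Keep all edges within the centre and add, for each branch, a shortest path to one of its
  \<open>S\<close>-vertices. These end vertices are leaves. Cycles and large degrees are harmless,
  as the result only starts a minimisation.\<close>

lemma star_model_forest:
  assumes "th = 1" "star_model W B"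
  shows "\<exists>F q. subgraph_in W F \<and> spans F {q} \<and> l \<le> card (terminals F) \<and> l < card (S \<inter> Domain F)"
proof -
  note B = star_modelD[OF assms(2)]
  define s where "s i = (SOME x. x \<in> B i \<inter> S)" for i
  have s: "s i \<in> B i" "s i \<in> S" if "i \<le> l" for i
    using B(3)[OF that] someI_ex[of "\<lambda>x. x \<in> B i \<inter> S"] unfolding s_def by auto
  have "\<exists>p R. p \<in> B 0 \<and> joins R p (s i) \<and> R \<subseteq> Restr E (B 0 \<union> B i) \<and>
      Domain R \<inter> (B 0 \<union> {s i}) \<subseteq> {p, s i}" if i: "1 \<le> i" "i \<le> l" for i
  proof -
    obtain u v where uv: "u \<in> B 0" "v \<in> B i" "(u, v) \<in> E" using B(5)[OF i] by blast
    have link: "linked E (B 0 \<union> B i)"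
      using linked_Un[OF symE B(2)[of 0] B(2)[OF i(2)] uv] by simp
    have conn: "(u, s i) \<in> (Restr E (B 0 \<union> B i))\<^sup>*"
      using linkedD[OF link, of u "s i"] uv(1) s(1)[OF i(2)] by blast
    have "s i \<notin> B 0" using B(4)[of 0 i] s(1)[OF i(2)] i by auto
    then have disj: "B 0 \<inter> {s i} = {}" by blast
    obtain a b R where R: "a \<in> B 0" "b \<in> {s i}" "joins R a b" "R \<subseteq> Restr E (B 0 \<union> B i)"
        "Domain R \<inter> (B 0 \<union> {s i}) \<subseteq> {a, b}"
      by (rule shortest_path_between[OF conn uv(1) singletonI disj symE])
    have "b = s i" using R(2) by simp
    then show ?thesis using R(1,3-5) by (intro exI[of _ a] exI[of _ R]) simp
  qed
  then obtain p R where pR: "\<And>i. 1 \<le> i \<Longrightarrow> i \<le> l \<Longrightarrow> p i \<in> B 0"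
    "\<And>i. 1 \<le> i \<Longrightarrow> i \<le> l \<Longrightarrow> joins (R i) (p i) (s i)"
    "\<And>i. 1 \<le> i \<Longrightarrow> i \<le> l \<Longrightarrow> R i \<subseteq> Restr E (B 0 \<union> B i)"
    by metis
  let ?I = "{1..l}"
  define F where "F = Restr E (B 0) \<union> (\<Union>i\<in>?I. R i)"
  have sym_R: "sym (R i)" if "i \<in> ?I" for i using pR(2)[of i] that by (simp add: joins_def)
  have subF: "subgraph_in W F"
    unfolding subgraph_in_def
  proof
    show "F \<subseteq> Restr E W" using pR(3) B(1) by (fastforce simp: F_def)
    show "sym F" unfolding F_def by (intro sym_Un sym_Restr symE sym_UNION) (use sym_R in auto)
  qed
  have fin: "finite F" using subgraph_in_finite[OF subF] .
  have to_s0: "(v, s 0) \<in> F\<^sup>*" if "v \<in> B 0" for v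
  proof (rule rtrancl_subset_mono)
    show "(v, s 0) \<in> (Restr E (B 0))\<^sup>*" using linkedD[OF B(2)[of 0] that] s(1)[of 0] by simp
  qed (simp add: F_def)
  have spansF: "spans F {s 0}"
    unfolding spans_def
  proof (intro conjI ballI)
    fix v assume "v \<in> Domain F"
    then have "v \<in> B 0 \<or> (\<exists>i\<in>?I. v \<in> Domain (R i))" unfolding F_def by blast
    then consider "v \<in> B 0" | i where "i \<in> ?I" "v \<in> Domain (R i)" by blast
    then show "\<exists>q\<in>{s 0}. (v, q) \<in> F\<^sup>*"
    proof cases
      case 2
      then have "(p i, v) \<in> (R i)\<^sup>*" using pR(2)[of i] by (simp add: joins_def)
      then have "(v, p i) \<in> (R i)\<^sup>*" using rtrancl_symD[OF sym_R] 2 by blast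
      then have "(v, p i) \<in> F\<^sup>*" by (rule rtrancl_subset_mono) (use 2 in \<open>auto simp: F_def\<close>)
      moreover have "(p i, s 0) \<in> F\<^sup>*" using pR(1)[of i] to_s0 2 by simp
      ultimately show ?thesis using rtrancl_trans by (metis singletonI)
    qed (use to_s0 in simp)
  qed simp
  have leaf: "s i \<in> terminals F" if i: "i \<in> ?I" for i
  proof -
    have other: "s i \<notin> B j" if "j \<le> l" "j \<noteq> i" for j
      using B(4)[of i j] s(1)[of i] that i by auto
    have "F `` {s i} = R i `` {s i}"
    proof
      show "F `` {s i} \<subseteq> R i `` {s i}"
      proof
        fix x assume "x \<in> F `` {s i}"
        then have "(s i, x) \<in> Restr E (B 0) \<or> (\<exists>j\<in>?I. (s i, x) \<in> R j)" unfolding F_def by blast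
        then consider "(s i, x) \<in> Restr E (B 0)" | j where "j \<in> ?I" "(s i, x) \<in> R j" by blast
        then show "x \<in> R i `` {s i}"
        proof cases
          case 1
          then show ?thesis using other[of 0] i by auto
        next
          case 2
          then have "s i \<in> B 0 \<union> B j" using pR(3)[of j] by auto
          then have "j = i" using other[of 0] other[of j] 2 i by auto
          then show ?thesis using 2 by simp
        qed
      qed
    qed (use i in \<open>auto simp: F_def\<close>)
    then have "deg F (s i) = 1" using pR(2)[of i] i by (simp add: joins_def)
    then show ?thesis using s(2)[of i] i th_pos by (simp add: terminals_def)
  qed
  have inj: "inj_on s {0..l}"
  proof (rule inj_onI)
    fix i j assume "i \<in> {0..l}" "j \<in> {0..l}" "s i = s j"
    then show "i = j" using B(4)[of i j] s(1)[of i] s(1)[of j] by auto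
  qed
  have "card (s ` ?I) = l" using card_image[OF inj_on_subset[OF inj, of ?I]] by simp
  moreover have "s ` ?I \<subseteq> terminals F" using leaf by blast
  ultimately have l_le: "l \<le> card (terminals F)" using card_mono[OF finite_terminals[OF fin]] by metis
  \<comment> \<open>The centre may be a single vertex without inner edges; then \<open>s 0\<close>
    is the start of the path into the first branch.\<close>
  have s0: "s 0 \<in> Domain F"
  proof (cases "p 1 = s 0")
    case True
    have "1 \<in> ?I" using l_pos by simp
    moreover have "s 0 \<in> Domain (R 1)" using joins_start_in_Domain[OF pR(2)[of 1]] l_pos True by simp
    ultimately show ?thesis unfolding F_def by blast
  next
    case False
    have "(s 0, p 1) \<in> F\<^sup>*" using rtrancl_symD[OF subgraph_in_sym[OF subF] to_s0] pR(1)[of 1] l_pos by simp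
    then show ?thesis using False by (auto elim: converse_rtranclE)
  qed
  have "s ` {0..l} \<subseteq> S \<inter> Domain F"
  proof -
    have "s i \<in> S \<inter> Domain F" if "i \<le> l" for i
      using s(2)[OF that] leaf[of i] terminals_subset[OF fin] s0 that by (cases "i = 0") auto
    then show ?thesis by auto
  qed
  then have "card (s ` {0..l}) \<le> card (S \<inter> Domain F)"
    using fin by (intro card_mono) (auto simp: finite_Domain)
  then have "l < card (S \<inter> Domain F)" using card_image[OF inj] by simp
  then show ?thesis using subF spansF l_le by blast
qed

section \<open>Starting trees when \<open>l\<close> is at most 2\<close>

lemma joins_excess: "joins R p q \<Longrightarrow> excess R = 0"
proof (rule excess_zeroI)
  fix v assume "joins R p q"
  then have "deg R v \<le> 2" by (simp add: joins_def)
  then show "deg R v \<le> 3" by simp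
qed

lemma joins_spans:
  assumes "joins R p q"
  shows "spans R {p}"
  using assms rtrancl_symD[of R] by (auto simp: joins_def spans_def)

text \<open>A path through two vertices of \<open>S\<close> suffices unless \<open>l = 2\<close> and
  no third vertex of \<open>S\<close> lies on it. Then a second path to a third vertex is attached,
  which creates at most one vertex of degree 3.\<close>

lemma star_model_forest_few:
  assumes "th = 2" "star_model W B"
  shows "\<exists>F q. subgraph_in W F \<and> excess F = 0 \<and> spans F {q} \<and> l < card (terminals F)"
proof -
  note B = star_modelD[OF assms(2)]
  define M where "M = (\<Union>i\<le>l. B i)"
  have M: "linked E M" "M \<subseteq> W" using star_model_linked[OF assms(2)] B(1) by (auto simp: M_def)
  define s where "s i = (SOME x. x \<in> B i \<inter> S)" for i
  have s: "s i \<in> B i" "s i \<in> S" "s i \<in> M" if "i \<le> l" for i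
    using B(3)[OF that] someI_ex[of "\<lambda>x. x \<in> B i \<inter> S"] that unfolding s_def M_def by auto
  have s_neq: "s i \<noteq> s j" if "i \<le> l" "j \<le> l" "i \<noteq> j" for i j
    using B(4)[OF that] s(1)[OF that(1)] s(1)[OF that(2)] by auto
  have conn: "(s 0, s 1) \<in> (Restr E M)\<^sup>*" using linkedD[OF M(1)] s(3) l_pos by simp
  have "{s 0} \<inter> {s 1} = {}" using s_neq[of 0 1] l_pos by simp
  then obtain p q R where "p \<in> {s 0}" "q \<in> {s 1}" and R: "joins R p q" "R \<subseteq> Restr E M"
    by (rule shortest_path_between[OF conn singletonI singletonI _ symE])
  then have pq: "p = s 0" "q = s 1" by auto
  have finR: "finite R" and symR: "sym R" using R(1) by (auto simp: joins_def)
  have subR: "subgraph_in W R" using R(2) M(2) symR by (auto simp: subgraph_in_def)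
  have tR: "x \<in> terminals R" if "x \<in> S" "x \<in> Domain R" for x
  proof -
    have "deg R x \<le> 2" using R(1) by (simp add: joins_def)
    then show ?thesis using that deg_pos_iff[OF finR, of x] assms(1) unfolding terminals_def by simp
  qed
  have pqR: "p \<in> Domain R" "q \<in> Domain R" using joins_start_in_Domain[OF R(1)] R(1) by (auto simp: joins_def)
  have pq_neq: "p \<noteq> q" using s_neq[of 0 1] l_pos pq by simp
  have pqS: "p \<in> S" "q \<in> S" using s(2) pq l_pos by auto
  show ?thesis
  proof (cases "l = 1")
    case True
    have "{p, q} \<subseteq> terminals R" using tR pqR pqS by blast
    then have "card {p, q} \<le> card (terminals R)" using finite_terminals[OF finR] by (intro card_mono)
    then have "l < card (terminals R)" using True pq_neq by simp
    then show ?thesis using subR joins_excess[OF R(1)] joins_spans[OF R(1)] by blast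
  next
    case False
    then have l: "l = 2" using th assms(1) by auto
    define t where "t = s 2"
    have t: "t \<in> S" "t \<in> M" "t \<noteq> p" "t \<noteq> q" using s[of 2] s_neq[of 2 0] s_neq[of 2 1] l pq by (auto simp: t_def)
    show ?thesis
    proof (cases "\<exists>x \<in> Domain R \<inter> S. x \<noteq> p \<and> x \<noteq> q")
      case True
      then obtain x where x: "x \<in> Domain R" "x \<in> S" "x \<noteq> p" "x \<noteq> q" by blast
      have "{p, q, x} \<subseteq> terminals R" using tR pqR pqS x by blast
      then have "card {p, q, x} \<le> card (terminals R)" using finite_terminals[OF finR] by (intro card_mono)
      then have "l < card (terminals R)" using l pq_neq x by simp
      then show ?thesis using subR joins_excess[OF R(1)] joins_spans[OF R(1)] by blast
    next
      case no_third: False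
      then have tR': "t \<notin> Domain R" using t by blast
      have "p \<in> M" using s(3)[of 0] pq by simp
      then have conn': "(p, t) \<in> (Restr E M)\<^sup>*" using linkedD[OF M(1)] t(2) by blast
      have "Domain R \<inter> {t} = {}" using tR' by blast
      then obtain c t' R' where "t' \<in> {t}" and R': "c \<in> Domain R" "joins R' c t'" "R' \<subseteq> Restr E M"
          "Domain R' \<inter> (Domain R \<union> {t}) \<subseteq> {c, t'}"
        by (rule shortest_path_between[OF conn' pqR(1) singletonI _ symE])
      then have t': "t' = t" by simp
      have finR': "finite R'" and symR': "sym R'" using R'(2) by (auto simp: joins_def)
      let ?F = "R \<union> R'"
      have subF: "subgraph_in W ?F" using subR R'(3) M(2) symR symR' sym_Un by (auto simp: subgraph_in_def)
      have deg_le: "deg ?F v \<le> deg R v + deg R' v" for v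
        using card_Un_le[of "R `` {v}" "R' `` {v}"] by (simp add: Un_Image)
      have degR: "deg R v \<le> 2" "deg R' v \<le> 2" for v using R(1) R'(2) by (auto simp: joins_def)
      have off: "deg R' v = 0" if "v \<in> Domain R" "v \<noteq> c" for v
      proof -
        have "v \<notin> Domain R'" using R'(4) that tR' t' by auto
        then have "R' `` {v} = {}" by auto
        then show ?thesis by simp
      qed
      have off': "deg R v = 0" if "v \<notin> Domain R" for v
      proof -
        have "R `` {v} = {}" using that by auto
        then show ?thesis by simp
      qed
      have c1: "deg R' c = 1" "deg R' t = 1" "deg R p = 1" "deg R q = 1"
        using R(1) R'(2) t' by (auto simp: joins_def)
      have "excess ?F = 0"
      proof (rule excess_zeroI)
        fix v
        show "deg ?F v \<le> 3"
          using deg_le[of v] degR[of v] off[of v] off'[of v] c1(1)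
          by (cases "v \<in> Domain R"; cases "v = c") auto
      qed
      moreover have "spans ?F {p}" using spans_add_path[OF joins_spans[OF R(1)] R'(2,1)] .
      moreover have "{p, q, t} \<subseteq> terminals ?F"
      proof -
        have mem: "v \<in> terminals ?F" if "v \<in> S" "v \<in> Domain ?F" "deg R v + deg R' v \<le> 2" for v
        proof -
          have "1 \<le> deg ?F v" using deg_pos_iff[of ?F v] finR finR' that(2) by blast
          moreover have "deg ?F v \<le> th" using deg_le[of v] that(3) assms(1) by simp
          ultimately show ?thesis using that(1) by (simp add: terminals_def)
        qed
        \<comment> \<open>Even if the second path starts at \<open>p\<close> or \<open>q\<close>,
          that end only reaches degree 2, which still counts as a terminal for
          \<open>th = 2\<close>.\<close>
        have "deg R' p \<le> 1" "deg R' q \<le> 1" using off pqR c1 by (metis le_refl zero_le)+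
        then have "deg R p + deg R' p \<le> 2" "deg R q + deg R' q \<le> 2" using c1 by linarith+
        then have "p \<in> terminals ?F" "q \<in> terminals ?F"
          using mem[OF pqS(1)] mem[OF pqS(2)] pqR by (simp_all only: Domain_Un_eq UnI1)
        moreover have "t \<in> terminals ?F"
        proof (rule mem[OF t(1)])
          show "t \<in> Domain ?F" using R'(2) t' by (auto simp: joins_def)
          show "deg R t + deg R' t \<le> 2" using off'[OF tR'] c1 by linarith
        qed
        ultimately show ?thesis by blast
      qed
      then have "card {p, q, t} \<le> card (terminals ?F)"
        using finite_terminals[OF subgraph_in_finite[OF subF]] by (intro card_mono)
      then have "l < card (terminals ?F)" using l pq_neq t by simp
      ultimately show ?thesis using subF by blast
    qed
  qed
qed

text \<open>A tree with \<open>l\<close> terminals and more than \<open>l\<close> vertices of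
  \<open>S\<close> is a model by itself, so one part suffices once the terminals are bounded by
  \<open>3 * l\<close>. Minimising the excess first gives this bound; maximal terminals and then
  minimal edges give stability.\<close>

lemma ex_packing_forest_hub:
  assumes "th = 1" "star_model W B"
    and none: "\<And>F Q. subgraph_in W F \<Longrightarrow> excess F = 0 \<Longrightarrow> spans F Q \<Longrightarrow> card (terminals F) \<le> l * card Q"
  shows "\<exists>F Q \<P>. packing_forest W F Q \<P>"
proof -
  have l3: "l \<ge> 3" using th assms(1) by auto
  \<comment> \<open>The last conjunct keeps a vertex of \<open>S\<close> for the centre when there
    are exactly \<open>l\<close> terminals; it may be an inner vertex of the tree.\<close>
  let ?g = "\<lambda>F. subgraph_in W F \<and> (\<exists>q. spans F {q}) \<and> l \<le> card (terminals F) \<and> l < card (S \<inter> Domain F)"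
  have g_of_terminals: "?g F" if "subgraph_in W F" "spans F {q}" "l < card (terminals F)" for F q
  proof -
    have "card (terminals F) \<le> card (S \<inter> Domain F)"
      using terminals_subset[OF subgraph_in_finite[OF that(1)]] subgraph_in_finite[OF that(1)]
      by (intro card_mono) (auto simp: finite_Domain)
    then show ?thesis using that by auto
  qed
  obtain F0 where F0: "?g F0" using star_model_forest[OF assms(1,2)] by blast
  obtain F1 where F1: "?g F1" "\<And>F. ?g F \<Longrightarrow> excess F1 \<le> excess F"
    using ex_has_least_nat[of ?g F0 excess] F0 by blast
  let ?g1 = "\<lambda>F. ?g F \<and> excess F = excess F1"
  have bound: "card (terminals F) \<le> card (Domain E)" if "?g1 F" for F
  proof -
    have sF: "subgraph_in W F" using that by blast
    have "terminals F \<subseteq> Domain F" using terminals_subset[OF subgraph_in_finite[OF sF]] by blast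
    also have "\<dots> \<subseteq> Domain E" using sF by (auto simp: subgraph_in_def)
    finally show ?thesis using finE by (intro card_mono) (auto simp: finite_Domain)
  qed
  obtain F2 where F2: "?g1 F2" "\<And>F. ?g1 F \<Longrightarrow> card (terminals F) \<le> card (terminals F2)"
    using ex_has_greatest_nat[of ?g1 F1 "\<lambda>F. card (terminals F)" "Suc (card (Domain E))"] F1(1) bound
    by (metis (mono_tags, lifting) le_imp_less_Suc)
  let ?g2 = "\<lambda>F. ?g1 F \<and> card (terminals F) = card (terminals F2)"
  obtain F where F: "?g2 F" "\<And>F'. ?g2 F' \<Longrightarrow> card F \<le> card F'"
    using ex_has_least_nat[of ?g2 F2 card] F2(1) by blast
  have sub: "subgraph_in W F" and terminals_ge: "l \<le> card (terminals F)" and S_gt: "l < card (S \<inter> Domain F)"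
    and excess_eq: "excess F = excess F1"
    using F(1) by auto
  obtain q where spans: "spans F {q}" using F(1) by blast
  have fin: "finite F" and sym: "sym F" using sub subgraph_in_finite by (auto simp: subgraph_in_def)
  have to_q: "(v, q) \<in> F\<^sup>*" if "v \<in> Domain F" for v using spans that by (simp add: spans_def)
  have conn: "(u, v) \<in> F\<^sup>*" if "u \<in> Domain F" "v \<in> Domain F" for u v
    using to_q[OF that(1)] rtrancl_symD[OF sym to_q[OF that(2)]] by (rule rtrancl_trans)
  have singleton: "\<exists>r. spans F' {r}" if "spans F' Q'" "card Q' \<le> 1" "Domain F' \<noteq> {}" for F' :: "'a rel" and Q'
  proof -
    have "finite Q'" "Q' \<noteq> {}" using that(1,3) unfolding spans_def by auto
    then have "card Q' = 1" using that(2) by (metis card_0_eq le_antisym less_one not_le)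
    then show ?thesis using that(1) by (metis card_1_singletonE)
  qed
  have min: "excess F \<le> excess F'" if "?g F'" for F' using F1(2)[OF that] excess_eq by simp
  have stable: "stable W F {q}"
  proof (rule stableI[OF sub spans])
    fix F' Q' assume *: "subgraph_in W F'" "spans F' Q'" "card Q' \<le> card {q}" "excess F' \<le> excess F"
    show "card (terminals F') \<le> card (terminals F)"
    proof (rule ccontr)
      assume more: "\<not> ?thesis"
      then have gt: "l < card (terminals F')" using terminals_ge by simp
      then have "terminals F' \<noteq> {}" by auto
      then have "Domain F' \<noteq> {}" using terminals_subset[OF subgraph_in_finite[OF *(1)]] by blast
      then obtain r where "spans F' {r}" using singleton[OF *(2)] *(3) by auto
      then have g: "?g F'" using g_of_terminals[OF *(1) _ gt] by blast
      then have "excess F' = excess F1" using min[OF g] *(4) excess_eq by simp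
      then have "card (terminals F') \<le> card (terminals F2)" using F2(2)[of F'] g by blast
      then show False using more F(1) by simp
    qed
  next
    fix F' Q' assume *: "F' \<subset> F" "subgraph_in W F'" "spans F' Q'" "card Q' \<le> card {q}" "terminals F \<subseteq> terminals F'"
      "S \<inter> Domain F \<subseteq> Domain F'"
    have fin': "finite F'" using subgraph_in_finite[OF *(2)] .
    have ge: "card (terminals F) \<le> card (terminals F')" using *(5) finite_terminals[OF fin'] by (intro card_mono)
    have "S \<inter> Domain F \<subseteq> S \<inter> Domain F'" using *(6) by blast
    then have "card (S \<inter> Domain F) \<le> card (S \<inter> Domain F')"
      using fin' by (intro card_mono) (auto simp: finite_Domain)
    then have gt': "l < card (S \<inter> Domain F')" using S_gt by simp
    then have "S \<inter> Domain F' \<noteq> {}" by auto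
    then have "Domain F' \<noteq> {}" by blast
    then obtain r where "spans F' {r}" using singleton[OF *(3)] *(4) by auto
    then have g: "?g F'" using *(2) ge terminals_ge gt' by auto
    have "excess F' \<le> excess F" using excess_mono[OF fin] *(1) by blast
    then have g1: "?g1 F'" using g min[OF g] excess_eq by simp
    have "card (terminals F') = card (terminals F2)" using F2(2)[OF g1] ge F(1) by simp
    then have "card F \<le> card F'" using F(2)[of F'] g1 by blast
    then show False using psubset_card_mono[OF fin *(1)] by simp
  next
    fix v assume v: "v \<in> Domain F"
    have "\<not> card (terminals F) \<le> Suc 0" using terminals_ge l3 by simp
    then obtain s t where st: "s \<in> terminals F" "t \<in> terminals F" "s \<noteq> t"
      using card_le_Suc0_iff_eq[OF finite_terminals[OF fin]] by auto
    then show "\<exists>s t. s \<in> terminals F \<and> t \<in> terminals F \<and> s \<noteq> t \<and> (v, s) \<in> F\<^sup>* \<and> (v, t) \<in> F\<^sup>*"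
      using conn[OF v] terminals_subset[OF fin] by blast
  qed
  have br: "bridged F" using stable by (simp add: stable_def)
  have leaf: "deg F v = 1" "v \<in> S" "v \<in> Domain F" if "v \<in> terminals F" for v
  proof -
    have "v \<in> S" "1 \<le> deg F v" "deg F v \<le> th" using that by (simp_all add: terminals_def)
    then show "deg F v = 1" "v \<in> S" using assms(1) by auto
    show "v \<in> Domain F" using terminals_subset[OF fin] that by blast
  qed
  have few: "card (terminals F) \<le> 3 * l"
  proof (cases "excess F = 0")
    case True
    then show ?thesis using none[OF sub True spans] by simp
  next
    case False
    then obtain v where v: "v \<in> Domain E" "deg F v - 3 \<noteq> 0"
      unfolding excess_def by (meson sum.neutral)
    then have "\<not> deg F v \<le> Suc 0" by simp
    then obtain z1 z2 where z: "(v, z1) \<in> F" "(v, z2) \<in> F" "z1 \<noteq> z2"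
      using card_le_Suc0_iff_eq[OF finite_Image_rel[OF fin, of "{v}"]] by auto
    \<comment> \<open>With more than \<open>l\<close> terminals left, the tree without this branch
      would still be admissible, and \<open>v\<close>, of degree at least 4, would lose an edge and
      lower the excess.\<close>
    have rest: "card (terminals F - side F v z) \<le> l" if vz: "(v, z) \<in> F" for z
    proof (rule ccontr)
      assume many: "\<not> ?thesis"
      let ?F = "Restr F (- side F v z)"
      have zv: "z \<noteq> v" using bridged_irrefl[OF br] vz by metis
      have vside: "v \<notin> side F v z" using zv by (rule not_in_side)
      have sF: "subgraph_in W ?F" using sub sym_Restr by (auto simp: subgraph_in_def)
      have "spans ?F {v}"
        unfolding spans_def
      proof (intro conjI ballI)
        fix x assume x: "x \<in> Domain ?F"
        then have "(v, x) \<in> F\<^sup>*" using conn[of v x] vz by auto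
        then have "(v, x) \<in> ?F\<^sup>*" using x zv by (intro rtrancl_outside_side) auto
        then show "\<exists>q\<in>{v}. (x, q) \<in> ?F\<^sup>*" using rtrancl_symD[OF subgraph_in_sym[OF sF]] by blast
      qed simp
      moreover have "terminals F - side F v z \<subseteq> terminals ?F"
      proof
        fix t assume t: "t \<in> terminals F - side F v z"
        then obtain w where w: "(t, w) \<in> F" using leaf(3) by blast
        have wt: "(w, t) \<in> F" using symD[OF sym w] .
        have "deg F t = 1" using leaf(1) t by blast
        then have "t \<noteq> v" using v by auto
        have "w \<notin> side F v z"
          using side_closed[OF _ wt \<open>t \<noteq> v\<close> zv] t by blast
        then have "t \<in> Domain ?F" using w t by auto
        then show "t \<in> terminals ?F" using terminals_reduce[OF fin, of ?F t] t by auto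
      qed
      then have "card (terminals F - side F v z) \<le> card (terminals ?F)"
        using finite_terminals[OF subgraph_in_finite[OF sF]] by (intro card_mono)
      then have "l < card (terminals ?F)" using many by simp
      ultimately have "excess F \<le> excess ?F" using min g_of_terminals[OF sF] by blast
      moreover have "excess ?F < excess F"
        unfolding excess_def
      proof (rule sum_strict_mono_ex1)
        show "finite (Domain E)" using finE by (rule finite_Domain)
        show "\<forall>x\<in>Domain E. deg ?F x - 3 \<le> deg F x - 3"
          using deg_mono[OF fin, of ?F] by (auto intro: diff_le_mono)
        have "z \<notin> ?F `` {v}" using side_refl[of z F v] by auto
        then have "?F `` {v} \<subset> F `` {v}" using vz by auto
        then have "deg ?F v < deg F v" using finite_Image_rel[OF fin] by (intro psubset_card_mono)
        then have "deg ?F v - 3 < deg F v - 3" using v(2) by simp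
        then show "\<exists>x\<in>Domain E. deg ?F x - 3 < deg F x - 3" using v(1) by blast
      qed
      ultimately show False by simp
    qed
    have "side F v z1 \<inter> side F v z2 = {}"
    proof (rule ccontr)
      assume "\<not> ?thesis"
      then obtain x where x: "(z1, x) \<in> (Restr F (- {v}))\<^sup>*" "(z2, x) \<in> (Restr F (- {v}))\<^sup>*"
        by (auto simp: side_def)
      have "(z1, z2) \<in> (Restr F (- {v}))\<^sup>*"
        using x(1) rtrancl_symD[OF sym_Restr[OF sym] x(2)] by (rule rtrancl_trans)
      then show False using bridged_neighbours_separated[OF br sym z(1,2)] z(3) by blast
    qed
    \<comment> \<open>Two disjoint branches: every terminal lies outside at least one of
      them.\<close>
    then have "terminals F = (terminals F - side F v z1) \<union> (terminals F - side F v z2)" by blast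
    then have "card (terminals F) \<le> card (terminals F - side F v z1) + card (terminals F - side F v z2)"
      using card_Un_le by metis
    then show ?thesis using rest[OF z(1)] rest[OF z(2)] by simp
  qed
  obtain L where L: "L \<subseteq> terminals F" "card L = l" "finite L"
    using obtain_subset_with_card_n[OF terminals_ge] by metis
  have "\<not> S \<inter> Domain F \<subseteq> L"
  proof
    assume "S \<inter> Domain F \<subseteq> L"
    then have "card (S \<inter> Domain F) \<le> card L" using L(3) by (intro card_mono)
    then show False using S_gt L(2) by simp
  qed
  then obtain s where s: "s \<in> S" "s \<in> Domain F" "s \<notin> L" by blast
  have link: "linked F (Domain F)"
  proof -
    have "F\<^sup>* `` {s} = Domain F"
    proof
      show "F\<^sup>* `` {s} \<subseteq> Domain F"
      proof
        fix x assume "x \<in> F\<^sup>* `` {s}"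
        then have "(x, s) \<in> F\<^sup>*" using rtrancl_symD[OF sym] by auto
        then show "x \<in> Domain F" using s(2) by (auto elim: converse_rtranclE)
      qed
      show "Domain F \<subseteq> F\<^sup>* `` {s}" using conn[OF s(2)] by blast
    qed
    then show ?thesis using reachable_linked[OF sym, of s] by simp
  qed
  have FE: "F \<subseteq> E" using sub by (auto simp: subgraph_in_def)
  have "\<exists>B. star_model (Domain F) B"
    by (rule star_modelI_singletons[OF FE sym link _ L(3,2), of s]) (use L s leaf in auto)
  then have "packing_forest W F {q} {Domain F}"
    unfolding packing_forest_def using stable few by auto
  then show ?thesis by blast
qed

text \<open>For \<open>th = 2\<close> a single model already gives a subcubic start with more than
  \<open>l\<close> terminals, so the remaining case has \<open>th = 1\<close>.\<close>

lemma ex_packing_forest: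
  assumes "star_model W B"
  shows "\<exists>F Q \<P>. packing_forest W F Q \<P>"
proof (cases "\<exists>F Q. subgraph_in W F \<and> excess F = 0 \<and> spans F Q \<and> l * card Q < card (terminals F)")
  case True
  then show ?thesis using ex_packing_forest_subcubic by blast
next
  case False
  have "th = 1"
  proof (rule ccontr)
    assume "th \<noteq> 1"
    then have "th = 2" using th by auto
    then obtain F q where F: "subgraph_in W F" "excess F = 0" "spans F {q}" "l < card (terminals F)"
      using star_model_forest_few[OF _ assms] by blast
    then have "l * card {q} < card (terminals F)" by simp
    then show False using False F by blast
  qed
  moreover have "card (terminals F) \<le> l * card Q" if "subgraph_in W F" "excess F = 0" "spans F Q" for F Q
    using False that not_less by blast
  ultimately show ?thesis using ex_packing_forest_hub[OF _ assms] by blast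
qed

section \<open>Packing and hitting\<close>

lemma star_model_mono:
  assumes "star_model U B" "(\<Union>i\<le>l. B i) \<subseteq> U'"
  shows "star_model U' B"
  using assms unfolding star_model_def by blast

lemma star_model_nonempty: "star_model P B \<Longrightarrow> P \<noteq> {}"
  using star_modelD(1,3)[of P B 0] by blast

text \<open>If the packing forest has only \<open>m < k\<close> parts, they are set aside. Models
  surviving the deletion of its hitting set miss \<open>F\<close>, so \<open>k - m\<close> and
  \<open>W - Domain F\<close> pose the same problem, and the models found there are disjoint from
  the \<open>m\<close> earlier ones.\<close>

theorem star_models_packing_or_hitting:
  assumes "finite W" "k \<ge> 1"
  shows "(\<exists>\<P>. finite \<P> \<and> k \<le> card \<P> \<and> pairwise disjnt \<P> \<and> (\<forall>P\<in>\<P>. P \<subseteq> W \<and> (\<exists>B. star_model P B))) \<or>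
    (\<exists>X\<subseteq>W. card X \<le> 21 * l * (k - 1) \<and> \<not> (\<exists>B. star_model (W - X) B))"
  using assms
proof (induction k arbitrary: W rule: less_induct)
  case (less k)
  show ?case
  proof (cases "\<exists>B. star_model W B")
    case False
    then show ?thesis by (intro disjI2 exI[of _ "{}"]) simp
  next
    case True
    then obtain F Q \<P> where pf: "packing_forest W F Q \<P>" using ex_packing_forest by blast
    then have stable: "stable W F Q" and \<P>: "finite \<P>" "\<P> \<noteq> {}" "pairwise disjnt \<P>"
      "\<And>P. P \<in> \<P> \<Longrightarrow> P \<subseteq> Domain F \<and> (\<exists>B. star_model P B)" "card (terminals F) \<le> 3 * l * card \<P>"
      unfolding packing_forest_def by blast+
    obtain X where X: "X \<subseteq> Domain F" "card X \<le> 6 * card (terminals F)"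
      "\<And>B. star_model (W - X) B \<Longrightarrow> (\<Union>i\<le>l. B i) \<inter> Domain F = {}"
      using stable_hitting_set[OF stable] by blast
    have FW: "Domain F \<subseteq> W" using stable by (auto simp: stable_def subgraph_in_def)
    define m where "m = card \<P>"
    have m: "m \<ge> 1" using \<P>(1,2) by (simp add: m_def Suc_le_eq card_gt_0_iff)
    show ?thesis
    proof (cases "k \<le> m")
      case True
      then have "k \<le> card \<P>" by (simp add: m_def)
      moreover have "\<forall>P\<in>\<P>. P \<subseteq> W \<and> (\<exists>B. star_model P B)"
        using \<P>(4) FW by (meson subset_trans)
      ultimately show ?thesis using \<P>(1,3) by (intro disjI1 exI[of _ \<P>]) simp
    next
      case False
      define W' where "W' = W - Domain F"
      have "k - m < k" "k - m \<ge> 1" "finite W'" using False m less.prems by (auto simp: W'_def)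
      from less.IH[OF this(1,3,2)] show ?thesis
      proof
        assume "\<exists>\<P>. finite \<P> \<and> k - m \<le> card \<P> \<and> pairwise disjnt \<P> \<and>
          (\<forall>P\<in>\<P>. P \<subseteq> W' \<and> (\<exists>B. star_model P B))"
        then obtain \<P>' where \<P>': "finite \<P>'" "k - m \<le> card \<P>'" "pairwise disjnt \<P>'"
          "\<And>P. P \<in> \<P>' \<Longrightarrow> P \<subseteq> W' \<and> (\<exists>B. star_model P B)" by blast
        have disj: "P \<inter> P' = {}" if "P \<in> \<P>" "P' \<in> \<P>'" for P P'
          using \<P>(4)[OF that(1)] \<P>'(4)[OF that(2)] unfolding W'_def by blast
        have "\<P> \<inter> \<P>' = {}"
        proof (rule ccontr)
          assume "\<P> \<inter> \<P>' \<noteq> {}"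
          then obtain P where "P \<in> \<P>" "P \<in> \<P>'" by blast
          then show False using disj[of P P] \<P>(4)[of P] star_model_nonempty by blast
        qed
        then have "k \<le> card (\<P> \<union> \<P>')" using \<P>(1) \<P>'(1,2) by (simp add: card_Un_disjoint m_def)
        moreover have "pairwise disjnt (\<P> \<union> \<P>')"
          using \<P>(3) \<P>'(3) disj by (auto simp: pairwise_def disjnt_def) blast+
        moreover have "\<forall>P\<in>\<P> \<union> \<P>'. P \<subseteq> W \<and> (\<exists>B. star_model P B)"
          using \<P>(4) \<P>'(4) FW unfolding W'_def by blast
        ultimately show ?thesis using \<P>(1) \<P>'(1) by blast
      next
        assume "\<exists>X\<subseteq>W'. card X \<le> 21 * l * (k - m - 1) \<and> \<not> (\<exists>B. star_model (W' - X) B)"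
        then obtain X' where X': "X' \<subseteq> W'" "card X' \<le> 21 * l * (k - m - 1)"
          "\<And>B. \<not> star_model (W' - X') B" by blast
        have "card (X \<union> X') \<le> card X + card X'" by (rule card_Un_le)
        also have "\<dots> \<le> 21 * l * m + 21 * l * (k - m - 1)"
          using X(2) \<P>(5) X'(2) unfolding m_def by linarith
        also have "\<dots> = 21 * l * (k - 1)"
          using False m by (simp add: add_mult_distrib2[symmetric])
        finally have "card (X \<union> X') \<le> 21 * l * (k - 1)" .
        moreover have "\<not> star_model (W - (X \<union> X')) B" for B
        proof
          assume B: "star_model (W - (X \<union> X')) B"
          have sub: "(\<Union>i\<le>l. B i) \<subseteq> W - (X \<union> X')" using star_modelD(1)[OF B] by blast
          then have "star_model (W - X) B" by (intro star_model_mono[OF B]) blast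
          then have "(\<Union>i\<le>l. B i) \<subseteq> W' - X'" using X(3) sub unfolding W'_def by blast
          then show False using X'(3) star_model_mono[OF B] by blast
        qed
        moreover have "X \<union> X' \<subseteq> W" using X(1) X'(1) FW unfolding W'_def by blast
        ultimately show ?thesis by blast
      qed
    qed
  qed
qed

end

section \<open>Translation from models in digraphs to \<open>star_model\<close>\<close>

lemma rtrancl_on_eq_rtrancl:
  assumes "u \<in> V" "r \<subseteq> V \<times> V"
  shows "(u, v) \<in> rtrancl_on V r \<longleftrightarrow> (u, v) \<in> r\<^sup>*"
proof
  show "(u, v) \<in> rtrancl_on V r \<Longrightarrow> (u, v) \<in> r\<^sup>*" by (rule rtrancl_on_rtranclI)
  assume "(u, v) \<in> r\<^sup>*"
  then show "(u, v) \<in> rtrancl_on V r"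
  proof (induction rule: rtrancl_induct)
    case (step y z)
    have "z \<in> V" using step.hyps(2) assms(2) by blast
    then show ?case using step.IH step.hyps(2) rtrancl_on_into_rtrancl_on by metis
  qed (use assms in simp)
qed

lemma arcs_ends_induce_subgraph: "arcs_ends (H \<restriction> V) = Restr (arcs_ends H) V"
  by (auto simp: arcs_ends_conv induce_subgraph_def)

lemma connected_induce_subgraph_iff:
  assumes "sym (arcs_ends H)"
  shows "connected (H \<restriction> B) \<longleftrightarrow> B \<noteq> {} \<and> linked (arcs_ends H) B"
proof -
  let ?r = "Restr (arcs_ends H) B"
  have "symcl ?r = ?r" using sym_Restr[OF assms, of B] by (auto simp: symcl_def dest: symD)
  then have "connected (H \<restriction> B) \<longleftrightarrow> B \<noteq> {} \<and> (\<forall>u\<in>B. \<forall>v\<in>B. (u, v) \<in> rtrancl_on B ?r)"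
    by (simp add: connected_conv arcs_ends_induce_subgraph)
  also have "\<dots> \<longleftrightarrow> B \<noteq> {} \<and> linked (arcs_ends H) B"
    using rtrancl_on_eq_rtrancl[of _ B ?r] by (auto simp: linked_def)
  finally show ?thesis .
qed

lemma (in rooted_graph) is_rooted_model_star_graph_iff:
  assumes "arcs_ends H = Restr E (verts H)"
  shows "is_rooted_model S (with_proj (star_graph l)) H B \<longleftrightarrow> star_model (verts H) B"
proof -
  let ?V = "verts H"
  have symH: "sym (arcs_ends H)" using assms sym_Restr[OF symE] by simp
  have linked: "linked (arcs_ends H) Z \<longleftrightarrow> linked E Z" if "Z \<subseteq> ?V" for Z
  proof -
    have "Restr (arcs_ends H) Z = Restr E Z" using assms that by auto
    then show ?thesis by (simp add: linked_def)
  qed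
  have adj: "(\<exists>u\<in>X. \<exists>v\<in>Y. u \<rightarrow>\<^bsub>H\<^esub> v) \<longleftrightarrow> (\<exists>u\<in>X. \<exists>v\<in>Y. (u, v) \<in> E)"
    if "X \<subseteq> ?V" "Y \<subseteq> ?V" for X Y unfolding assms using that by blast
  have adj_sym: "(\<exists>u\<in>X. \<exists>v\<in>Y. (u, v) \<in> E) \<longleftrightarrow> (\<exists>u\<in>Y. \<exists>v\<in>X. (u, v) \<in> E)" for X Y
    using symD[OF symE] by blast
  have conn: "connected (H \<restriction> Z) \<longleftrightarrow> Z \<noteq> {} \<and> linked E Z" if "Z \<subseteq> ?V" for Z
    using connected_induce_subgraph_iff[OF symH] linked[OF that] by simp
  have star: "x \<rightarrow>\<^bsub>with_proj (star_graph l)\<^esub> y \<longleftrightarrow>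
      x = 0 \<and> 1 \<le> y \<and> y \<le> l \<or> y = 0 \<and> 1 \<le> x \<and> x \<le> l" for x y
    by (auto simp: star_graph_def)
  have verts: "verts (with_proj (star_graph l)) = {..l}" by (auto simp: star_graph_def)
  show ?thesis
  proof
    assume M: "is_rooted_model S (with_proj (star_graph l)) H B"
    have V: "B i \<subseteq> ?V" if "i \<le> l" for i
      using M that unfolding is_rooted_model_def is_model_def verts by blast
    show "star_model ?V B"
      unfolding star_model_def
    proof (intro conjI allI impI)
      fix i assume i: "i \<le> l"
      show "B i \<subseteq> ?V" using V[OF i] .
      show "linked E (B i)" using M i conn[OF V[OF i]]
        unfolding is_rooted_model_def is_model_def verts by blast
      show "B i \<inter> S \<noteq> {}" using M i unfolding is_rooted_model_def verts by blast
      show "B i \<inter> B j = {}" if "j \<le> l" "i \<noteq> j" for j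
        using M i that unfolding is_rooted_model_def is_model_def verts disjoint_family_on_def by blast
    next
      fix i assume i: "1 \<le> i \<and> i \<le> l"
      then have "0 \<rightarrow>\<^bsub>with_proj (star_graph l)\<^esub> i" unfolding star by simp
      then have "\<exists>u\<in>B 0. \<exists>v\<in>B i. u \<rightarrow>\<^bsub>H\<^esub> v"
        using M unfolding is_rooted_model_def is_model_def by blast
      then show "\<exists>u\<in>B 0. \<exists>v\<in>B i. (u, v) \<in> E" using adj[OF V V] i by blast
    qed
  next
    assume M: "star_model ?V B"
    note D = star_modelD[OF M]
    show "is_rooted_model S (with_proj (star_graph l)) H B"
      unfolding is_rooted_model_def is_model_def verts disjoint_family_on_def
    proof (intro conjI ballI allI impI)
      fix i assume "i \<in> {..l}"
      then have i: "i \<le> l" by simp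
      show "B i \<subseteq> ?V" "B i \<inter> S \<noteq> {}" using D(1,3)[OF i] .
      then show "B i \<noteq> {}" by blast
      then show "connected (H \<restriction> B i)" using conn[OF D(1)[OF i]] D(2)[OF i] by blast
      show "B i \<inter> B j = {}" if "j \<in> {..l}" "i \<noteq> j" for j using D(4) i that by simp
    next
      fix x y assume "x \<rightarrow>\<^bsub>with_proj (star_graph l)\<^esub> y"
      then have "x = 0 \<and> 1 \<le> y \<and> y \<le> l \<or> y = 0 \<and> 1 \<le> x \<and> x \<le> l" unfolding star .
      then show "\<exists>u\<in>B x. \<exists>v\<in>B y. u \<rightarrow>\<^bsub>H\<^esub> v"
      proof
        assume "x = 0 \<and> 1 \<le> y \<and> y \<le> l"
        then show ?thesis using D(5)[of y] adj[OF D(1) D(1), of x y] by simp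
      next
        assume "y = 0 \<and> 1 \<le> x \<and> x \<le> l"
        then show ?thesis using D(5)[of x] adj[OF D(1) D(1), of x y] adj_sym[of "B x" "B y"] by simp
      qed
    qed
  qed
qed

theorem theorem24:
  fixes G :: "'a pair_pre_digraph" and S :: "'a set" and k l :: nat
  assumes "pair_graph G" and "S \<subseteq> pverts G" and "k \<ge> 1" and "l \<ge> 1"
  shows "has_disjoint_rooted_models k S (with_proj (star_graph l)) (with_proj G) \<or>
    (\<exists>X \<subseteq> pverts G. card X \<le> 21 * l * (k - 1) \<and>
       \<not> (\<exists>B. is_rooted_model S (with_proj (star_graph l)) (delete_verts (with_proj G) X) B))"
proof -
  interpret G: pair_graph G by (rule assms(1))
  let ?E = "parcs G" and ?V = "pverts G" and ?H = "with_proj (star_graph l)"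
  \<comment> \<open>The threshold is 1 when pigeonhole on three branches is available, and 2 for the
    small stars.\<close>
  interpret R: rooted_graph ?E S l "if l \<ge> 3 then 1 else 2"
  proof
    show "finite ?E" by (rule G.pair_finite_arcs)
    show "sym ?E" using G.arcs_symmetric by (auto intro: symI)
    show "(v, v) \<notin> ?E" for v using G.pair_no_loops by fastforce
  qed (use assms(4) in auto)
  have EV: "Restr ?E ?V = ?E" using G.arc_fst_in_verts G.arc_snd_in_verts by fastforce
  have model: "is_rooted_model S ?H (with_proj G) B \<longleftrightarrow> R.star_model ?V B" for B
    using R.is_rooted_model_star_graph_iff[of "with_proj G"] EV by simp
  have "verts (delete_verts (with_proj G) X) = ?V - X" for X by (simp add: delete_verts_def)
  moreover have "arcs_ends (delete_verts (with_proj G) X) = Restr ?E (?V - X)" for X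
    by (simp add: delete_verts_def arcs_ends_induce_subgraph)
  ultimately have model_del:
    "is_rooted_model S ?H (delete_verts (with_proj G) X) B \<longleftrightarrow> R.star_model (?V - X) B" for X B
    using R.is_rooted_model_star_graph_iff[of "delete_verts (with_proj G) X"] by simp
  from R.star_models_packing_or_hitting[OF G.pair_finite_verts assms(3)] show ?thesis
  proof
    assume "\<exists>\<P>. finite \<P> \<and> k \<le> card \<P> \<and> pairwise disjnt \<P> \<and>
      (\<forall>P\<in>\<P>. P \<subseteq> ?V \<and> (\<exists>B. R.star_model P B))"
    then obtain \<P> where \<P>: "finite \<P>" "k \<le> card \<P>" "pairwise disjnt \<P>"
      "\<And>P. P \<in> \<P> \<Longrightarrow> P \<subseteq> ?V" "\<And>P. P \<in> \<P> \<Longrightarrow> \<exists>B. R.star_model P B" by blast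
    obtain f where f: "bij_betw f {0..<card \<P>} \<P>" using ex_bij_betw_nat_finite[OF \<P>(1)] by blast
    have f_in: "f i \<in> \<P>" if "i < k" for i using bij_betwE[OF f] that \<P>(2) by simp
    define M where "M i = (SOME B. R.star_model (f i) B)" for i
    have M: "R.star_model (f i) (M i)" if "i < k" for i
      unfolding M_def using someI_ex[OF \<P>(5)[OF f_in[OF that]]] .
    have M_sub: "(\<Union>x\<in>verts ?H. M i x) \<subseteq> f i" if "i < k" for i
    proof -
      have "verts ?H = {..l}" by (auto simp: star_graph_def)
      then show ?thesis using R.star_modelD(1)[OF M[OF that]] by blast
    qed
    have "is_rooted_model S ?H (with_proj G) (M i)" if "i < k" for i
    proof -
      have "(\<Union>x\<le>l. M i x) \<subseteq> ?V" using R.star_modelD(1)[OF M[OF that]] \<P>(4)[OF f_in[OF that]] by blast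
      then show ?thesis unfolding model by (rule R.star_model_mono[OF M[OF that]])
    qed
    moreover have "disjoint_family_on (\<lambda>i. \<Union>x\<in>verts ?H. M i x) {..<k}"
      unfolding disjoint_family_on_def
    proof (intro ballI impI)
      fix i j assume ij: "i \<in> {..<k}" "j \<in> {..<k}" "i \<noteq> j"
      then have "f i \<noteq> f j" using inj_onD[OF bij_betw_imp_inj_on[OF f], of i j] \<P>(2) by auto
      then have "f i \<inter> f j = {}"
        using pairwiseD[OF \<P>(3)] f_in ij by (auto simp: disjnt_def)
      then show "(\<Union>x\<in>verts ?H. M i x) \<inter> (\<Union>x\<in>verts ?H. M j x) = {}"
        using M_sub ij by blast
    qed
    ultimately show ?thesis unfolding has_disjoint_rooted_models_def by blast
  next
    assume "\<exists>X\<subseteq>?V. card X \<le> 21 * l * (k - 1) \<and> \<not> (\<exists>B. R.star_model (?V - X) B)"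
    then show ?thesis unfolding model_del by blast
  qed
qed

end
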